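(* Let $N=2$ and $n\ge1$. Suppose $\phi:\mathbb{R}^n\to[0,\infty)$ is a smooth radial kernel with $\phi(x)>0$ for $|x|<r_0$ and $\phi(x)=0$ for $|x|\ge r_0$, where $r_0>0$. Let $U\in W^{2,\infty}_{\mathrm{loc}}(\mathbb{R}^n)$ be a radial potential, $U=U(r)\ge0$ with $r=|x|$, such that $U(r)\to\infty$ as $r\to\infty$, $$U'(r)\,\phi'(r)\le0\qquad\forall r\ge0,$$ and for every $R>0$ there exists $c_R>0$ such that $$|U'(r)|^2\ge c_R|U(r)|\qquad\forall r<R.$$ Consider the system $$\dot x_i=v_i,\qquad \dot v_i=\frac12\sum_{j=1}^2\phi(x_i-x_j)(v_j-v_i)-\frac12\sum_{j=1}^2\nabla U(x_i-x_j),\qquad i=1,2,$$ with initial data $(\mathbf{x}_0,\mathbf{v}_0)\in\mathbb{R}^{2n}\times\mathbb{R}^{2n}$, and let $$\mathcal{H}=\{(\mathbf{x}_0,\mathbf{v}_0)\in\mathbb{R}^{2n}\times\mathbb{R}^{2n}:\ |x_1(t)-x_2(t)|\ge r_0\ \ \forall t\ge0\}.$$ Then for Lebesgue-almost every initial datum $(\mathbf{x}_0,\mathbf{v}_0)\in(\mathbb{R}^{2n}\times\mathbb{R}^{2n})\setminus\mathcal{H}$ the solution satisfies $$U(x_1(t)-x_2(t))+|v_1(t)-v_2(t)|\to0\quad\text{as }t\to\infty.$$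
   Context: $\mathbf{x}=(x_1,x_2)$, $\mathbf{v}=(v_1,v_2)$ with $x_i,v_i\in\mathbb{R}^n$; $(\mathbf{x}(t),\mathbf{v}(t))$ denotes the solution with initial datum $(\mathbf{x}_0,\mathbf{v}_0)$. For radial functions, $\phi(x)=\phi(|x|)$ and $U(x)=U(|x|)$, and $\phi'$, $U'$ denote derivatives of the radial profiles with respect to $r=|x|$. The term $\nabla U(0)$ (self-interaction $j=i$) equals $0$. *)

theory Defs
  imports "HOL-Analysis.Analysis"
begin

section \<open>Smooth functions, gradients, Sobolev spaces\<close>

definition partial_deriv :: "'a::euclidean_space \<Rightarrow> ('a \<Rightarrow> real) \<Rightarrow> 'a \<Rightarrow> real" where
  "partial_deriv b f x = frechet_derivative f (at x) b"

primrec C_k :: "nat \<Rightarrow> ('a::euclidean_space \<Rightarrow> real) \<Rightarrow> bool" where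
  "C_k 0 f \<longleftrightarrow> continuous_on UNIV f"
| "C_k (Suc k) f \<longleftrightarrow> f differentiable_on UNIV \<and> (\<forall>b\<in>Basis. C_k k (partial_deriv b f))"

definition smooth :: "('a::euclidean_space \<Rightarrow> real) \<Rightarrow> bool" where
  "smooth f \<longleftrightarrow> (\<forall>k. C_k k f)"

definition gradient :: "('a::euclidean_space \<Rightarrow> real) \<Rightarrow> 'a \<Rightarrow> 'a" where
  "gradient f x = (THE D. GDERIV f x :> D)"

definition test_function :: "('a::euclidean_space \<Rightarrow> real) \<Rightarrow> bool" where
  "test_function \<psi> \<longleftrightarrow> smooth \<psi> \<and> (\<exists>K. compact K \<and> (\<forall>x. x \<notin> K \<longrightarrow> \<psi> x = 0))"

definition Linf_loc :: "('a::euclidean_space \<Rightarrow> real) \<Rightarrow> bool" where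
  "Linf_loc f \<longleftrightarrow> f \<in> borel_measurable lebesgue \<and>
     (\<forall>K. compact K \<longrightarrow> (\<exists>C. AE x in lebesgue. x \<in> K \<longrightarrow> \<bar>f x\<bar> \<le> C))"

text \<open>Only used for \<open>f\<close> and \<open>g\<close> in \<open>Linf_loc\<close>, where both integrands are integrable.\<close>

definition weak_partial_deriv ::
    "'a::euclidean_space \<Rightarrow> ('a \<Rightarrow> real) \<Rightarrow> ('a \<Rightarrow> real) \<Rightarrow> bool" where
  "weak_partial_deriv b f g \<longleftrightarrow>
     (\<forall>\<psi>. test_function \<psi> \<longrightarrow>
        (LINT x|lebesgue. f x * partial_deriv b \<psi> x) = - (LINT x|lebesgue. g x * \<psi> x))"

text \<open>\<open>W_inf_loc k\<close> is the space \<open>W\<^sup>k\<^sup>,\<^sup>\<infinity>\<^sub>l\<^sub>o\<^sub>c\<close> on the whole space, with the weak derivatives of higher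
  order obtained by iterating those of first order. The predicate is invariant under changes on null
  sets; wherever point values matter, continuity is assumed separately to select the continuous
  representative (which for \<open>k = 2\<close> is \<open>C\<^sup>1\<close>, so that its gradient is defined everywhere).\<close>

primrec W_inf_loc :: "nat \<Rightarrow> ('a::euclidean_space \<Rightarrow> real) \<Rightarrow> bool" where
  "W_inf_loc 0 f \<longleftrightarrow> Linf_loc f"
| "W_inf_loc (Suc k) f \<longleftrightarrow>
     Linf_loc f \<and> (\<forall>b\<in>Basis. \<exists>g. weak_partial_deriv b f g \<and> W_inf_loc k g)"


section \<open>Radial profiles\<close>

text \<open>The derivative of a profile with respect to \<open>r \<ge> 0\<close>, one-sided at \<open>r = 0\<close>; the values of
  the profile at negative arguments play no role.\<close>

definition profile_deriv :: "(real \<Rightarrow> real) \<Rightarrow> real \<Rightarrow> real" where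
  "profile_deriv f r = vector_derivative f (at r within {0..})"


section \<open>The two-agent system\<close>

text \<open>The state is \<open>(x, v)\<close>, with \<open>x $ i\<close> and \<open>v $ i\<close> the position and velocity of agent \<open>i\<close>,
  where the index type \<open>2\<close> has exactly the elements \<open>1\<close> and \<open>2\<close>.\<close>

type_synonym 'n state = "(real^'n^2) \<times> (real^'n^2)"

definition is_solution ::
    "(real^'n \<Rightarrow> real) \<Rightarrow> (real^'n \<Rightarrow> real) \<Rightarrow> (real \<Rightarrow> 'n::finite state) \<Rightarrow> bool" where
  "is_solution \<phi> U z \<longleftrightarrow> (\<forall>t\<ge>0. \<forall>i.
     ((\<lambda>s. fst (z s) $ i) has_vector_derivative snd (z t) $ i) (at t within {0..}) \<and>
     ((\<lambda>s. snd (z s) $ i) has_vector_derivative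
        ((1/2) *\<^sub>R (\<Sum>j\<in>UNIV. \<phi> (fst (z t) $ i - fst (z t) $ j) *\<^sub>R (snd (z t) $ j - snd (z t) $ i))
         - (1/2) *\<^sub>R (\<Sum>j\<in>UNIV. gradient U (fst (z t) $ i - fst (z t) $ j))))
       (at t within {0..}))"

text \<open>The solution on \<open>t \<ge> 0\<close> with initial datum \<open>z\<^sub>0\<close>. Under the hypotheses of interest the vector
  field is locally Lipschitz and the energy bounds the motion, so a global solution exists and is
  unique on \<open>t \<ge> 0\<close>; the choice only concerns the irrelevant values at \<open>t < 0\<close>.\<close>

definition solution ::
    "(real^'n \<Rightarrow> real) \<Rightarrow> (real^'n \<Rightarrow> real) \<Rightarrow> 'n::finite state \<Rightarrow> real \<Rightarrow> 'n state" where
  "solution \<phi> U z\<^sub>0 = (SOME z. is_solution \<phi> U z \<and> z 0 = z\<^sub>0)"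

definition rel_pos :: "'n::finite state \<Rightarrow> real^'n" where
  "rel_pos z = fst z $ 1 - fst z $ 2"

definition rel_vel :: "'n::finite state \<Rightarrow> real^'n" where
  "rel_vel z = snd z $ 1 - snd z $ 2"

definition noninteracting_data ::
    "(real^'n \<Rightarrow> real) \<Rightarrow> (real^'n \<Rightarrow> real) \<Rightarrow> real \<Rightarrow> 'n::finite state set" where
  "noninteracting_data \<phi> U r\<^sub>0 = {z\<^sub>0. \<forall>t\<ge>0. norm (rel_pos (solution \<phi> U z\<^sub>0 t)) \<ge> r\<^sub>0}"

end

theory Submission
  imports Defs
begin

text \<open>
  The relative coordinates \<open>x = x\<^sub>1 - x\<^sub>2\<close>, \<open>v = v\<^sub>1 - v\<^sub>2\<close> satisfy \<open>x' = v\<close>,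
  \<open>v' = - \<phi>(x) v - \<nabla>U(x)\<close>. The energy \<open>|v|\<^sup>2 / 2 + U(x)\<close> decreases, and the claim is that for almost
  every interacting datum its limit is \<open>0\<close>. Suppose that the limit is positive. By LaSalle's principle
  the limit points of the trajectory satisfy \<open>|x| \<ge> r\<^sub>0\<close>, and the angular momentum \<open>|x \<and> v|\<close>, which
  decays at the rate \<open>\<phi>\<close>, keeps a positive limit. The energy relative to the effective potential
  at a fixed radius shows that a particle which has left a ball with \<open>|x| < r\<^sub>0\<close> can never turn back
  towards the centre and out again, so \<open>|x|\<close> is eventually monotone and \<open>x \<bullet> v \<rightarrow> 0\<close>.

  Phase space volume decays at the rate \<open>n \<phi>\<close>, so the density \<open>|x \<and> v|\<^sup>-\<^sup>n\<close> is invariant. Where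
  the angular momentum stays bounded below, a set of data with \<open>x \<bullet> v \<rightarrow> 0\<close> is carried, without
  substantial loss of volume, into arbitrarily thin neighbourhoods of the null set \<open>x \<bullet> v = 0\<close>, and
  is therefore null itself. Since \<open>\<nabla>U\<close> is only locally Lipschitz, the invariance is used for a
  splitting scheme that approximates the flow and preserves the same density exactly.
\<close>

section \<open>Smooth functions and test functions\<close>

text \<open>The lower bound on |U'|^2 enters through one consequence: \<open>U\<close> vanishes
  wherever its gradient does. Hence the profile of \<open>U\<close> is nondecreasing, which drives
  the barrier estimate, and a trajectory that rests has energy 0, which drives LaSalle's principle.
  In dimension one \<open>am\<close> is identically 0, so the positivity of its limit already
  settles every datum. In higher dimensions a trajectory might escape the drag by creeping towards a
  circular motion at a radius of at least r_0, and this is not ruled out datum by datum. It is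
  exceptional because x . v = 0 costs one dimension, while transport up to any time loses volume
  only by a factor controlled by the ratio of angular momenta. The obstacle on the way is the
  eventual monotonicity of |x|: where \<phi> vanishes the energy gives no information. The remedy
  combines energy and angular momentum: the barrier and the squared angular momentum obey linear
  equations with the same rate 2 \<phi>, and their quotient is monotone as long as the particle
  stays outside the chosen radius.\<close>

lemma frechet_derivative_at_eq:
  "(f has_derivative f') (at x) \<Longrightarrow> frechet_derivative f (at x) = f'"
  using frechet_derivative_at by metis

lemma partial_deriv_eq:
  "(f has_derivative f') (at x) \<Longrightarrow> partial_deriv b f x = f' b"
  by (simp add: partial_deriv_def frechet_derivative_at_eq)

lemma differentiable_has_partial_derivs:
  fixes f :: "'a::euclidean_space \<Rightarrow> real"
  assumes "f differentiable (at x)"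
  shows "(f has_derivative (\<lambda>h. \<Sum>b\<in>Basis. (h \<bullet> b) * partial_deriv b f x)) (at x)"
proof -
  let ?D = "frechet_derivative f (at x)"
  have D: "(f has_derivative ?D) (at x)"
    using assms frechet_derivative_works by blast
  then have l: "linear ?D" by (simp add: has_derivative_linear)
  have "?D h = (\<Sum>b\<in>Basis. (h \<bullet> b) * partial_deriv b f x)" for h
  proof -
    have "?D h = ?D (\<Sum>b\<in>Basis. (h \<bullet> b) *\<^sub>R b)" by (simp add: euclidean_representation)
    also have "\<dots> = (\<Sum>b\<in>Basis. (h \<bullet> b) * partial_deriv b f x)"
      using l by (simp add: linear_sum linear_scale partial_deriv_def)
    finally show ?thesis .
  qed
  then have "?D = (\<lambda>h. \<Sum>b\<in>Basis. (h \<bullet> b) * partial_deriv b f x)" by auto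
  with D show ?thesis by simp
qed

lemma C_k_Suc_diff: "C_k (Suc k) f \<Longrightarrow> f differentiable (at x)"
  by (simp add: differentiable_on_def)

lemma C_k_SucD: "C_k (Suc k) f \<Longrightarrow> C_k k f"
proof (induction k arbitrary: f)
  case 0
  then show ?case by (auto simp: differentiable_imp_continuous_on)
next
  case (Suc k)
  then show ?case by simp
qed

lemma C_k_const: "C_k k (\<lambda>x. c :: real)"
proof (induction k arbitrary: c)
  case (Suc k)
  have "partial_deriv b (\<lambda>x. c) = (\<lambda>x. 0)" for b :: 'a
    using partial_deriv_eq[OF has_derivative_const] by auto
  then show ?case using Suc by simp
qed simp

lemma C_k_inner_right: "C_k k (\<lambda>x. x \<bullet> c)"
proof (cases k)
  case (Suc j)
  have "partial_deriv b (\<lambda>x. x \<bullet> c) x = b \<bullet> c" for b x :: 'a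
    by (rule partial_deriv_eq) (auto intro!: derivative_eq_intros)
  then have "partial_deriv b (\<lambda>x. x \<bullet> c) = (\<lambda>x. b \<bullet> c)" for b :: 'a by auto
  then show ?thesis using Suc by (simp add: C_k_const differentiable_on_def)
qed (auto intro!: continuous_intros)

lemma C_k_add: "C_k k f \<Longrightarrow> C_k k g \<Longrightarrow> C_k k (\<lambda>x. f x + g x)"
proof (induction k arbitrary: f g)
  case 0
  then show ?case by (auto intro: continuous_intros)
next
  case (Suc k)
  have "partial_deriv b (\<lambda>x. f x + g x) = (\<lambda>x. partial_deriv b f x + partial_deriv b g x)" if "b \<in> Basis" for b
  proof
    fix x
    show "partial_deriv b (\<lambda>x. f x + g x) x = partial_deriv b f x + partial_deriv b g x"
      using that partial_deriv_eq[OF has_derivative_add[OF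
        C_k_Suc_diff[OF Suc.prems(1), THEN differentiable_has_partial_derivs]
        C_k_Suc_diff[OF Suc.prems(2), THEN differentiable_has_partial_derivs]], of b x]
      by (simp add: inner_Basis if_distrib if_distribR sum.delta cong: if_cong)
  qed
  then show ?case using Suc by (auto intro: differentiable_on_add)
qed

lemma C_k_mult: "C_k k f \<Longrightarrow> C_k k g \<Longrightarrow> C_k k (\<lambda>x. f x * g x)"
proof (induction k arbitrary: f g)
  case 0
  then show ?case by (auto intro: continuous_intros)
next
  case (Suc k)
  have "partial_deriv b (\<lambda>x. f x * g x) = (\<lambda>x. f x * partial_deriv b g x + partial_deriv b f x * g x)" if "b \<in> Basis" for b
  proof
    fix x
    show "partial_deriv b (\<lambda>x. f x * g x) x = f x * partial_deriv b g x + partial_deriv b f x * g x"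
      using that partial_deriv_eq[OF has_derivative_mult[OF
        C_k_Suc_diff[OF Suc.prems(1), THEN differentiable_has_partial_derivs]
        C_k_Suc_diff[OF Suc.prems(2), THEN differentiable_has_partial_derivs]], of b x]
      by (simp add: inner_Basis if_distrib if_distribR sum.delta cong: if_cong)
  qed
  moreover have "C_k k f" "C_k k g" using Suc.prems C_k_SucD by blast+
  ultimately show ?case using Suc.prems Suc.IH
    by (auto intro!: C_k_add simp: differentiable_on_mult)
qed

lemma partial_deriv_affine:
  fixes f :: "'a::euclidean_space \<Rightarrow> real"
  assumes "f differentiable (at (a + c *\<^sub>R y))" "b \<in> Basis"
  shows "partial_deriv b (\<lambda>y. f (a + c *\<^sub>R y)) y = c * partial_deriv b f (a + c *\<^sub>R y)"
    and "(\<lambda>y. f (a + c *\<^sub>R y)) differentiable (at y)"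
proof -
  have 1: "((\<lambda>y. a + c *\<^sub>R y) has_derivative (\<lambda>h. c *\<^sub>R h)) (at y)"
    by (auto intro!: derivative_eq_intros)
  have D: "((\<lambda>y. f (a + c *\<^sub>R y)) has_derivative
     (\<lambda>h. \<Sum>b\<in>Basis. ((c *\<^sub>R h) \<bullet> b) * partial_deriv b f (a + c *\<^sub>R y))) (at y)"
    by (rule has_derivative_compose[OF 1 differentiable_has_partial_derivs[OF assms(1)]])
  show "partial_deriv b (\<lambda>y. f (a + c *\<^sub>R y)) y = c * partial_deriv b f (a + c *\<^sub>R y)"
    using partial_deriv_eq[OF D, of b] assms(2)
    by (simp add: inner_Basis if_distrib if_distribR sum.delta cong: if_cong)
  show "(\<lambda>y. f (a + c *\<^sub>R y)) differentiable (at y)"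
    using D differentiable_def by blast
qed

lemma C_k_affine: "C_k k f \<Longrightarrow> C_k k (\<lambda>y. f (a + c *\<^sub>R y))"
proof (induction k arbitrary: f)
  case 0
  then show ?case by (auto intro!: continuous_intros continuous_on_compose2[of UNIV f])
next
  case (Suc k)
  have "partial_deriv b (\<lambda>y. f (a + c *\<^sub>R y)) = (\<lambda>y. c * partial_deriv b f (a + c *\<^sub>R y))"
    if "b \<in> Basis" for b
    using partial_deriv_affine(1)[OF C_k_Suc_diff[OF Suc.prems] that] by auto
  moreover have "(\<lambda>y. f (a + c *\<^sub>R y)) differentiable (at y)" for y
    using partial_deriv_affine(2)[OF C_k_Suc_diff[OF Suc.prems] SOME_Basis] by auto
  ultimately show ?case using Suc
    by (auto intro!: C_k_mult[OF C_k_const] simp: differentiable_on_def)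
qed

section \<open>A smooth bump function\<close>

text \<open>The powers \<open>t ^ m\<close> in the denominator make the family closed under
  differentiation up to linear combinations, so one induction gives the smoothness of the bump
  \<open>flat_exp 0 (1 - x \<bullet> x)\<close>.\<close>

definition flat_exp :: "nat \<Rightarrow> real \<Rightarrow> real" where
  "flat_exp m t = (if t > 0 then exp (- (1 / t)) / t ^ m else 0)"

lemma flat_exp_tendsto_0: "(flat_exp m \<longlongrightarrow> 0) (at_right 0)"
proof -
  have "((\<lambda>s::real. s ^ m / exp s) \<longlongrightarrow> 0) at_top"
    by (rule tendsto_power_div_exp_0)
  then have "((\<lambda>t::real. inverse t ^ m / exp (inverse t)) \<longlongrightarrow> 0) (at_right 0)"
    by (rule filterlim_compose[OF _ filterlim_inverse_at_top_right])
  moreover have "\<forall>\<^sub>F t in at_right 0. inverse t ^ m / exp (inverse t) = flat_exp m t"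
    unfolding eventually_at_right_field
    by (rule exI[of _ 1]) (auto simp: flat_exp_def exp_minus field_simps)
  ultimately show ?thesis by (rule Lim_transform_eventually)
qed

lemma flat_exp_deriv:
  "(flat_exp m has_real_derivative (flat_exp (m + 2) t - real m * flat_exp (m + 1) t)) (at t)"
proof -
  consider "t > 0" | "t < 0" | "t = 0" by linarith
  then show ?thesis
  proof cases
    case 1
    have "((\<lambda>t. exp (- (1 / t)) / t ^ m) has_real_derivative
       (flat_exp (m + 2) t - real m * flat_exp (m + 1) t)) (at t)"
    proof -
      \<comment> \<open>Writing the derivative of \<open>t ^ m\<close> as
        \<open>m * t ^ m / t\<close> keeps the truncated exponent \<open>m - 1\<close> out of the
        quotient rule.\<close>
      have [derivative_intros]: "((\<lambda>t. t ^ m) has_real_derivative real m * t ^ m / t) (at t)"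
        using 1 by (intro DERIV_cong[OF DERIV_pow]) (cases m; simp)
      show ?thesis
        using 1 by (auto intro!: derivative_eq_intros simp: flat_exp_def field_simps power2_eq_square)
    qed
    then show ?thesis
      by (rule has_field_derivative_transform_within_open[of _ _ _ "{0<..}"])
         (use 1 in \<open>auto simp: flat_exp_def\<close>)
  next
    case 2
    have "((\<lambda>t. 0) has_real_derivative 0) (at t)" by simp
    then have "(flat_exp m has_real_derivative 0) (at t)"
      by (rule has_field_derivative_transform_within_open[of _ _ _ "{..<0}"])
         (use 2 in \<open>auto simp: flat_exp_def\<close>)
    then show ?thesis using 2 by (simp add: flat_exp_def)
  next
    case 3
    \<comment> \<open>The quotient at 0 vanishes on the left, and on the right it is
      \<open>flat_exp (Suc m)\<close>, which tends to 0.\<close>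
    have "((\<lambda>y. (flat_exp m y - flat_exp m 0) / (y - 0)) \<longlongrightarrow> 0) (at 0)"
    proof (rule filterlim_split_at)
      show "((\<lambda>y. (flat_exp m y - flat_exp m 0) / (y - 0)) \<longlongrightarrow> 0) (at_left 0)"
        by (rule tendsto_eventually)
           (auto simp: eventually_at_left_field flat_exp_def intro!: exI[of _ "-1"])
      have "\<forall>\<^sub>F y in at_right 0. flat_exp (Suc m) y = (flat_exp m y - flat_exp m 0) / (y - 0)"
        unfolding eventually_at_right_field
        by (rule exI[of _ 1]) (auto simp: flat_exp_def)
      with flat_exp_tendsto_0[of "Suc m"]
      show "((\<lambda>y. (flat_exp m y - flat_exp m 0) / (y - 0)) \<longlongrightarrow> 0) (at_right 0)"
        by (rule Lim_transform_eventually)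
    qed
    then show ?thesis using 3 by (simp add: has_field_derivative_iff flat_exp_def)
  qed
qed

lemma C_k_flat_exp: "C_k k (\<lambda>x::'a::euclidean_space. flat_exp m (1 - x \<bullet> x))"
proof (induction k arbitrary: m)
  case 0
  have "continuous_on UNIV (flat_exp m)"
    by (rule DERIV_continuous_on) (use flat_exp_deriv in \<open>blast intro: has_field_derivative_at_within\<close>)
  then show ?case by (auto intro!: continuous_intros continuous_on_compose2[of UNIV "flat_exp m"])
next
  case (Suc k)
  have D: "((\<lambda>x::'a. flat_exp m (1 - x \<bullet> x)) has_derivative
     (\<lambda>h. (flat_exp (m + 2) (1 - x \<bullet> x) - real m * flat_exp (m + 1) (1 - x \<bullet> x)) * (- 2 * (x \<bullet> h)))) (at x)" for x
    by (rule has_derivative_compose[OF _ flat_exp_deriv[THEN has_field_derivative_imp_has_derivative]])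
       (auto intro!: derivative_eq_intros simp: inner_commute)
  have "partial_deriv b (\<lambda>x::'a. flat_exp m (1 - x \<bullet> x)) =
     (\<lambda>x. (flat_exp (m + 2) (1 - x \<bullet> x) + (- real m) * flat_exp (m + 1) (1 - x \<bullet> x)) * ((- 2) * (x \<bullet> b)))" for b
    using partial_deriv_eq[OF D] by auto
  moreover have "(\<lambda>x::'a. flat_exp m (1 - x \<bullet> x)) differentiable_on UNIV"
    using D by (auto simp: differentiable_on_def differentiable_def)
  ultimately show ?case
    using Suc by (simp only: C_k.simps) (intro conjI ballI C_k_mult C_k_add C_k_const C_k_inner_right; simp)
qed

section \<open>Closure properties and bounds of test functions\<close>

lemma test_function_partial_deriv:
  assumes "test_function \<psi>" "b \<in> Basis"
  shows "test_function (partial_deriv b \<psi>)"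
proof -
  from assms obtain K where K: "compact K" "\<And>x. x \<notin> K \<Longrightarrow> \<psi> x = 0" and s: "\<And>k. C_k k \<psi>"
    by (auto simp: test_function_def smooth_def)
  have "C_k k (partial_deriv b \<psi>)" for k
    using s[of "Suc k"] assms(2) by simp
  moreover have "partial_deriv b \<psi> x = 0" if "x \<notin> K" for x
  proof -
    have "((\<lambda>x. 0 :: real) has_derivative (\<lambda>h. 0)) (at x)" by simp
    then have "(\<psi> has_derivative (\<lambda>h. 0)) (at x)"
      by (rule has_derivative_transform_within_open[of _ _ _ _ "- K"])
         (use that K in \<open>auto simp: compact_imp_closed\<close>)
    then show ?thesis by (simp add: partial_deriv_eq)
  qed
  ultimately show ?thesis using K(1) by (auto simp: test_function_def smooth_def)
qed

lemma test_function_affine: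
  assumes "test_function \<psi>" "c \<noteq> 0"
  shows "test_function (\<lambda>y. \<psi> (a + c *\<^sub>R y))"
proof -
  from assms obtain K where K: "compact K" "\<And>x. x \<notin> K \<Longrightarrow> \<psi> x = 0" and s: "\<And>k. C_k k \<psi>"
    by (auto simp: test_function_def smooth_def)
  have "compact ((\<lambda>x. (1/c) *\<^sub>R (x - a)) ` K)"
    by (intro compact_continuous_image K continuous_intros)
  moreover have "\<psi> (a + c *\<^sub>R y) = 0" if "y \<notin> (\<lambda>x. (1/c) *\<^sub>R (x - a)) ` K" for y
  proof (rule K(2), rule)
    assume "a + c *\<^sub>R y \<in> K"
    then have "(1/c) *\<^sub>R ((a + c *\<^sub>R y) - a) \<in> (\<lambda>x. (1/c) *\<^sub>R (x - a)) ` K" by (rule imageI)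
    then show False using that assms(2) by simp
  qed
  moreover have "C_k k (\<lambda>y. \<psi> (a + c *\<^sub>R y))" for k using s by (rule C_k_affine)
  ultimately show ?thesis by (auto simp: test_function_def smooth_def)
qed

lemma test_function_differentiable: "test_function \<psi> \<Longrightarrow> \<psi> differentiable (at x)"
  unfolding test_function_def smooth_def using C_k_Suc_diff by blast

lemma test_function_continuous: "test_function \<psi> \<Longrightarrow> continuous_on UNIV \<psi>"
  unfolding test_function_def smooth_def using C_k.simps(1) by blast

lemma test_function_bounded:
  assumes "test_function \<psi>"
  obtains B where "B > 0" "\<And>x. \<bar>\<psi> x\<bar> \<le> B"
proof -
  from assms obtain K where K: "compact K" "\<And>x. x \<notin> K \<Longrightarrow> \<psi> x = 0"
    by (auto simp: test_function_def)
  have "compact (\<psi> ` K)"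
    by (rule compact_continuous_image[OF continuous_on_subset[OF test_function_continuous[OF assms]]])
       (use K in auto)
  then obtain B where B: "B > 0" "\<forall>x\<in>\<psi> ` K. norm x \<le> B"
    using bounded_pos compact_imp_bounded by metis
  then have "\<bar>\<psi> x\<bar> \<le> B" for x using K(2)[of x] by (cases "x \<in> K") auto
  with B(1) show ?thesis by (rule that)
qed

section \<open>Lipschitz and Taylor estimates from partial derivatives\<close>

lemma norm_sum_inner_le:
  fixes h :: "'a::euclidean_space" and A :: real
  assumes "\<And>b. b \<in> Basis \<Longrightarrow> \<bar>a b\<bar> \<le> A"
  shows "\<bar>\<Sum>b\<in>Basis. (h \<bullet> b) * a b\<bar> \<le> DIM('a) * A * norm h"
proof -
  have "\<bar>\<Sum>b\<in>Basis. (h \<bullet> b) * a b\<bar> \<le> (\<Sum>b\<in>Basis. \<bar>(h \<bullet> b) * a b\<bar>)" by (rule sum_abs)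
  also have "\<dots> \<le> (\<Sum>b\<in>(Basis::'a set). norm h * A)"
    by (intro sum_mono) (use assms in \<open>auto simp: abs_mult intro!: mult_mono Basis_le_norm\<close>)
  finally show ?thesis by (simp add: mult_ac)
qed

lemma partials_bounded_lipschitz:
  fixes f :: "'a::euclidean_space \<Rightarrow> real" and A :: real
  assumes "convex S" "A \<ge> 0"
    and D: "\<And>x. x \<in> S \<Longrightarrow> (f has_derivative (\<lambda>h. \<Sum>b\<in>Basis. (h \<bullet> b) * f' b x)) (at x)"
    and B: "\<And>x b. x \<in> S \<Longrightarrow> b \<in> Basis \<Longrightarrow> \<bar>f' b x\<bar> \<le> A"
  shows "(DIM('a) * A)-lipschitz_on S f"
proof (rule lipschitz_onI)
  fix x y assume "x \<in> S" "y \<in> S"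
  have "onorm (\<lambda>h. \<Sum>b\<in>Basis. (h \<bullet> b) * f' b z) \<le> DIM('a) * A" if "z \<in> S" for z
    by (rule onorm_le) (simp, rule norm_sum_inner_le, use B that in auto)
  then have "norm (f x - f y) \<le> DIM('a) * A * norm (x - y)"
    using \<open>x \<in> S\<close> \<open>y \<in> S\<close>
    by (intro differentiable_bound[OF assms(1)]) (auto intro: has_derivative_at_withinI[OF D])
  then show "dist (f x) (f y) \<le> DIM('a) * A * dist x y" by (simp add: dist_norm)
qed (use assms in simp)

lemma test_function_lipschitz:
  fixes \<psi> :: "'a::euclidean_space \<Rightarrow> real"
  assumes "test_function \<psi>"
  shows "\<exists>L. L-lipschitz_on UNIV \<psi>"
proof -
  have "\<forall>b\<in>Basis. \<exists>B. B > 0 \<and> (\<forall>x. \<bar>partial_deriv b \<psi> x\<bar> \<le> B)"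
    using test_function_bounded[OF test_function_partial_deriv[OF assms]] by metis
  then obtain B where B: "\<And>b. b \<in> Basis \<Longrightarrow> B b > 0" "\<And>b x. b \<in> Basis \<Longrightarrow> \<bar>partial_deriv b \<psi> x\<bar> \<le> B b"
    by metis
  have "B b \<le> sum B Basis" if "b \<in> Basis" for b
    by (rule member_le_sum) (use that B(1) in \<open>auto intro: less_imp_le\<close>)
  then have "\<bar>partial_deriv b \<psi> x\<bar> \<le> sum B Basis" if "b \<in> Basis" for b x
    using B(2)[OF that] that order_trans by blast
  moreover have "sum B Basis \<ge> 0" by (rule sum_nonneg) (use B(1) in \<open>auto intro: less_imp_le\<close>)
  ultimately have "(DIM('a) * sum B Basis)-lipschitz_on UNIV \<psi>"
    by (intro partials_bounded_lipschitz[where f' = "\<lambda>b. partial_deriv b \<psi>"])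
       (auto intro!: differentiable_has_partial_derivs test_function_differentiable assms)
  then show ?thesis by blast
qed

text \<open>Subtracting the linear form with the partial derivatives frozen at \<open>x\<close>
  leaves a function whose partial derivatives are at most \<open>A * norm (y - x)\<close> on the
  segment. The constant depends on the Lipschitz bound alone, so the estimate survives pointwise
  limits.\<close>

lemma taylor_lipschitz_partials:
  fixes f :: "'a::euclidean_space \<Rightarrow> real" and A :: real
  assumes "convex S" "A \<ge> 0"
    and D: "\<And>x. x \<in> S \<Longrightarrow> (f has_derivative (\<lambda>h. \<Sum>b\<in>Basis. (h \<bullet> b) * f' b x)) (at x)"
    and L: "\<And>b. b \<in> Basis \<Longrightarrow> A-lipschitz_on S (f' b)"
    and "x \<in> S" "y \<in> S"
  shows "\<bar>f y - f x - (\<Sum>b\<in>Basis. ((y - x) \<bullet> b) * f' b x)\<bar> \<le> DIM('a) * A * (norm (y - x))\<^sup>2"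
proof -
  let ?k = "\<lambda>z. f z - (\<Sum>b\<in>Basis. (z \<bullet> b) * f' b x)"
  let ?S = "closed_segment x y"
  have seg: "?S \<subseteq> S" using assms by (simp add: closed_segment_subset)
  have "(?k has_derivative (\<lambda>h. \<Sum>b\<in>Basis. (h \<bullet> b) * (f' b z - f' b x))) (at z)" if "z \<in> S" for z
    by (auto intro!: derivative_eq_intros D[OF that] simp: algebra_simps sum_subtractf)
  moreover have "\<bar>f' b z - f' b x\<bar> \<le> A * norm (y - x)" if "z \<in> ?S" "b \<in> Basis" for b z
  proof -
    have "dist (f' b z) (f' b x) \<le> A * dist z x"
      using L[OF that(2)] seg that assms by (auto intro: lipschitz_onD)
    also have "dist z x \<le> dist y x"
      using that(1) by (metis dist_commute dist_norm segment_bound(1) norm_minus_commute)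
    finally show ?thesis using assms(2) by (simp add: dist_norm mult_left_mono)
  qed
  ultimately have "(DIM('a) * (A * norm (y - x)))-lipschitz_on ?S ?k"
    using assms(2) seg by (intro partials_bounded_lipschitz) auto
  then have "dist (?k y) (?k x) \<le> (DIM('a) * (A * norm (y - x))) * dist y x"
    by (rule lipschitz_onD) auto
  also have "?k y - ?k x = f y - f x - (\<Sum>b\<in>Basis. ((y - x) \<bullet> b) * f' b x)"
    by (simp add: algebra_simps sum_subtractf inner_diff_left)
  then have "dist (?k y) (?k x) = \<bar>f y - f x - (\<Sum>b\<in>Basis. ((y - x) \<bullet> b) * f' b x)\<bar>"
    by (simp add: dist_real_def)
  finally show ?thesis by (simp add: dist_norm power2_eq_square mult_ac)
qed

lemma has_derivative_quadratic_error:
  fixes f :: "'a::euclidean_space \<Rightarrow> real"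
  assumes "linear A" and "\<And>h. norm h \<le> 1 \<Longrightarrow> \<bar>f (x + h) - f x - A h\<bar> \<le> C * (norm h)\<^sup>2"
  shows "(f has_derivative A) (at x)"
proof -
  have "((\<lambda>h. (f (x + h) - f x - A h) / norm h) \<longlongrightarrow> 0) (at 0)"
  proof (rule Lim_null_comparison)
    show "\<forall>\<^sub>F h in at 0. norm ((f (x + h) - f x - A h) / norm h) \<le> C * norm h"
      unfolding eventually_at
    proof (rule exI[of _ 1], safe)
      fix h :: 'a assume "h \<noteq> 0" "dist h 0 < 1"
      then show "norm ((f (x + h) - f x - A h) / norm h) \<le> C * norm h"
        using assms(2)[of h] by (simp add: field_simps power2_eq_square)
    qed simp
    show "((\<lambda>h::'a. C * norm h) \<longlongrightarrow> 0) (at 0)"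
      by (auto intro!: tendsto_eq_intros)
  qed
  then have "((\<lambda>h. norm ((f (x + h) - f x - A h) / norm h)) \<longlongrightarrow> 0) (at 0)"
    by (rule tendsto_norm_zero)
  then show ?thesis
    using assms(1) by (simp add: has_derivative_at linear_conv_bounded_linear)
qed

section \<open>Mollification and the regularity of \<open>W\<^sup>2\<^sup>,\<^sup>\<infinity>\<^sub>l\<^sub>o\<^sub>c\<close>\<close>

definition mollify :: "('a::euclidean_space \<Rightarrow> real) \<Rightarrow> ('a \<Rightarrow> real) \<Rightarrow> 'a \<Rightarrow> real" where
  "mollify k f x = (LINT y|lebesgue. f y * k (x - y))"

lemma test_function_reflect: "test_function k \<Longrightarrow> test_function (\<lambda>y. k (x - y))"
  using test_function_affine[of k "-1" x] by simp

lemma partial_deriv_reflect: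
  assumes "test_function k" "b \<in> Basis"
  shows "partial_deriv b (\<lambda>y. k (x - y)) = (\<lambda>y. - partial_deriv b k (x - y))"
  using partial_deriv_affine(1)[OF test_function_differentiable[OF assms(1)] assms(2), of x "-1"]
  by auto

lemma integrable_compact_support:
  fixes f :: "'a::euclidean_space \<Rightarrow> real"
  assumes "continuous_on UNIV f" "compact K" "\<And>x. x \<notin> K \<Longrightarrow> f x = 0"
  shows "integrable lebesgue f"
proof -
  have "integrable lborel (\<lambda>x. indicator K x *\<^sub>R f x)"
    by (rule borel_integrable_compact[OF assms(2) continuous_on_subset[OF assms(1)]]) auto
  also have "(\<lambda>x. indicator K x *\<^sub>R f x) = f"
    using assms(3) by (auto simp: indicator_def of_bool_def)
  finally show ?thesis
    using assms(1) by (subst integrable_completion) (auto intro: borel_measurable_continuous_onI)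
qed

lemma integrable_mult_test_function:
  assumes "continuous_on UNIV f" "test_function k"
  shows "integrable lebesgue (\<lambda>y. f y * k y)"
proof -
  from assms obtain K where K: "compact K" "\<And>x. x \<notin> K \<Longrightarrow> k x = 0"
    by (auto simp: test_function_def)
  show ?thesis
    by (rule integrable_compact_support[OF _ K(1)])
       (use assms K in \<open>auto intro: continuous_intros test_function_continuous\<close>)
qed

lemma test_function_quadratic_error:
  fixes k :: "'a::euclidean_space \<Rightarrow> real"
  assumes "test_function k"
  obtains C where "C \<ge> 0" "\<And>x h. \<bar>k (x + h) - k x - (\<Sum>b\<in>Basis. (h \<bullet> b) * partial_deriv b k x)\<bar> \<le> C * (norm h)\<^sup>2"
proof -
  have "\<forall>b\<in>Basis. \<exists>L. L-lipschitz_on UNIV (partial_deriv b k)"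
    using test_function_lipschitz[OF test_function_partial_deriv[OF assms]] by blast
  then obtain L where L: "\<And>b. b \<in> Basis \<Longrightarrow> (L b)-lipschitz_on UNIV (partial_deriv b k)"
    by metis
  have L0: "L b \<ge> 0" if "b \<in> Basis" for b using lipschitz_on_nonneg[OF L[OF that]] .
  define A where "A = sum L Basis"
  have A0: "A \<ge> 0" unfolding A_def by (rule sum_nonneg[OF L0])
  have LA: "A-lipschitz_on UNIV (partial_deriv b k)" if "b \<in> Basis" for b
    by (rule lipschitz_on_le[OF L[OF that]]) (use L0 that in \<open>auto simp: A_def intro!: member_le_sum\<close>)
  have "\<bar>k (x + h) - k x - (\<Sum>b\<in>Basis. (h \<bullet> b) * partial_deriv b k x)\<bar> \<le> DIM('a) * A * (norm h)\<^sup>2" for x h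
    using taylor_lipschitz_partials[OF convex_UNIV A0
        differentiable_has_partial_derivs[OF test_function_differentiable[OF assms]] LA UNIV_I UNIV_I, of "x + h" x]
    by simp
  then show ?thesis by (rule that[rotated]) (use A0 in simp)
qed

text \<open>Differentiation under the integral: the second-order Taylor error of \<open>k\<close> is
  bounded uniformly in its argument and is integrated against |f| over a bounded set.\<close>

lemma mollify_has_derivative:
  fixes f :: "'a::euclidean_space \<Rightarrow> real"
  assumes f: "continuous_on UNIV f" and k: "test_function k"
  shows "(mollify k f has_derivative (\<lambda>h. \<Sum>b\<in>Basis. (h \<bullet> b) * mollify (partial_deriv b k) f x)) (at x)"
proof -
  obtain C where C: "C \<ge> 0" "\<And>x h. \<bar>k (x + h) - k x - (\<Sum>b\<in>Basis. (h \<bullet> b) * partial_deriv b k x)\<bar> \<le> C * (norm h)\<^sup>2"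
    using test_function_quadratic_error[OF k] by blast
  from k obtain K where K: "compact K" "\<And>x. x \<notin> K \<Longrightarrow> k x = 0"
    by (auto simp: test_function_def)
  then obtain \<rho> where "\<rho> > 0" and \<rho>: "K \<subseteq> cball 0 \<rho>"
    using compact_imp_bounded[of K] that by (auto simp: bounded_pos subset_iff)
  have k0: "k z = 0" if "norm z > \<rho>" for z
    using K(2) \<rho> that by force
  have dk0: "partial_deriv b k z = 0" if "norm z > \<rho>" for b z
  proof -
    have "((\<lambda>x. 0 :: real) has_derivative (\<lambda>h. 0)) (at z)" by simp
    then have "(k has_derivative (\<lambda>h. 0)) (at z)"
      by (rule has_derivative_transform_within_open[of _ _ _ _ "- cball 0 \<rho>"]) (use that k0 in auto)
    then show ?thesis by (simp add: partial_deriv_eq)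
  qed
  \<comment> \<open>The extra 1 absorbs \<open>h\<close>: for \<open>norm h \<le> 1\<close> and
    \<open>y\<close> outside \<open>?Q\<close>, both \<open>x - y\<close> and
    \<open>x - y + h\<close> lie outside the ball that carries \<open>k\<close>.\<close>
  let ?Q = "cball x (\<rho> + 1)"
  define B where "B = (LINT y|lebesgue. indicator ?Q y *\<^sub>R \<bar>f y\<bar>)"
  have int_B: "integrable lebesgue (\<lambda>y. indicator ?Q y *\<^sub>R \<bar>f y\<bar>)"
  proof -
    have "integrable lborel (\<lambda>y. indicator ?Q y *\<^sub>R \<bar>f y\<bar>)"
      by (rule borel_integrable_compact) (use f in \<open>auto intro!: continuous_intros continuous_on_subset[OF f]\<close>)
    then show ?thesis
      by (subst integrable_completion) (auto dest: borel_measurable_integrable)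
  qed
  have ik: "integrable lebesgue (\<lambda>y. f y * k (z - y))" for z
    by (rule integrable_mult_test_function[OF f test_function_reflect[OF k]])
  have idk: "integrable lebesgue (\<lambda>y. f y * partial_deriv b k (z - y))" if "b \<in> Basis" for b z
    by (rule integrable_mult_test_function[OF f test_function_reflect[OF test_function_partial_deriv[OF k that]]])
  show ?thesis
  proof (rule has_derivative_quadratic_error)
    show "linear (\<lambda>h. \<Sum>b\<in>Basis. (h \<bullet> b) * mollify (partial_deriv b k) f x)"
      by (auto intro!: linearI simp: inner_simps algebra_simps sum.distrib sum_distrib_left)
    fix h :: 'a assume h: "norm h \<le> 1"
    let ?e = "\<lambda>y. f y * k (x + h - y) - f y * k (x - y) - (\<Sum>b\<in>Basis. (h \<bullet> b) * (f y * partial_deriv b k (x - y)))"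
    have ie: "integrable lebesgue ?e"
      by (intro Bochner_Integration.integrable_diff Bochner_Integration.integrable_sum integrable_mult_right ik idk)
    have e: "?e y = f y * (k (x - y + h) - k (x - y) - (\<Sum>b\<in>Basis. (h \<bullet> b) * partial_deriv b k (x - y)))" for y
    proof -
      have "x + h - y = x - y + h" by simp
      then show ?thesis by (simp only: right_diff_distrib sum_distrib_left mult.left_commute)
    qed
    have le: "\<bar>?e y\<bar> \<le> C * (norm h)\<^sup>2 * (indicator ?Q y *\<^sub>R \<bar>f y\<bar>)" for y
    proof (cases "y \<in> ?Q")
      case True
      have "\<bar>f y\<bar> * \<bar>k (x - y + h) - k (x - y) - (\<Sum>b\<in>Basis. (h \<bullet> b) * partial_deriv b k (x - y))\<bar>
          \<le> \<bar>f y\<bar> * (C * (norm h)\<^sup>2)"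
        by (rule mult_left_mono[OF C(2)]) simp
      with True show ?thesis unfolding e abs_mult by (simp add: mult_ac)
    next
      case False
      then have n: "norm (x - y) > \<rho> + 1" by (simp add: dist_norm)
      moreover have "norm (x - y + h) \<ge> norm (x - y) - norm h"
        using norm_triangle_ineq4[of "x - y + h" h] by simp
      ultimately have "norm (x - y + h) > \<rho>" using h by linarith
      then have "k (x - y + h) = 0" "k (x - y) = 0" "\<And>b. partial_deriv b k (x - y) = 0"
        using n by (auto intro: k0 dk0)
      then show ?thesis unfolding e using False by simp
    qed
    have "mollify k f (x + h) - mollify k f x - (\<Sum>b\<in>Basis. (h \<bullet> b) * mollify (partial_deriv b k) f x)
        = (LINT y|lebesgue. ?e y)"
      unfolding mollify_def using ik idk by simp
    then have "\<bar>mollify k f (x + h) - mollify k f x - (\<Sum>b\<in>Basis. (h \<bullet> b) * mollify (partial_deriv b k) f x)\<bar>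
        = \<bar>LINT y|lebesgue. ?e y\<bar>" by (rule arg_cong)
    also have "\<dots> \<le> (LINT y|lebesgue. \<bar>?e y\<bar>)"
      using integral_norm_bound[of lebesgue ?e] unfolding real_norm_def .
    also have "\<dots> \<le> (LINT y|lebesgue. C * (norm h)\<^sup>2 * (indicator ?Q y *\<^sub>R \<bar>f y\<bar>))"
      by (rule integral_mono[OF integrable_abs[OF ie] integrable_mult_right[OF int_B] le])
    also have "\<dots> = C * B * (norm h)\<^sup>2" unfolding B_def by simp
    finally show "\<bar>mollify k f (x + h) - mollify k f x - (\<Sum>b\<in>Basis. (h \<bullet> b) * mollify (partial_deriv b k) f x)\<bar> \<le> C * B * (norm h)\<^sup>2" .
  qed
qed

definition mollifier :: "real \<Rightarrow> ('a::euclidean_space \<Rightarrow> real) \<Rightarrow> bool" where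
  "mollifier \<epsilon> k \<longleftrightarrow> test_function k \<and> (\<forall>x. 0 \<le> k x) \<and> (\<forall>x. norm x > \<epsilon> \<longrightarrow> k x = 0) \<and>
     (LINT x|lebesgue. k x) = 1"

lemma test_function_integrable: "test_function k \<Longrightarrow> integrable lebesgue k"
  using integrable_mult_test_function[of "\<lambda>_. 1" k] by simp

lemma mollifier_exists:
  assumes "\<epsilon> > 0"
  shows "\<exists>k::'a::euclidean_space \<Rightarrow> real. mollifier \<epsilon> k"
proof -
  define k0 where "k0 = (\<lambda>x::'a. flat_exp 0 (1 - x \<bullet> x))"
  have k0_out: "k0 x = 0" if "norm x > 1" for x
  proof -
    have "x \<bullet> x > 1" using that by (simp add: dot_square_norm one_less_power)
    then show ?thesis by (simp add: k0_def flat_exp_def)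
  qed
  have "test_function k0"
    unfolding test_function_def smooth_def using C_k_flat_exp k0_out
    by (auto simp: k0_def intro!: exI[of _ "cball 0 1"])
  then have t: "test_function (\<lambda>y. k0 (0 + (1 / \<epsilon>) *\<^sub>R y))"
    using assms by (intro test_function_affine) auto
  define k1 where "k1 = (\<lambda>y. k0 ((1 / \<epsilon>) *\<^sub>R y))"
  have t1: "test_function k1" using t by (simp add: k1_def)
  have nn: "k1 x \<ge> 0" for x by (simp add: k1_def k0_def flat_exp_def)
  have out: "k1 x = 0" if "norm x > \<epsilon>" for x
    unfolding k1_def by (rule k0_out) (use that assms in \<open>simp add: field_simps\<close>)
  define I where "I = (LINT x|lebesgue. k1 x)"
  have pos: "I > 0"
  proof -
    \<comment> \<open>Otherwise the nonnegative \<open>k1\<close> would vanish almost everywhere,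
      although it is positive on the open ball of radius \<epsilon>.\<close>
    have "I \<noteq> 0"
    proof
      assume "I = 0"
      then have "AE x in lebesgue. k1 x = 0"
        using integral_nonneg_eq_0_iff_AE[OF test_function_integrable[OF t1]] nn by (simp add: I_def)
      then have "AE x in lebesgue. x \<in> - ball (0::'a) \<epsilon>"
      proof eventually_elim
        case (elim x)
        have "(1 / \<epsilon>) *\<^sub>R x \<bullet> (1 / \<epsilon>) *\<^sub>R x < 1" if "norm x < \<epsilon>"
        proof -
          have "norm ((1 / \<epsilon>) *\<^sub>R x) < 1" using that assms by simp
          then show ?thesis unfolding dot_square_norm by (intro power_less_one_iff[THEN iffD2]) auto
        qed
        then show ?case using elim by (auto simp: k1_def k0_def flat_exp_def split: if_splits)
      qed
      then have "negligible (ball (0::'a) \<epsilon>)"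
        by (auto simp: negligible_iff_null_sets AE_iff_null_sets)
      then show False using assms using open_not_negligible[of "ball (0::'a) \<epsilon>"] by simp
    qed
    moreover have "I \<ge> 0" unfolding I_def using nn by (simp add: Bochner_Integration.integral_nonneg)
    ultimately show ?thesis by simp
  qed
  have "test_function (\<lambda>x. (1 / I) * k1 x)"
    unfolding test_function_def smooth_def
  proof
    show "\<forall>k. C_k k (\<lambda>x. (1 / I) * k1 x)"
      using t1 C_k_mult[OF C_k_const] unfolding test_function_def smooth_def by blast
    obtain K where "compact K" "\<forall>x. x \<notin> K \<longrightarrow> k1 x = 0"
      using t1 unfolding test_function_def by blast
    then show "\<exists>K. compact K \<and> (\<forall>x. x \<notin> K \<longrightarrow> (1 / I) * k1 x = 0)"
      by (intro exI[of _ K]) simp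
  qed
  then have "mollifier \<epsilon> (\<lambda>x. (1 / I) * k1 x)"
    unfolding mollifier_def using nn out pos by (simp add: I_def)
  then show ?thesis by blast
qed

lemma mollifier_reflect_integral:
  fixes k :: "'a::euclidean_space \<Rightarrow> real"
  assumes "mollifier \<epsilon> k"
  shows "(LINT y|lebesgue. k (x - y)) = 1"
proof -
  have m: "k \<in> borel_measurable borel"
    using assms by (auto simp: mollifier_def intro: borel_measurable_continuous_onI test_function_continuous)
  have "(LINT y|lebesgue. k (x - y)) = (LINT y|lborel. k (x - y))"
    by (rule integral_completion) (use m in measurable)
  also have "\<dots> = (LINT y|distr lborel borel (\<lambda>y. x - y). k y)"
    by (subst integral_distr) (use m in measurable)
  also have "distr lborel borel (\<lambda>y. x - y) = (lborel :: 'a measure)"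
  proof -
    show ?thesis using lborel_affine[of "-1" x] by (simp add: density_1)
  qed
  also have "(LINT y|lborel. k y) = (LINT y|lebesgue. k y)"
    by (rule integral_completion[symmetric]) (use m in measurable)
  finally show ?thesis using assms by (simp add: mollifier_def)
qed

section \<open>From bounded second weak derivatives to a locally Lipschitz gradient\<close>

text \<open>Both derivatives move from the kernel to \<open>U\<close> through the definition of weak
  derivatives, applied to reflected test functions; the sign of the reflection cancels that of the
  integration by parts. What remains is an average of a locally bounded function, so the bound does
  not depend on \<epsilon>.\<close>

lemma mollify_second_derivative_bounded:
  fixes U :: "'a::euclidean_space \<Rightarrow> real"
  assumes W: "W_inf_loc 2 U"
  shows "\<exists>C\<ge>0. \<forall>\<epsilon> k x. \<forall>b\<in>Basis. \<forall>c\<in>Basis. \<epsilon> \<le> 1 \<and> mollifier \<epsilon> k \<and> norm x \<le> R \<longrightarrow>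
    \<bar>mollify (partial_deriv b (partial_deriv c k)) U x\<bar> \<le> C"
proof -
  have "\<forall>b\<in>Basis. \<exists>g. weak_partial_deriv b U g \<and> (\<forall>c\<in>Basis. \<exists>h. weak_partial_deriv c g h \<and> Linf_loc h)"
    using W by (auto simp: numeral_2_eq_2)
  then obtain G where G: "\<And>b. b \<in> Basis \<Longrightarrow> weak_partial_deriv b U (G b)"
    and "\<forall>b\<in>Basis. \<forall>c\<in>Basis. \<exists>h. weak_partial_deriv c (G b) h \<and> Linf_loc h" by metis
  then obtain H where H: "\<And>b c. b \<in> Basis \<Longrightarrow> c \<in> Basis \<Longrightarrow> weak_partial_deriv c (G b) (H b c)"
    and HL: "\<And>b c. b \<in> Basis \<Longrightarrow> c \<in> Basis \<Longrightarrow> Linf_loc (H b c)" by metis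
  \<comment> \<open>The kernel only sees points within \<epsilon> \<le> 1 of \<open>x\<close>, hence
    the radius \<open>R + 1\<close>.\<close>
  have "\<forall>p\<in>Basis \<times> Basis. \<exists>C. AE y in lebesgue. y \<in> cball 0 (R + 1) \<longrightarrow> \<bar>H (fst p) (snd p) y\<bar> \<le> C"
    using HL compact_cball unfolding Linf_loc_def by (metis mem_Times_iff)
  from bchoice[OF this] obtain C where C: "\<And>p. p \<in> Basis \<times> Basis \<Longrightarrow> AE y in lebesgue. y \<in> cball 0 (R + 1) \<longrightarrow> \<bar>H (fst p) (snd p) y\<bar> \<le> C p"
    by blast
  define B where "B = (\<Sum>p\<in>(Basis \<times> Basis :: ('a \<times> 'a) set). \<bar>C p\<bar>)"
  have CB: "C p \<le> B" if "p \<in> Basis \<times> Basis" for p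
  proof -
    have "\<bar>C p\<bar> \<le> B" unfolding B_def by (rule member_le_sum) (use that in auto)
    then show ?thesis by linarith
  qed
  have "\<bar>mollify (partial_deriv b (partial_deriv c k)) U x\<bar> \<le> B"
    if b: "b \<in> Basis" and c: "c \<in> Basis" and "\<epsilon> \<le> 1" and k: "mollifier \<epsilon> k" and x: "norm x \<le> R" for \<epsilon> k x b c
  proof -
    have t: "test_function k" using k by (simp add: mollifier_def)
    have tc: "test_function (partial_deriv c k)" by (rule test_function_partial_deriv[OF t c])
    have "(LINT y|lebesgue. U y * partial_deriv b (\<lambda>y. partial_deriv c k (x - y)) y)
        = - (LINT y|lebesgue. G b y * partial_deriv c k (x - y))"
      using G[OF b] test_function_reflect[OF tc] unfolding weak_partial_deriv_def by blast
    then have 1: "mollify (partial_deriv b (partial_deriv c k)) U x = (LINT y|lebesgue. G b y * partial_deriv c k (x - y))"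
      by (simp add: mollify_def partial_deriv_reflect[OF tc b])
    have "(LINT y|lebesgue. G b y * partial_deriv c (\<lambda>y. k (x - y)) y)
        = - (LINT y|lebesgue. H b c y * k (x - y))"
      using H[OF b c] test_function_reflect[OF t] unfolding weak_partial_deriv_def by blast
    then have 2: "(LINT y|lebesgue. G b y * partial_deriv c k (x - y)) = (LINT y|lebesgue. H b c y * k (x - y))"
      by (simp add: partial_deriv_reflect[OF t c])
    have ik: "integrable lebesgue (\<lambda>y. B * k (x - y))"
      by (intro integrable_mult_right test_function_integrable test_function_reflect t)
    have le: "AE y in lebesgue. \<bar>H b c y * k (x - y)\<bar> \<le> B * k (x - y)"
      using C[of "(b, c)"]
    proof (rule AE_mp, goal_cases)
      case 2
      show ?case
      proof (rule AE_I2, rule impI)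
        fix y :: 'a assume y: "y \<in> cball 0 (R + 1) \<longrightarrow> \<bar>H (fst (b, c)) (snd (b, c)) y\<bar> \<le> C (b, c)"
        show "\<bar>H b c y * k (x - y)\<bar> \<le> B * k (x - y)"
        proof (cases "norm (x - y) > \<epsilon>")
          case True
          then show ?thesis using k by (simp add: mollifier_def)
        next
          case False
          have "norm y \<le> norm x + norm (x - y)" using norm_triangle_ineq4[of x "x - y"] by simp
          then have "\<bar>H b c y\<bar> \<le> B" using y False x \<open>\<epsilon> \<le> 1\<close> CB[of "(b, c)"] b c by auto
          then show ?thesis using k by (simp add: mollifier_def abs_mult mult_right_mono)
        qed
      qed
    qed (use b c in simp)
    have m: "(\<lambda>y. H b c y * k (x - y)) \<in> borel_measurable lebesgue"
      using HL[OF b c] test_function_integrable[OF test_function_reflect[OF t, of x]]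
      by (intro borel_measurable_times) (auto simp: Linf_loc_def dest: borel_measurable_integrable)
    have int: "integrable lebesgue (\<lambda>y. H b c y * k (x - y))"
      by (rule Bochner_Integration.integrable_bound[OF ik m]) (use le in \<open>auto elim!: eventually_mono\<close>)
    have "\<bar>LINT y|lebesgue. H b c y * k (x - y)\<bar> \<le> (LINT y|lebesgue. \<bar>H b c y * k (x - y)\<bar>)"
      using integral_norm_bound[of lebesgue "\<lambda>y. H b c y * k (x - y)"] unfolding real_norm_def .
    also have "\<dots> \<le> (LINT y|lebesgue. B * k (x - y))"
      by (rule integral_mono_AE[OF integrable_abs[OF int] ik le])
    also have "\<dots> = B" using mollifier_reflect_integral[OF k] by simp
    finally show ?thesis by (simp add: 1 2)
  qed
  moreover have "B \<ge> 0" unfolding B_def by (rule sum_nonneg) simp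
  ultimately show ?thesis by blast
qed

lemma mollify_tendsto:
  fixes U :: "'a::euclidean_space \<Rightarrow> real"
  assumes U: "continuous_on UNIV U" and k: "\<And>m. mollifier (1 / (real m + 1)) (k m)"
  shows "(\<lambda>m. mollify (k m) U x) \<longlonglongrightarrow> U x"
proof (rule LIMSEQ_I)
  fix e :: real assume "e > 0"
  obtain d where d: "d > 0" "\<And>y. dist y x < d \<Longrightarrow> dist (U y) (U x) < e / 2"
    using U \<open>e > 0\<close> unfolding continuous_on_iff by (metis UNIV_I half_gt_zero)
  obtain N :: nat where N: "1 / d < N" using reals_Archimedean2 by blast
  have "norm (mollify (k m) U x - U x) < e" if "m \<ge> N" for m
  proof -
    have "1 / d < real m + 1" using N that by linarith
    then have md: "1 / (real m + 1) < d" using d(1) by (simp add: field_simps)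
    have t: "test_function (k m)" using k by (simp add: mollifier_def)
    have i1: "integrable lebesgue (\<lambda>y. U y * k m (x - y))" for x
      by (rule integrable_mult_test_function[OF U test_function_reflect[OF t]])
    have i2: "integrable lebesgue (\<lambda>y. c * k m (x - y))" for x c
      by (intro integrable_mult_right test_function_integrable test_function_reflect t)
    have i3: "integrable lebesgue (\<lambda>y. (U y - U x) * k m (x - y))"
      using Bochner_Integration.integrable_diff[OF i1 i2] by (simp add: left_diff_distrib)
    have "mollify (k m) U x - U x = (LINT y|lebesgue. U y * k m (x - y)) - (LINT y|lebesgue. U x * k m (x - y))"
      using mollifier_reflect_integral[OF k] by (simp add: mollify_def)
    also have "\<dots> = (LINT y|lebesgue. (U y - U x) * k m (x - y))"
      using Bochner_Integration.integral_diff[OF i1 i2] by (simp add: left_diff_distrib)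
    finally have "norm (mollify (k m) U x - U x) = \<bar>LINT y|lebesgue. (U y - U x) * k m (x - y)\<bar>" by simp
    also have "\<dots> \<le> (LINT y|lebesgue. \<bar>(U y - U x) * k m (x - y)\<bar>)"
      using integral_norm_bound[of lebesgue "\<lambda>y. (U y - U x) * k m (x - y)"] unfolding real_norm_def .
    also have "\<dots> \<le> (LINT y|lebesgue. e / 2 * k m (x - y))"
    proof (rule integral_mono[OF integrable_abs[OF i3] i2])
      fix y
      show "\<bar>(U y - U x) * k m (x - y)\<bar> \<le> e / 2 * k m (x - y)"
      proof (cases "norm (x - y) > 1 / (real m + 1)")
        case True
        then show ?thesis using k[of m] unfolding mollifier_def by simp
      next
        case False
        then have "\<bar>U y - U x\<bar> \<le> e / 2" using d(2)[of y] md by (simp add: dist_norm norm_minus_commute)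
        then show ?thesis using k[of m] unfolding mollifier_def abs_mult
            by (simp only: abs_of_nonneg) (intro mult_right_mono; simp)
      qed
    qed
    also have "\<dots> = e / 2" using mollifier_reflect_integral[OF k] by simp
    finally show ?thesis using \<open>e > 0\<close> by simp
  qed
  then show "\<exists>no. \<forall>m\<ge>no. norm (mollify (k m) U x - U x) < e" by blast
qed

text \<open>The mollifications converge to \<open>U\<close> pointwise, and on each ball their
  partial derivatives share one Lipschitz constant. By the uniform Taylor bound a partial derivative
  is a difference quotient of step \<eta> up to O(\<eta>), so convergence of the values forces
  convergence of the partial derivatives; the limits inherit the Taylor bound and the Lipschitz
  estimate.\<close>

theorem W_2_inf_imp_C_1_1:
  fixes U :: "'a::euclidean_space \<Rightarrow> real"
  assumes W: "W_inf_loc 2 U" and U: "continuous_on UNIV U"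
  obtains G where "\<And>x. GDERIV U x :> G x" "\<And>R. \<exists>L. L-lipschitz_on (cball 0 R) G"
proof -
  have "\<forall>m. \<exists>k::'a \<Rightarrow> real. mollifier (1 / (real m + 1)) k"
    by (intro allI mollifier_exists) simp
  then obtain k :: "nat \<Rightarrow> 'a \<Rightarrow> real" where k: "\<And>m. mollifier (1 / (real m + 1)) (k m)" by metis
  have t: "test_function (k m)" for m using k by (simp add: mollifier_def)
  define F where "F = (\<lambda>m. mollify (k m) U)"
  define F' where "F' = (\<lambda>m b. mollify (partial_deriv b (k m)) U)"
  have F: "(F m has_derivative (\<lambda>h. \<Sum>b\<in>Basis. (h \<bullet> b) * F' m b x)) (at x)" for m x
    unfolding F_def F'_def by (rule mollify_has_derivative[OF U t])
  have F': "(F' m b has_derivative (\<lambda>h. \<Sum>c\<in>Basis. (h \<bullet> c) * mollify (partial_deriv c (partial_deriv b (k m))) U x)) (at x)"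
    if "b \<in> Basis" for m b x
    unfolding F'_def by (rule mollify_has_derivative[OF U test_function_partial_deriv[OF t that]])
  have "\<forall>R. \<exists>A\<ge>0. \<forall>m. \<forall>b\<in>Basis. A-lipschitz_on (cball 0 R) (F' m b)"
  proof
    fix R
    obtain C where C: "C \<ge> 0" "\<And>\<epsilon> k x b c. b \<in> Basis \<Longrightarrow> c \<in> Basis \<Longrightarrow> \<epsilon> \<le> 1 \<Longrightarrow> mollifier \<epsilon> k \<Longrightarrow> norm x \<le> R \<Longrightarrow>
        \<bar>mollify (partial_deriv b (partial_deriv c k)) U x\<bar> \<le> C"
      using mollify_second_derivative_bounded[OF W, of R] by metis
    have "(DIM('a) * C)-lipschitz_on (cball 0 R) (F' m b)" if b: "b \<in> Basis" for m b
    proof (rule partials_bounded_lipschitz[OF convex_cball C(1) F'[OF b]])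
      fix x c :: 'a assume "x \<in> cball 0 R" "c \<in> Basis"
      then show "\<bar>mollify (partial_deriv c (partial_deriv b (k m))) U x\<bar> \<le> C"
        by (intro C(2)[OF _ b _ k]) auto
    qed
    then show "\<exists>A\<ge>0. \<forall>m. \<forall>b\<in>Basis. A-lipschitz_on (cball 0 R) (F' m b)"
      using C(1) by (intro exI[of _ "DIM('a) * C"]) auto
  qed
  then obtain A where A: "\<And>R. A R \<ge> 0" and lip: "\<And>R m b. b \<in> Basis \<Longrightarrow> (A R)-lipschitz_on (cball 0 R) (F' m b)"
    by metis
  have taylor: "\<bar>F m y - F m x - (\<Sum>b\<in>Basis. ((y - x) \<bullet> b) * F' m b x)\<bar> \<le> DIM('a) * A R * (norm (y - x))\<^sup>2"
    if "norm x \<le> R" "norm y \<le> R" for m x y R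
    by (rule taylor_lipschitz_partials[OF convex_cball A F lip]) (use that in auto)
  have lim: "(\<lambda>m. F m x) \<longlonglongrightarrow> U x" for x
    unfolding F_def by (rule mollify_tendsto[OF U k])
  have conv: "convergent (\<lambda>m. F' m b x)" if b: "b \<in> Basis" for b x
  proof -
    have "Cauchy (\<lambda>m. F' m b x)"
    proof (rule CauchyI)
      fix e :: real assume e: "e > 0"
      define D where "D = DIM('a) * A (norm x + 1)"
      have D: "D \<ge> 0" using A by (simp add: D_def)
      \<comment> \<open>This step makes each Taylor error at most \<open>e * \<eta> / 8\<close>. The
        values are then taken within \<open>e * \<eta> / 8\<close>, since they get divided by
        \<eta>; two Taylor errors and four errors of values stay below
        \<open>e * \<eta>\<close>.\<close>
      define \<eta> where "\<eta> = min 1 (e / (8 * (D + 1)))"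
      have \<eta>: "\<eta> > 0" "\<eta> \<le> 1" using e D by (auto simp: \<eta>_def)
      have "\<eta> * (D + 1) \<le> e / (8 * (D + 1)) * (D + 1)"
        by (rule mult_right_mono) (use D in \<open>auto simp: \<eta>_def\<close>)
      also have "\<dots> = e / 8" using D by (simp add: field_simps)
      finally have D\<eta>: "\<eta> * D \<le> e / 8" using \<eta> by (simp add: algebra_simps)
      obtain N1 where N1: "\<And>m. m \<ge> N1 \<Longrightarrow> \<bar>F m x - U x\<bar> < e * \<eta> / 8"
        using LIMSEQ_D[OF lim, of "e * \<eta> / 8" x] e \<eta> by auto
      obtain N2 where N2: "\<And>m. m \<ge> N2 \<Longrightarrow> \<bar>F m (x + \<eta> *\<^sub>R b) - U (x + \<eta> *\<^sub>R b)\<bar> < e * \<eta> / 8"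
        using LIMSEQ_D[OF lim, of "e * \<eta> / 8" "x + \<eta> *\<^sub>R b"] e \<eta> by auto
      have T: "\<bar>F m (x + \<eta> *\<^sub>R b) - F m x - \<eta> * F' m b x\<bar> \<le> D * \<eta>\<^sup>2" for m
      proof -
        have nb: "norm (\<eta> *\<^sub>R b) = \<eta>" using \<eta> b by simp
        have "norm (x + \<eta> *\<^sub>R b) \<le> norm x + 1"
          using norm_triangle_ineq[of x "\<eta> *\<^sub>R b"] nb \<eta> by linarith
        from taylor[OF _ this, of x m] show ?thesis
          using \<eta> b by (simp add: D_def inner_Basis if_distrib if_distribR sum.delta cong: if_cong)
      qed
      have "norm (F' m b x - F' l b x) < e" if "m \<ge> max N1 N2" "l \<ge> max N1 N2" for m l
      proof -
        have "D * \<eta>\<^sup>2 \<le> e / 8 * \<eta>" using mult_right_mono[OF D\<eta>, of \<eta>] \<eta> by (simp add: power2_eq_square mult_ac)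
        then have "\<bar>\<eta> * F' m b x - \<eta> * F' l b x\<bar> < e * \<eta>"
          using T[of m] T[of l] N1[of m] N1[of l] N2[of m] N2[of l] that
          unfolding abs_le_iff abs_less_iff max.bounded_iff by linarith
        then have "\<eta> * \<bar>F' m b x - F' l b x\<bar> < \<eta> * e"
          using \<eta> by (simp add: abs_mult mult.commute flip: right_diff_distrib)
        then show ?thesis using \<eta> by simp
      qed
      then show "\<exists>M. \<forall>m\<ge>M. \<forall>n\<ge>M. norm (F' m b x - F' n b x) < e" by blast
    qed
    then show ?thesis by (rule Cauchy_convergent)
  qed
  define g where "g = (\<lambda>b x. lim (\<lambda>m. F' m b x))"
  have g: "(\<lambda>m. F' m b x) \<longlonglongrightarrow> g b x" if "b \<in> Basis" for b x
    using conv[OF that] unfolding g_def by (simp add: convergent_LIMSEQ_iff)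
  define G where "G = (\<lambda>x. \<Sum>b\<in>Basis. g b x *\<^sub>R b)"
  have "GDERIV U x :> G x" for x
    unfolding gderiv_def
  proof (rule has_derivative_quadratic_error)
    show "linear (\<lambda>h. h \<bullet> G x)" by (auto intro!: linearI simp: inner_simps)
    fix h :: 'a assume h: "norm h \<le> 1"
    have "(\<lambda>m. \<bar>F m (x + h) - F m x - (\<Sum>b\<in>Basis. ((x + h - x) \<bullet> b) * F' m b x)\<bar>)
        \<longlonglongrightarrow> \<bar>U (x + h) - U x - (\<Sum>b\<in>Basis. ((x + h - x) \<bullet> b) * g b x)\<bar>"
      by (intro tendsto_intros lim g)
    moreover have "\<bar>F m (x + h) - F m x - (\<Sum>b\<in>Basis. ((x + h - x) \<bullet> b) * F' m b x)\<bar> \<le> DIM('a) * A (norm x + 1) * (norm h)\<^sup>2" for m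
      using taylor[of x "norm x + 1" "x + h" m] norm_triangle_ineq[of x h] h by simp
    ultimately have "\<bar>U (x + h) - U x - (\<Sum>b\<in>Basis. ((x + h - x) \<bullet> b) * g b x)\<bar> \<le> DIM('a) * A (norm x + 1) * (norm h)\<^sup>2"
      by (intro LIMSEQ_le_const2) auto
    also have "(\<Sum>b\<in>Basis. ((x + h - x) \<bullet> b) * g b x) = h \<bullet> G x"
      by (simp add: G_def inner_sum_right mult.commute)
    finally show "\<bar>U (x + h) - U x - h \<bullet> G x\<bar> \<le> DIM('a) * A (norm x + 1) * (norm h)\<^sup>2" .
  qed
  moreover have "(DIM('a) * A R)-lipschitz_on (cball 0 R) G" for R
  proof (rule lipschitz_onI)
    fix x y :: 'a assume xy: "x \<in> cball 0 R" "y \<in> cball 0 R"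
    have gl: "\<bar>g b x - g b y\<bar> \<le> A R * dist x y" if b: "b \<in> Basis" for b
    proof (rule LIMSEQ_le_const2)
      show "(\<lambda>m. \<bar>F' m b x - F' m b y\<bar>) \<longlonglongrightarrow> \<bar>g b x - g b y\<bar>"
        by (intro tendsto_intros g b)
      show "\<exists>N. \<forall>m\<ge>N. \<bar>F' m b x - F' m b y\<bar> \<le> A R * dist x y"
        using lipschitz_onD[OF lip[OF b] xy] by (auto simp: dist_real_def)
    qed
    have "G x - G y = (\<Sum>b\<in>Basis. (g b x - g b y) *\<^sub>R b)"
      by (simp add: G_def sum_subtractf scaleR_diff_left)
    also have "norm \<dots> \<le> (\<Sum>b\<in>(Basis::'a set). A R * dist x y)"
      by (rule sum_norm_le) (use gl in simp)
    finally have "norm (G x - G y) \<le> (\<Sum>b\<in>(Basis::'a set). A R * dist x y)" .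
    then show "dist (G x) (G y) \<le> DIM('a) * A R * dist x y" by (simp add: dist_norm)
  qed (use A in simp)
  ultimately show ?thesis using that by blast
qed

lemma gradient_eq: "GDERIV f x :> D \<Longrightarrow> gradient f x = D"
  unfolding gradient_def
proof (rule the_equality)
  fix E assume "GDERIV f x :> D" "GDERIV f x :> E"
  then have "(\<lambda>h. h \<bullet> D) = (\<lambda>h. h \<bullet> E)"
    unfolding gderiv_def by (rule has_derivative_unique)
  then have "h \<bullet> D = h \<bullet> E" for h by metis
  then show "E = D" by (metis vector_eq_rdot inner_commute vector_eq_ldot)
qed

section \<open>Ordinary differential equations with a Lipschitz right-hand side\<close>

definition ode_solution :: "('a::real_normed_vector \<Rightarrow> 'a) \<Rightarrow> (real \<Rightarrow> 'a) \<Rightarrow> bool" where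
  "ode_solution G y \<longleftrightarrow> (\<forall>t\<ge>0. (y has_vector_derivative G (y t)) (at t within {0..}))"

lemma at_within_Ici_eq_Icc: "0 \<le> (t::real) \<Longrightarrow> t < b \<Longrightarrow> at t within {0..} = at t within {0..b}"
  by (rule at_within_nhd[where S = "{..<b}"]) auto

lemma continuous_integral_derivative:
  fixes g :: "real \<Rightarrow> 'a::banach"
  assumes "continuous_on UNIV g" "0 \<le> t"
  shows "((\<lambda>u. integral {0..u} g) has_vector_derivative g t) (at t within {0..})"
  using integral_has_vector_derivative[of 0 "t + 1" g t] assms
  by (simp add: at_within_Ici_eq_Icc[of t "t + 1"] continuous_on_subset)

text \<open>Picard iteration on the whole half-line at once. The unknown is
  \<open>u t = exp (- (2 * K * t)) *\<^sub>R y t\<close>, which is bounded because \<open>y\<close>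
  grows at most linearly. With this weight, integrating the Lipschitz estimate gains the factor 1/2,
  so the iteration contracts in the sup norm.\<close>

lemma ode_exists_bounded_lipschitz:
  fixes G :: "'a::banach \<Rightarrow> 'a"
  assumes L: "L-lipschitz_on UNIV G" and B: "\<And>x. norm (G x) \<le> B"
  obtains y where "ode_solution G y" "y 0 = y0"
proof -
  \<comment> \<open>\<open>L + 1\<close> instead of \<open>L\<close> keeps \<open>K\<close> positive
    when \<open>L = 0\<close>.\<close>
  define K where "K = L + 1"
  have K: "K > 0" "K \<ge> L" using lipschitz_on_nonneg[OF L] by (auto simp: K_def)
  have B0: "B \<ge> 0" using B[of 0] norm_ge_zero order_trans by blast
  have Gc: "continuous_on UNIV G" using L lipschitz_on_continuous_on by blast
  define g where "g = (\<lambda>(u::real \<Rightarrow>\<^sub>C 'a) s. G (exp (2 * K * s) *\<^sub>R u s))"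
  have gc: "continuous_on S (g u)" for u S
    unfolding g_def by (intro continuous_on_compose2[OF Gc] continuous_intros) auto
  have gB: "norm (g u s) \<le> B" for u s by (simp add: g_def B)
  define I where "I = (\<lambda>u t. integral {0..t} (g u))"
  have Ider: "(I u has_vector_derivative g u t) (at t within {0..})" if "t \<ge> 0" for u t
    unfolding I_def by (rule continuous_integral_derivative[OF gc that])
  have Icont: "continuous_on {0..} (I u)" for u
    by (rule differentiable_imp_continuous_on)
       (use Ider in \<open>force simp: differentiable_on_def has_vector_derivative_def differentiable_def\<close>)
  have IB: "norm (I u t) \<le> B * t" if "t \<ge> 0" for u t
    unfolding I_def using integral_bound[of 0 t "g u" B] that gc gB by auto
  \<comment> \<open>Bounded continuous functions live on the whole line, so \<open>max t 0\<close>
    continues the iterate to negative times by its initial value.\<close>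
  define T where "T = (\<lambda>u t. exp (- (2 * K * max t 0)) *\<^sub>R (y0 + I u (max t 0)))"
  have Tb: "T u \<in> bcontfun" for u
    unfolding bcontfun_def mem_Collect_eq
  proof
    show "continuous_on UNIV (T u)"
      unfolding T_def by (intro continuous_intros continuous_on_compose2[OF Icont]) auto
    have "norm (T u t) \<le> norm y0 + B / (2 * K)" for t
    proof -
      let ?t = "max t 0"
      have "2 * K * ?t \<le> exp (2 * K * ?t)" using exp_ge_add_one_self[of "2 * K * ?t"] by linarith
      then have e: "exp (- (2 * K * ?t)) * ?t \<le> 1 / (2 * K)"
        using K by (simp add: exp_minus field_simps)
      have "norm (T u t) = exp (- (2 * K * ?t)) * norm (y0 + I u ?t)" by (simp add: T_def)
      also have "\<dots> \<le> exp (- (2 * K * ?t)) * (norm y0 + B * ?t)"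
        by (intro mult_left_mono norm_triangle_le add_left_mono IB) auto
      also have "\<dots> = exp (- (2 * K * ?t)) * norm y0 + B * (exp (- (2 * K * ?t)) * ?t)" by (simp add: algebra_simps)
      also have "\<dots> \<le> 1 * norm y0 + B * (1 / (2 * K))"
        using e B0 K by (intro add_mono mult_right_mono mult_left_mono) auto
      finally show ?thesis by simp
    qed
    then show "bounded (range (T u))" by (auto simp: bounded_iff)
  qed
  define F where "F = (\<lambda>u. Bcontfun (T u))"
  have F: "apply_bcontfun (F u) = T u" for u by (simp add: F_def Bcontfun_inverse[OF Tb])
  have "\<exists>!u. F u = u"
  proof (rule banach_fix_type[of "1/2"])
    show "\<forall>u w. dist (F u) (F w) \<le> 1 / 2 * dist u w"
    proof (intro allI)
      fix u w :: "real \<Rightarrow>\<^sub>C 'a"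
      have "dist (F u t) (F w t) \<le> 1 / 2 * dist u w" for t
      proof -
        let ?t = "max t 0"
        have "norm (g u s - g w s) \<le> K * dist u w * exp (2 * K * s)" for s
        proof -
          have "norm (g u s - g w s) \<le> L * dist (exp (2 * K * s) *\<^sub>R u s) (exp (2 * K * s) *\<^sub>R w s)"
            unfolding g_def using lipschitz_onD[OF L] by (simp add: dist_norm)
          also have "\<dots> \<le> K * (exp (2 * K * s) * dist u w)"
            using K lipschitz_on_nonneg[OF L] dist_bounded[of u s w]
            by (intro mult_mono) (auto simp: dist_norm simp flip: scaleR_diff_right)
          finally show ?thesis by (simp add: mult_ac)
        qed
        moreover have hi: "((\<lambda>s. K * dist u w * exp (2 * K * s)) has_integral
            (dist u w / 2 * exp (2 * K * ?t) - dist u w / 2 * exp (2 * K * 0))) {0..?t}"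
          by (rule fundamental_theorem_of_calculus)
             (use K in \<open>auto intro!: derivative_eq_intros simp flip: has_real_derivative_iff_has_vector_derivative\<close>)
        ultimately have "norm (integral {0..?t} (\<lambda>s. g u s - g w s)) \<le> integral {0..?t} (\<lambda>s. K * dist u w * exp (2 * K * s))"
          by (intro integral_norm_bound_integral integrable_continuous_real continuous_intros gc) auto
        also have "\<dots> = dist u w / 2 * exp (2 * K * ?t) - dist u w / 2 * exp (2 * K * 0)"
          using hi by (rule integral_unique)
        also have "\<dots> \<le> dist u w / 2 * exp (2 * K * ?t)" by simp
        also have "integral {0..?t} (\<lambda>s. g u s - g w s) = I u ?t - I w ?t"
          unfolding I_def by (intro integral_diff integrable_continuous_real gc)
        finally have "exp (- (2 * K * ?t)) * norm (I u ?t - I w ?t) \<le> exp (- (2 * K * ?t)) * (dist u w / 2 * exp (2 * K * ?t))"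
          by (intro mult_left_mono) auto
        also have "\<dots> = 1 / 2 * dist u w" by (simp add: exp_minus)
        also have "exp (- (2 * K * ?t)) * norm (I u ?t - I w ?t) = dist (F u t) (F w t)"
          by (simp add: F T_def dist_norm flip: scaleR_diff_right)
        finally show ?thesis .
      qed
      then show "dist (F u) (F w) \<le> 1 / 2 * dist u w" by (rule dist_bound)
    qed
  qed auto
  then obtain u where u: "F u = u" by blast
  define y where "y = (\<lambda>t. y0 + I u t)"
  have uy: "exp (2 * K * t) *\<^sub>R u t = y t" if "t \<ge> 0" for t
  proof -
    have "u t = T u t" using F[of u] u by simp
    then show ?thesis using that by (simp add: T_def y_def flip: exp_add)
  qed
  have "ode_solution G y"
    unfolding ode_solution_def
  proof (intro allI impI)
    fix t :: real assume t: "t \<ge> 0"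
    have "(y has_vector_derivative g u t) (at t within {0..})"
      unfolding y_def using Ider[OF t] by (auto intro!: derivative_eq_intros)
    then show "(y has_vector_derivative G (y t)) (at t within {0..})"
      unfolding g_def uy[OF t] .
  qed
  moreover have "y 0 = y0" by (simp add: y_def I_def)
  ultimately show ?thesis by (rule that)
qed

lemma lipschitz_cutoff:
  fixes G :: "'a::real_normed_vector \<Rightarrow> 'b::real_normed_vector"
  assumes R: "R > 0" and L: "L-lipschitz_on (cball 0 (R + 1)) G"
  obtains c L' B where "L'-lipschitz_on UNIV (\<lambda>x. c x *\<^sub>R G x)" "\<And>x. norm (c x *\<^sub>R G x) \<le> B"
    "\<And>x. norm x \<le> R \<Longrightarrow> c x = 1"
proof -
  define c where "c = (\<lambda>x::'a. max 0 (min 1 (R + 1 - norm x)))"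
  define B where "B = norm (G 0) + L * (R + 1)"
  have L0: "L \<ge> 0" using lipschitz_on_nonneg[OF L] .
  have GB: "norm (G x) \<le> B" if "norm x \<le> R + 1" for x
  proof -
    have "dist (G x) (G 0) \<le> L * dist x 0" using lipschitz_onD[OF L, of x 0] that R by simp
    also have "\<dots> \<le> L * (R + 1)" using that L0 by (intro mult_left_mono) auto
    finally show ?thesis using norm_triangle_ineq2[of "G x" "G 0"] by (simp add: B_def dist_norm)
  qed
  have B0: "B \<ge> 0" using L0 R by (simp add: B_def)
  have c01: "0 \<le> c x" "c x \<le> 1" for x by (auto simp: c_def)
  have cl: "\<bar>c x - c y\<bar> \<le> dist x y" for x y
    using norm_triangle_ineq3[of x y] by (auto simp: c_def dist_norm)
  have c0: "c x = 0" if "norm x > R + 1" for x using that by (simp add: c_def)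
  \<comment> \<open>One point in the ball is enough: the estimate is symmetric, and for two points
    outside both products vanish.\<close>
  have lip: "norm (c x *\<^sub>R G x - c y *\<^sub>R G y) \<le> (L + B) * dist x y" if y: "norm y \<le> R + 1" for x y
  proof (cases "norm x \<le> R + 1")
    case True
    have "c x *\<^sub>R G x - c y *\<^sub>R G y = c x *\<^sub>R (G x - G y) + (c x - c y) *\<^sub>R G y"
      by (simp add: algebra_simps)
    also have "norm \<dots> \<le> c x * norm (G x - G y) + \<bar>c x - c y\<bar> * norm (G y)"
      using norm_triangle_ineq[of "c x *\<^sub>R (G x - G y)" "(c x - c y) *\<^sub>R G y"] c01 by simp
    also have "\<dots> \<le> 1 * (L * dist x y) + dist x y * B"
      using c01 cl GB[OF y] lipschitz_onD[OF L, of x y] True y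
      by (intro add_mono mult_mono) (auto simp: dist_norm)
    finally show ?thesis by (simp add: algebra_simps)
  next
    case False
    then have "norm (c x *\<^sub>R G x - c y *\<^sub>R G y) = \<bar>c x - c y\<bar> * norm (G y)" using c0[of x] c01 by simp
    also have "\<dots> \<le> dist x y * B" using cl GB[OF y] by (intro mult_mono) auto
    also have "\<dots> \<le> (L + B) * dist x y" using L0 by (simp add: algebra_simps)
    finally show ?thesis .
  qed
  have "(L + B)-lipschitz_on UNIV (\<lambda>x. c x *\<^sub>R G x)"
  proof (rule lipschitz_onI)
    fix x y :: 'a
    show "dist (c x *\<^sub>R G x) (c y *\<^sub>R G y) \<le> (L + B) * dist x y"
    proof (cases "norm y \<le> R + 1")
      case True
      then show ?thesis using lip[OF True] by (simp add: dist_norm)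
    next
      case y: False
      show ?thesis
      proof (cases "norm x \<le> R + 1")
        case True
        then show ?thesis using lip[OF True, of y] by (simp add: dist_norm norm_minus_commute)
      next
        case False
        then show ?thesis using y c0 L0 B0 by simp
      qed
    qed
  qed (use L0 B0 in simp)
  moreover have "norm (c x *\<^sub>R G x) \<le> B" for x
  proof (cases "norm x \<le> R + 1")
    case True
    then show ?thesis using mult_mono[OF c01(2) GB[OF True]] c01 by simp
  qed (use c0 B0 in auto)
  moreover have "c x = 1" if "norm x \<le> R" for x using that by (simp add: c_def)
  ultimately show ?thesis by (rule that)
qed

lemma ode_solution_continuous: "ode_solution G y \<Longrightarrow> continuous_on {0..} y"
  unfolding ode_solution_def
  by (force intro!: differentiable_imp_continuous_on simp: differentiable_on_def has_vector_derivative_def differentiable_def)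

text \<open>The truncated field has a global solution. Up to the first time at which its norm
  reaches \<open>R\<close> it also solves the original equation, and there the a priori bound is
  contradicted. For this purpose the bound speaks of solutions on compact intervals.\<close>

lemma ode_exists_apriori_bound:
  fixes G :: "'a::banach \<Rightarrow> 'a"
  assumes L: "\<And>R. \<exists>L. L-lipschitz_on (cball 0 R) G"
    and R: "norm y0 < R"
    and bound: "\<And>T y. 0 \<le> T \<Longrightarrow> y 0 = y0 \<Longrightarrow>
      (\<And>t. t \<in> {0..T} \<Longrightarrow> (y has_vector_derivative G (y t)) (at t within {0..T})) \<Longrightarrow> norm (y T) < R"
  obtains y where "ode_solution G y" "y 0 = y0"
proof -
  have R0: "R > 0" using R norm_ge_zero le_less_trans by blast
  obtain L where LR: "L-lipschitz_on (cball 0 (R + 1)) G" using L by blast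
  obtain c L' B where
    c: "L'-lipschitz_on UNIV (\<lambda>x. c x *\<^sub>R G x)" "\<And>x. norm (c x *\<^sub>R G x) \<le> B" "\<And>x. norm x \<le> R \<Longrightarrow> c x = 1"
    by (rule lipschitz_cutoff[OF R0 LR]) (rule that)
  obtain y where y: "ode_solution (\<lambda>x. c x *\<^sub>R G x) y" "y 0 = y0"
    by (rule ode_exists_bounded_lipschitz[OF c(1,2)])
  have cont: "continuous_on S (\<lambda>t. norm (y t))" if "S \<subseteq> {0..}" for S
    using ode_solution_continuous[OF y(1)] that by (auto intro!: continuous_intros intro: continuous_on_subset)
  have lt: "norm (y t) < R" if t: "t \<ge> 0" for t
  proof (rule ccontr)
    assume nt: "\<not> norm (y t) < R"
    define S where "S = {s\<in>{0..t}. norm (y s) = R}"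
    have ivt: "\<exists>s\<in>{0..r}. norm (y s) = R" if "r \<ge> 0" "norm (y r) \<ge> R" for r
    proof -
      have "\<exists>s. 0 \<le> s \<and> s \<le> r \<and> norm (y s) = R"
        by (rule IVT'[of "\<lambda>s. norm (y s)"]) (use that R y(2) cont[of "{0..r}"] in auto)
      then show ?thesis by auto
    qed
    have "S \<noteq> {}" using ivt[OF t] nt by (auto simp: S_def)
    moreover have "closed S"
      unfolding S_def by (intro continuous_closed_preimage_constant cont) auto
    moreover have bdd: "bdd_below S" by (auto simp: S_def intro!: bdd_belowI[of _ 0])
    ultimately have TS: "Inf S \<in> S" by (simp add: closed_contains_Inf)
    define T where "T = Inf S"
    have T: "0 \<le> T" "norm (y T) = R" "T \<le> t" using TS by (auto simp: T_def S_def)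
    have le: "norm (y s) \<le> R" if sT: "s \<in> {0..T}" for s
    proof (rule ccontr)
      assume n: "\<not> norm (y s) \<le> R"
      then obtain r where r: "r \<in> {0..s}" "norm (y r) = R" using ivt[of s] sT by auto
      then have "r \<in> S" using sT T by (auto simp: S_def)
      then have "T \<le> r" unfolding T_def using bdd by (rule cInf_lower)
      then have "s = T" using r sT by auto
      then show False using n T by simp
    qed
    have "norm (y T) < R"
    proof (rule bound[of T y, OF T(1) y(2)])
      fix s assume s: "s \<in> {0..T}"
      then have "(y has_vector_derivative c (y s) *\<^sub>R G (y s)) (at s within {0..})"
        using y(1) by (auto simp: ode_solution_def)
      then show "(y has_vector_derivative G (y s)) (at s within {0..T})"
        using c(3)[OF le[OF s]] by (auto intro: has_vector_derivative_within_subset)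
    qed
    then show False using T by simp
  qed
  have "ode_solution G y"
    using y(1) c(3)[OF less_imp_le[OF lt]] unfolding ode_solution_def by (metis scaleR_one)
  then show ?thesis using that y(2) by blast
qed

section \<open>Monotonicity from one-sided derivatives, and Gronwall's inequality\<close>

text \<open>Derivatives are taken within a set such as the half-line, because at time 0 only a
  one-sided derivative exists; in the open interval they are ordinary ones.\<close>

lemma deriv_nonneg_imp_mono_within:
  fixes f :: "real \<Rightarrow> real"
  assumes "a \<le> b" "{a..b} \<subseteq> S"
    and D: "\<And>t. t \<in> {a..b} \<Longrightarrow> (f has_real_derivative f' t) (at t within S)"
    and nn: "\<And>t. t \<in> {a<..<b} \<Longrightarrow> 0 \<le> f' t"
  shows "f a \<le> f b"
proof (rule DERIV_nonneg_imp_increasing_open[OF assms(1)])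
  have D': "(f has_real_derivative f' t) (at t within {a..b})" if "t \<in> {a..b}" for t
    using D[OF that] assms(2) by (rule has_field_derivative_subset)
  show "continuous_on {a..b} f" by (rule DERIV_continuous_on[OF D'])
  fix t assume t: "a < t" "t < b"
  then have "(f has_real_derivative f' t) (at t)"
    using D'[of t] at_within_Icc_at[OF t] by simp
  then show "\<exists>y. (f has_real_derivative y) (at t) \<and> 0 \<le> y" using nn[of t] t by auto
qed

lemma deriv_nonpos_imp_antimono_within:
  fixes f :: "real \<Rightarrow> real"
  assumes "a \<le> b" "{a..b} \<subseteq> S"
    and D: "\<And>t. t \<in> {a..b} \<Longrightarrow> (f has_real_derivative f' t) (at t within S)"
    and nn: "\<And>t. t \<in> {a<..<b} \<Longrightarrow> f' t \<le> 0"
  shows "f b \<le> f a"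
proof -
  have "- f a \<le> - f b"
    by (rule deriv_nonneg_imp_mono_within[OF assms(1,2), where f' = "\<lambda>t. - f' t"])
       (use D nn in \<open>auto intro: derivative_intros\<close>)
  then show ?thesis by simp
qed

lemma has_real_derivative_inner_within:
  fixes f g :: "real \<Rightarrow> 'a::real_inner"
  assumes "(f has_vector_derivative f') (at t within S)" "(g has_vector_derivative g') (at t within S)"
  shows "((\<lambda>t. f t \<bullet> g t) has_real_derivative (f t \<bullet> g' + f' \<bullet> g t)) (at t within S)"
  using bounded_bilinear.has_vector_derivative[OF bounded_bilinear_inner assms]
  by (simp add: has_real_derivative_iff_has_vector_derivative)

text \<open>The squared distance times \<open>exp (- (2 * L) * t)\<close> is nonincreasing, by
  Cauchy-Schwarz.\<close>

lemma gronwall_lipschitz: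
  fixes y1 y2 :: "real \<Rightarrow> 'a::real_inner"
  assumes sol: "ode_solution G y1" "ode_solution G y2"
    and L: "L-lipschitz_on K G" and K: "\<And>t. t \<ge> 0 \<Longrightarrow> y1 t \<in> K" "\<And>t. t \<ge> 0 \<Longrightarrow> y2 t \<in> K"
    and t: "t \<ge> 0"
  shows "norm (y1 t - y2 t) \<le> exp (L * t) * norm (y1 0 - y2 0)"
proof -
  define w where "w = (\<lambda>t. y1 t - y2 t)"
  have D: "((\<lambda>s. (w s \<bullet> w s) * exp (- (2 * L) * s)) has_real_derivative
      (2 * (w s \<bullet> (G (y1 s) - G (y2 s))) - 2 * L * (w s \<bullet> w s)) * exp (- (2 * L) * s)) (at s within {0..})"
    if "s \<ge> 0" for s
  proof -
    have "(w has_vector_derivative G (y1 s) - G (y2 s)) (at s within {0..})"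
      using sol that unfolding w_def ode_solution_def by (auto intro!: derivative_intros)
    from has_real_derivative_inner_within[OF this this] show ?thesis
      by (auto intro!: derivative_eq_intros simp: inner_commute algebra_simps)
  qed
  have "(w t \<bullet> w t) * exp (- (2 * L) * t) \<le> (w 0 \<bullet> w 0) * exp (- (2 * L) * 0)"
  proof (rule deriv_nonpos_imp_antimono_within[OF t, where S = "{0..}"])
    fix s assume s: "s \<in> {0<..<t}"
    have "w s \<bullet> (G (y1 s) - G (y2 s)) \<le> norm (w s) * norm (G (y1 s) - G (y2 s))" by (rule norm_cauchy_schwarz)
    also have "\<dots> \<le> norm (w s) * (L * norm (w s))"
      using lipschitz_onD[OF L K, of s s] s by (intro mult_left_mono) (auto simp: w_def dist_norm)
    finally show "(2 * (w s \<bullet> (G (y1 s) - G (y2 s))) - 2 * L * (w s \<bullet> w s)) * exp (- (2 * L) * s) \<le> 0"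
      by (intro mult_nonpos_nonneg) (auto simp: dot_square_norm power2_eq_square mult_ac)
  qed (use D in auto)
  then have "(norm (w t))\<^sup>2 \<le> (exp (L * t) * norm (w 0))\<^sup>2"
    by (simp add: dot_square_norm exp_minus power_mult_distrib field_simps flip: exp_double)
  then show ?thesis unfolding w_def by (rule power2_le_imp_le) simp
qed

section \<open>Damped motion in a central potential\<close>

lemma even_imp_deriv_0:
  fixes f :: "real \<Rightarrow> real"
  assumes "(f has_real_derivative d) (at 0)" "\<And>t. f (- t) = f t"
  shows "d = 0"
proof -
  have "((\<lambda>t. f (- t)) has_real_derivative - d) (at 0)"
    using DERIV_mirror[of f d 0] assms(1) by simp
  then have "(f has_real_derivative - d) (at 0)" using assms(2) by simp
  from DERIV_unique[OF this assms(1)] show ?thesis by simp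
qed

lemma dist_Pair_le: "dist a b \<le> dist (fst a) (fst b) + dist (snd a) (snd b)"
  by (simp add: dist_prod_def sqrt_sum_squares_le_sum)

text \<open>The relative motion as a one-particle system, with the hypotheses in the form in which
  they act: the gradient is a locally Lipschitz field \<open>g\<close>, and the lower bound on
  |U'|^2 has become \<open>g_eq_0D\<close>.\<close>

locale central_system =
  fixes \<phi> U :: "'a::euclidean_space \<Rightarrow> real" and g :: "'a \<Rightarrow> 'a" and u :: "real \<Rightarrow> real" and r\<^sub>0 :: real
  assumes r0_pos: "r\<^sub>0 > 0"
    and phi_nonneg: "\<And>x. 0 \<le> \<phi> x"
    and phi_pos: "\<And>x. norm x < r\<^sub>0 \<Longrightarrow> 0 < \<phi> x"
    and phi_zero: "\<And>x. norm x \<ge> r\<^sub>0 \<Longrightarrow> \<phi> x = 0"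
    and phi_lip: "\<exists>L. L-lipschitz_on UNIV \<phi>"
    and U_radial: "\<And>x. U x = u (norm x)"
    and U_gderiv: "\<And>x. GDERIV U x :> g x"
    and g_lip: "\<And>R. \<exists>L. L-lipschitz_on (cball 0 R) g"
    and u_nonneg: "\<And>r. 0 \<le> r \<Longrightarrow> 0 \<le> u r"
    and u_at_top: "filterlim u at_top at_top"
    and g_eq_0D: "\<And>x. g x = 0 \<Longrightarrow> U x = 0"
begin

section \<open>Consequences of radial symmetry\<close>

lemma U_has_derivative: "(U has_derivative (\<lambda>h. h \<bullet> g x)) (at x)"
  using U_gderiv by (simp add: gderiv_def)

lemma U_nonneg: "0 \<le> U x"
  by (simp add: U_radial u_nonneg)

lemma U_line_deriv: "((\<lambda>t. U (x + t *\<^sub>R w)) has_real_derivative w \<bullet> g (x + s *\<^sub>R w)) (at s)"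
proof -
  have "((\<lambda>t. x + t *\<^sub>R w) has_derivative (\<lambda>h. h *\<^sub>R w)) (at s)"
    by (auto intro!: derivative_eq_intros)
  from has_derivative_compose[OF this U_has_derivative] show ?thesis
    by (simp add: has_field_derivative_def mult_commute_abs)
qed

text \<open>Along the line through \<open>x\<close> in the direction \<open>w\<close> the norm, and
  with it \<open>U\<close>, is an even function of the parameter.\<close>

lemma g_tangential: "x \<bullet> w = 0 \<Longrightarrow> g x \<bullet> w = 0"
proof -
  assume o: "x \<bullet> w = 0"
  have "norm (x + (- t) *\<^sub>R w) = norm (x + t *\<^sub>R w)" for t
    using o by (simp add: norm_eq_sqrt_inner inner_simps inner_commute)
  then have "w \<bullet> g x = 0"
    using even_imp_deriv_0[of "\<lambda>t. U (x + t *\<^sub>R w)" "w \<bullet> g x"] U_line_deriv[of x w 0]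
    by (simp add: U_radial)
  then show ?thesis by (simp add: inner_commute)
qed

text \<open>The part of \<open>w\<close> orthogonal to \<open>x\<close> contributes nothing by
  \<open>g_tangential\<close>. This expresses that \<open>g x\<close> is parallel to
  \<open>x\<close> without a division, so it serves as an identity in computations with the angular
  momentum.\<close>

lemma g_parallel: "(x \<bullet> x) * (g x \<bullet> w) = (x \<bullet> w) * (g x \<bullet> x)"
proof -
  have "x \<bullet> ((x \<bullet> x) *\<^sub>R w - (x \<bullet> w) *\<^sub>R x) = 0" by (simp add: inner_simps)
  from g_tangential[OF this] show ?thesis by (simp add: inner_simps)
qed

lemma g_odd: "g (- x) = - g x"
proof -
  have "((\<lambda>y. U (- y)) has_derivative (\<lambda>h. (- h) \<bullet> g (- x))) (at x)"
    by (rule has_derivative_compose[OF _ U_has_derivative]) (auto intro!: derivative_eq_intros)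
  moreover have "(\<lambda>y. U (- y)) = U" by (simp add: U_radial fun_eq_iff)
  ultimately have "(\<lambda>h. (- h) \<bullet> g (- x)) = (\<lambda>h. h \<bullet> g x)"
    using U_has_derivative has_derivative_unique by metis
  then have "\<forall>h. h \<bullet> (- g (- x)) = h \<bullet> g x" by (simp add: fun_eq_iff)
  then have "- g (- x) = g x" by (metis vector_eq_ldot)
  then show ?thesis by (metis minus_minus)
qed

lemma g_0: "g 0 = 0"
proof -
  have "2 *\<^sub>R g 0 = 0" using g_odd[of 0] unfolding scaleR_2 by (metis minus_zero add.right_inverse)
  then show ?thesis by simp
qed

definition dir :: 'a where "dir = (SOME b. b \<in> Basis)"

lemma norm_dir: "norm dir = 1"
  unfolding dir_def by (simp add: SOME_Basis)

text \<open>The derivative of the radial profile of \<open>U\<close>, read off along the fixed direction \<open>dir\<close>.\<close>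
definition du :: "real \<Rightarrow> real" where "du r = g (r *\<^sub>R dir) \<bullet> dir"

lemma u_deriv_direction:
  assumes "norm n = 1" "r > 0"
  shows "(u has_real_derivative g (r *\<^sub>R n) \<bullet> n) (at r)"
proof -
  have "((\<lambda>t. U (t *\<^sub>R n)) has_real_derivative g (r *\<^sub>R n) \<bullet> n) (at r)"
    using U_line_deriv[of 0 n r] by (simp add: inner_commute)
  then show ?thesis
    by (rule has_field_derivative_transform_within_open[of _ _ _ "{0<..}"])
       (use assms in \<open>auto simp: U_radial\<close>)
qed

lemma u_deriv: "r > 0 \<Longrightarrow> (u has_real_derivative du r) (at r)"
  unfolding du_def by (rule u_deriv_direction[OF norm_dir])

lemma g_inner_self: "g x \<bullet> x = norm x * du (norm x)"
proof (cases "x = 0")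
  case False
  let ?n = "(1 / norm x) *\<^sub>R x"
  have "norm ?n = 1" "norm x > 0" using False by auto
  from DERIV_unique[OF u_deriv_direction[OF this] u_deriv[OF this(2)]]
  have "g x \<bullet> ?n = du (norm x)" using False by simp
  then show ?thesis using False by (simp add: field_simps)
qed simp

lemma du_0: "du 0 = 0"
  by (simp add: du_def g_0)

lemma u_0: "u 0 = 0"
  using g_eq_0D[OF g_0] by (simp add: U_radial)

lemma du_eq_0D:
  assumes "r > 0" "du r = 0"
  shows "u r = 0"
proof -
  let ?x = "r *\<^sub>R dir"
  have "g ?x \<bullet> ?x = 0" using assms unfolding g_inner_self by (simp add: norm_dir)
  \<comment> \<open>\<open>g_parallel\<close> with \<open>w\<close> taken to be the gradient itself:
    its only possible component is radial, and that one is 0.\<close>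
  then have "(?x \<bullet> ?x) * (g ?x \<bullet> g ?x) = 0" by (metis g_parallel mult_zero_right)
  then have "g ?x = 0" using assms norm_dir by auto
  from g_eq_0D[OF this] show ?thesis using assms by (simp add: U_radial norm_dir)
qed

lemma continuous_on_U: "continuous_on S U"
  by (rule has_derivative_continuous_on) (blast intro: U_has_derivative has_derivative_at_withinI)

lemma continuous_on_u: "S \<subseteq> {0..} \<Longrightarrow> continuous_on S u"
proof -
  assume S: "S \<subseteq> {0..}"
  have "continuous_on S (\<lambda>r. U (r *\<^sub>R dir))"
    by (intro continuous_on_compose2[OF continuous_on_U[of UNIV]] continuous_intros) auto
  then show ?thesis
    by (rule continuous_on_eq) (use S in \<open>auto simp: U_radial norm_dir\<close>)
qed

text \<open>A positive interior maximum of \<open>u\<close> would be a critical point where \<open>u\<close> does not vanish.\<close>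
lemma u_mono:
  assumes "0 \<le> a" "a \<le> b"
  shows "u a \<le> u b"
proof (rule ccontr)
  assume ab: "\<not> u a \<le> u b"
  have "\<exists>c\<in>{0..b}. \<forall>s\<in>{0..b}. u s \<le> u c"
    by (rule continuous_attains_sup) (use assms in \<open>auto intro: continuous_on_u\<close>)
  then obtain c where c: "c \<in> {0..b}" and max: "\<And>s. s \<in> {0..b} \<Longrightarrow> u s \<le> u c" by blast
  have uc: "u c \<ge> u a" using max[of a] assms by simp
  have "c \<noteq> b" using uc ab by auto
  moreover have "u a > 0" using ab u_nonneg[of b] assms by simp
  then have "c \<noteq> 0" using uc u_0 by auto
  ultimately have c': "0 < c" "c < b" using c by auto
  have "du c = 0"
  proof (rule DERIV_local_max[OF u_deriv[OF c'(1)]])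
    show "0 < min c (b - c)" using c' by simp
    show "\<forall>y. \<bar>c - y\<bar> < min c (b - c) \<longrightarrow> u y \<le> u c"
    proof (intro allI impI)
      fix y assume "\<bar>c - y\<bar> < min c (b - c)"
      then have "y \<in> {0..b}" unfolding abs_less_iff by auto
      then show "u y \<le> u c" by (rule max)
    qed
  qed
  from du_eq_0D[OF c'(1) this] show False using uc \<open>u a > 0\<close> by simp
qed

lemma du_nonneg: "0 \<le> r \<Longrightarrow> 0 \<le> du r"
proof (cases "r = 0")
  case False
  assume "0 \<le> r"
  with False have r: "r > 0" by simp
  show ?thesis
  proof (rule ccontr)
    assume "\<not> 0 \<le> du r"
    then obtain d where d: "d > 0" "\<forall>h>0. h < d \<longrightarrow> u r < u (r - h)"
      using DERIV_neg_dec_left[OF u_deriv[OF r]] by auto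
    have "u r < u (r - min (d / 2) r)" using d r by auto
    then show False using u_mono[of "r - min (d / 2) r" r] r d(1) by auto
  qed
qed (simp add: du_0)

lemma du_lip: "\<exists>L. L-lipschitz_on {0..R} du"
proof -
  obtain L where L: "L-lipschitz_on (cball 0 R) g" using g_lip by blast
  have "L-lipschitz_on {0..R} du"
  proof (rule lipschitz_onI)
    fix a b assume ab: "a \<in> {0..R}" "b \<in> {0..R}"
    have "\<bar>du a - du b\<bar> = \<bar>(g (a *\<^sub>R dir) - g (b *\<^sub>R dir)) \<bullet> dir\<bar>" by (simp add: du_def inner_simps)
    also have "\<dots> \<le> norm (g (a *\<^sub>R dir) - g (b *\<^sub>R dir)) * norm dir" by (rule Cauchy_Schwarz_ineq2)
    also have "\<dots> \<le> L * dist (a *\<^sub>R dir) (b *\<^sub>R dir)"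
      using lipschitz_onD[OF L, of "a *\<^sub>R dir" "b *\<^sub>R dir"] ab by (simp add: norm_dir dist_norm)
    also have "dist (a *\<^sub>R dir) (b *\<^sub>R dir) = dist a b"
      by (simp add: dist_norm norm_dir flip: scaleR_diff_left)
    finally show "dist (du a) (du b) \<le> L * dist a b" by (simp add: dist_real_def)
  qed (rule lipschitz_on_nonneg[OF L])
  then show ?thesis by blast
qed

lemma continuous_on_phi: "continuous_on S \<phi>"
  using phi_lip lipschitz_on_continuous_on continuous_on_subset by (metis subset_UNIV)

lemma phi_bounded: "\<exists>B>0. \<forall>x. \<phi> x \<le> B"
proof -
  have "compact (\<phi> ` cball 0 r\<^sub>0)"
    by (intro compact_continuous_image continuous_on_phi compact_cball)
  then obtain B where B: "B > 0" "\<forall>y\<in>\<phi> ` cball 0 r\<^sub>0. norm y \<le> B"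
    using compact_imp_bounded bounded_pos by metis
  have "\<phi> x \<le> B" for x
  proof (cases "norm x \<le> r\<^sub>0")
    case True
    then have "norm (\<phi> x) \<le> B" using B(2) by simp
    then show ?thesis by simp
  next
    case False
    then show ?thesis using phi_zero[of x] B(1) by simp
  qed
  then show ?thesis using B(1) by blast
qed

section \<open>The relative vector field, energy and angular momentum\<close>

text \<open>Each agent's acceleration carries a factor 1/2; the two accelerations are opposite and
  add up in the difference, so no factor is left.\<close>

definition fld :: "'a \<times> 'a \<Rightarrow> 'a \<times> 'a" where
  "fld z = (snd z, - (\<phi> (fst z) *\<^sub>R snd z) - g (fst z))"

lemma fld_lip: "\<exists>L. L-lipschitz_on (cball 0 R) fld"
proof -
  obtain Lg where Lg: "Lg-lipschitz_on (cball 0 R) g" using g_lip by blast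
  obtain Lp where Lp: "Lp-lipschitz_on UNIV \<phi>" using phi_lip by blast
  obtain B where B: "B > 0" "\<And>x. \<phi> x \<le> B" using phi_bounded by blast
  have L0: "Lg \<ge> 0" "Lp \<ge> 0" using Lg Lp lipschitz_on_nonneg by auto
  \<comment> \<open>\<open>\<bar>R\<bar>\<close> keeps the constant nonnegative when
    \<open>R\<close> is negative and the ball is empty.\<close>
  have "(1 + (B + Lp * \<bar>R\<bar>) + Lg)-lipschitz_on (cball 0 R) fld"
  proof (rule lipschitz_onI)
    fix z w :: "'a \<times> 'a" assume z: "z \<in> cball 0 R" and w: "w \<in> cball 0 R"
    have nz: "norm (fst z) \<le> R" "norm (snd z) \<le> R" "norm (fst w) \<le> R" "norm (snd w) \<le> R"
      using z w norm_fst_le[of "fst z" "snd z"] norm_snd_le[of "snd z" "fst z"]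
        norm_fst_le[of "fst w" "snd w"] norm_snd_le[of "snd w" "fst w"] by auto
    have d: "dist (fst z) (fst w) \<le> dist z w" "dist (snd z) (snd w) \<le> dist z w"
      by (auto simp: dist_fst_le dist_snd_le)
    have "dist (\<phi> (fst z) *\<^sub>R snd z) (\<phi> (fst w) *\<^sub>R snd w)
        = norm (\<phi> (fst z) *\<^sub>R (snd z - snd w) + (\<phi> (fst z) - \<phi> (fst w)) *\<^sub>R snd w)"
      by (simp add: dist_norm algebra_simps)
    also have "\<dots> \<le> \<phi> (fst z) * dist (snd z) (snd w) + dist (\<phi> (fst z)) (\<phi> (fst w)) * norm (snd w)"
      using norm_triangle_ineq[of "\<phi> (fst z) *\<^sub>R (snd z - snd w)" "(\<phi> (fst z) - \<phi> (fst w)) *\<^sub>R snd w"] phi_nonneg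
      by (simp add: dist_norm)
    also have "\<dots> \<le> B * dist z w + (Lp * dist z w) * \<bar>R\<bar>"
      using B phi_nonneg d L0 nz lipschitz_onD[OF Lp, of "fst z" "fst w"]
      by (intro add_mono mult_mono) (auto intro: order_trans[OF _ mult_left_mono])
    finally have 1: "dist (\<phi> (fst z) *\<^sub>R snd z) (\<phi> (fst w) *\<^sub>R snd w) \<le> (B + Lp * \<bar>R\<bar>) * dist z w"
      by (simp add: algebra_simps)
    have "dist (g (fst z)) (g (fst w)) \<le> Lg * dist (fst z) (fst w)" using lipschitz_onD[OF Lg] nz by simp
    also have "\<dots> \<le> Lg * dist z w" using d L0 by (intro mult_left_mono) auto
    finally have 2: "dist (g (fst z)) (g (fst w)) \<le> Lg * dist z w" .
    have "dist (fld z) (fld w) \<le> dist (snd z) (snd w)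
        + dist (- (\<phi> (fst z) *\<^sub>R snd z) - g (fst z)) (- (\<phi> (fst w) *\<^sub>R snd w) - g (fst w))"
      using dist_Pair_le[of "fld z" "fld w"] by (simp add: fld_def)
    also have "dist (- (\<phi> (fst z) *\<^sub>R snd z) - g (fst z)) (- (\<phi> (fst w) *\<^sub>R snd w) - g (fst w))
        \<le> dist (\<phi> (fst z) *\<^sub>R snd z) (\<phi> (fst w) *\<^sub>R snd w) + dist (g (fst z)) (g (fst w))"
      using norm_triangle_ineq[of "\<phi> (fst w) *\<^sub>R snd w - \<phi> (fst z) *\<^sub>R snd z" "g (fst w) - g (fst z)"]
      by (simp add: dist_norm norm_minus_commute algebra_simps)
    finally show "dist (fld z) (fld w) \<le> (1 + (B + Lp * \<bar>R\<bar>) + Lg) * dist z w"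
      using 1 2 d by (simp add: algebra_simps)
  qed (use B L0 in simp)
  then show ?thesis by blast
qed

definition en :: "'a \<times> 'a \<Rightarrow> real" where "en z = (snd z \<bullet> snd z) / 2 + U (fst z)"
text \<open>For the distance r to the centre this is r r', half the derivative of |x|^2; its sign
  tells outward from inward motion.\<close>

definition vr :: "'a \<times> 'a \<Rightarrow> real" where "vr z = fst z \<bullet> snd z"

text \<open>The squared angular momentum \<open>|x \<and> v|\<^sup>2\<close>, in a form that makes sense in every dimension.\<close>
definition am :: "'a \<times> 'a \<Rightarrow> real" where
  "am z = (fst z \<bullet> fst z) * (snd z \<bullet> snd z) - (vr z)\<^sup>2"

lemma am_nonneg: "0 \<le> am z"
  unfolding am_def vr_def using Cauchy_Schwarz_ineq[of "fst z" "snd z"] by simp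

lemma en_nonneg: "0 \<le> en z"
  unfolding en_def using U_nonneg[of "fst z"] by simp

lemma continuous_en: "continuous_on S en"
  unfolding en_def by (intro continuous_intros continuous_on_compose2[OF continuous_on_U[of UNIV]]) auto

lemma continuous_vr: "continuous_on S vr"
  unfolding vr_def by (intro continuous_intros)

lemma continuous_am: "continuous_on S am"
  unfolding am_def by (intro continuous_intros continuous_vr)

text \<open>The equation is used at a single time \<open>t\<close> and within an arbitrary
  \<open>S\<close>, so that the same derivatives serve solutions on compact intervals, needed for
  the a priori bound, and on the half-line.\<close>

context
  fixes y :: "real \<Rightarrow> 'a \<times> 'a" and t S
  assumes y: "(y has_vector_derivative fld (y t)) (at t within S)"
begin

lemma fst_deriv: "((\<lambda>s. fst (y s)) has_vector_derivative snd (y t)) (at t within S)"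
  using bounded_linear.has_vector_derivative[OF bounded_linear_fst y] by (simp add: fld_def)

lemma snd_deriv:
  "((\<lambda>s. snd (y s)) has_vector_derivative (- (\<phi> (fst (y t)) *\<^sub>R snd (y t)) - g (fst (y t)))) (at t within S)"
  using bounded_linear.has_vector_derivative[OF bounded_linear_snd y] by (simp add: fld_def)

lemma sqnorm_deriv:
  "((\<lambda>s. fst (y s) \<bullet> fst (y s)) has_real_derivative 2 * vr (y t)) (at t within S)"
  using has_real_derivative_inner_within[OF fst_deriv fst_deriv] by (simp add: vr_def inner_commute)

lemma vr_deriv:
  "((\<lambda>s. vr (y s)) has_real_derivative
     (snd (y t) \<bullet> snd (y t) - \<phi> (fst (y t)) * vr (y t) - g (fst (y t)) \<bullet> fst (y t))) (at t within S)"
  using has_real_derivative_inner_within[OF fst_deriv snd_deriv]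
  by (simp add: vr_def inner_simps inner_commute algebra_simps)

lemma sqvel_deriv:
  "((\<lambda>s. snd (y s) \<bullet> snd (y s)) has_real_derivative
     - 2 * \<phi> (fst (y t)) * (snd (y t) \<bullet> snd (y t)) - 2 * (g (fst (y t)) \<bullet> snd (y t))) (at t within S)"
  using has_real_derivative_inner_within[OF snd_deriv snd_deriv]
  by (simp add: inner_simps inner_commute algebra_simps)

lemma U_deriv: "((\<lambda>s. U (fst (y s))) has_real_derivative g (fst (y t)) \<bullet> snd (y t)) (at t within S)"
  using has_derivative_compose[OF fst_deriv[unfolded has_vector_derivative_def] U_has_derivative]
  by (simp add: has_field_derivative_def mult_commute_abs inner_commute)

lemma en_deriv:
  "((\<lambda>s. en (y s)) has_real_derivative - \<phi> (fst (y t)) * (snd (y t) \<bullet> snd (y t))) (at t within S)"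
  unfolding en_def 
  by (rule DERIV_cong[OF DERIV_add[OF DERIV_cdivide[OF sqvel_deriv] U_deriv]]) (simp add: field_simps)

text \<open>A central force exerts no torque: its contribution cancels by \<open>g_parallel\<close>.
  The drag, parallel to the velocity, gives the rate 2 \<phi> for a quantity quadratic in
  \<open>v\<close>.\<close>

lemma am_deriv:
  "((\<lambda>s. am (y s)) has_real_derivative - 2 * \<phi> (fst (y t)) * am (y t)) (at t within S)"
proof -
  have p: "(fst (y t) \<bullet> fst (y t)) * (g (fst (y t)) \<bullet> snd (y t)) = vr (y t) * (g (fst (y t)) \<bullet> fst (y t))"
    unfolding vr_def by (rule g_parallel)
  show ?thesis
    unfolding am_def
    by (rule derivative_eq_intros sqnorm_deriv sqvel_deriv vr_deriv refl)+
       (use p in \<open>simp add: algebra_simps power2_eq_square\<close>)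
qed

end

lemma en_antimono_within:
  assumes "\<And>t. t \<in> {a..b} \<Longrightarrow> (y has_vector_derivative fld (y t)) (at t within S)" "a \<le> b" "{a..b} \<subseteq> S"
  shows "en (y b) \<le> en (y a)"
  by (rule deriv_nonpos_imp_antimono_within[OF assms(2,3) en_deriv[OF assms(1)]])
     (use phi_nonneg in \<open>auto simp: mult_nonneg_nonneg\<close>)

lemma am_antimono_within:
  assumes "\<And>t. t \<in> {a..b} \<Longrightarrow> (y has_vector_derivative fld (y t)) (at t within S)" "a \<le> b" "{a..b} \<subseteq> S"
  shows "am (y b) \<le> am (y a)"
  by (rule deriv_nonpos_imp_antimono_within[OF assms(2,3) am_deriv[OF assms(1)]])
     (use phi_nonneg am_nonneg in \<open>auto simp: mult_nonneg_nonneg\<close>)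

lemma sublevel_bounded: "\<exists>R>0. \<forall>z. en z \<le> c \<longrightarrow> norm z < R"
proof -
  obtain X where X: "\<And>r. r \<ge> X \<Longrightarrow> u r > c"
    using u_at_top unfolding filterlim_at_top_dense eventually_at_top_linorder by metis
  have "norm z < \<bar>X\<bar> + sqrt (2 * \<bar>c\<bar>) + 1" if z: "en z \<le> c" for z
  proof -
    have "U (fst z) \<le> c" using z inner_ge_zero[of "snd z"] unfolding en_def by linarith
    then have "norm (fst z) < X" using X[of "norm (fst z)"] by (force simp: U_radial)
    moreover have "snd z \<bullet> snd z \<le> 2 * \<bar>c\<bar>" using z U_nonneg[of "fst z"] unfolding en_def by linarith
    then have "norm (snd z) \<le> sqrt (2 * \<bar>c\<bar>)" by (simp add: norm_eq_sqrt_inner)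
    moreover have "norm z \<le> norm (fst z) + norm (snd z)"
      by (simp add: norm_prod_def sqrt_sum_squares_le_sum)
    ultimately show ?thesis by linarith
  qed
  moreover have "\<bar>X\<bar> + sqrt (2 * \<bar>c\<bar>) + 1 > 0" by (simp add: add_nonneg_pos)
  ultimately show ?thesis by blast
qed

lemma ball_energy_bounded: "\<exists>c. \<forall>z. norm z \<le> k \<longrightarrow> en z \<le> c"
proof -
  have "compact (en ` cball 0 k)" by (intro compact_continuous_image continuous_en compact_cball)
  then obtain B where "\<forall>y\<in>en ` cball 0 k. norm y \<le> B"
    using compact_imp_bounded bounded_pos by metis
  then have "norm (en z) \<le> B" if "norm z \<le> k" for z using that by simp
  then have "en z \<le> B" if "norm z \<le> k" for z using that by fastforce
  then show ?thesis by blast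
qed

section \<open>The global flow\<close>

definition flow :: "'a \<times> 'a \<Rightarrow> real \<Rightarrow> 'a \<times> 'a" where
  "flow z = (SOME y. ode_solution fld y \<and> y 0 = z)"

text \<open>The energy cannot grow and its sublevel sets are bounded, which is the a priori
  bound.\<close>

lemma flow_exists: "\<exists>y. ode_solution fld y \<and> y 0 = z"
proof -
  obtain R where R: "R > 0" "\<And>w. en w \<le> en z \<Longrightarrow> norm w < R" using sublevel_bounded by blast
  obtain y where "ode_solution fld y" "y 0 = z"
  proof (rule ode_exists_apriori_bound[OF fld_lip])
    show "norm z < R" by (rule R) simp
    fix T y assume T: "0 \<le> T" "y 0 = z"
      and "\<And>t. t \<in> {0..T} \<Longrightarrow> (y has_vector_derivative fld (y t)) (at t within {0..T})"
    then have "en (y T) \<le> en (y 0)" by (intro en_antimono_within) auto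
    then show "norm (y T) < R" using R T by simp
  qed
  then show ?thesis by blast
qed

lemma flow_solution: "ode_solution fld (flow z)" and flow_0 [simp]: "flow z 0 = z"
  using someI_ex[OF flow_exists[of z]] unfolding flow_def by auto

lemma solution_deriv:
  "ode_solution fld y \<Longrightarrow> 0 \<le> t \<Longrightarrow> (y has_vector_derivative fld (y t)) (at t within {0..})"
  by (simp add: ode_solution_def)

lemmas flow_deriv = solution_deriv[OF flow_solution]

lemma solution_en_antimono: "ode_solution fld y \<Longrightarrow> 0 \<le> s \<Longrightarrow> s \<le> t \<Longrightarrow> en (y t) \<le> en (y s)"
  by (rule en_antimono_within[where S = "{0..}"]) (auto intro: solution_deriv)

lemma solution_am_antimono: "ode_solution fld y \<Longrightarrow> 0 \<le> s \<Longrightarrow> s \<le> t \<Longrightarrow> am (y t) \<le> am (y s)"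
  by (rule am_antimono_within[where S = "{0..}"]) (auto intro: solution_deriv)

lemma solution_bounded:
  "\<exists>R>0. \<forall>y. ode_solution fld y \<longrightarrow> norm (y 0) \<le> k \<longrightarrow> (\<forall>t\<ge>0. norm (y t) < R)"
proof -
  obtain c where c: "\<And>z. norm z \<le> k \<Longrightarrow> en z \<le> c" using ball_energy_bounded by blast
  obtain R where R: "R > 0" "\<And>w. en w \<le> c \<Longrightarrow> norm w < R" using sublevel_bounded by blast
  have "norm (y t) < R" if "ode_solution fld y" "norm (y 0) \<le> k" "t \<ge> 0" for y t
    using solution_en_antimono[OF that(1), of 0 t] that c[OF that(2)] by (intro R) auto
  then show ?thesis using R(1) by blast
qed

lemma solution_lipschitz:
  "\<exists>L\<ge>0. \<forall>y1 y2 t. ode_solution fld y1 \<longrightarrow> ode_solution fld y2 \<longrightarrow> norm (y1 0) \<le> k \<longrightarrow> norm (y2 0) \<le> k \<longrightarrow> t \<ge> 0 \<longrightarrow>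
     norm (y1 t - y2 t) \<le> exp (L * t) * norm (y1 0 - y2 0)"
proof -
  obtain R where R: "\<forall>y. ode_solution fld y \<longrightarrow> norm (y 0) \<le> k \<longrightarrow> (\<forall>t\<ge>0. norm (y t) < R)"
    using solution_bounded by blast
  obtain L where L: "L-lipschitz_on (cball 0 R) fld" using fld_lip by blast
  have "norm (y1 t - y2 t) \<le> exp (L * t) * norm (y1 0 - y2 0)"
    if "ode_solution fld y1" "ode_solution fld y2" "norm (y1 0) \<le> k" "norm (y2 0) \<le> k" "t \<ge> 0" for y1 y2 t
    by (rule gronwall_lipschitz[OF that(1,2) L _ _ that(5)])
       (use R that in \<open>auto intro!: less_imp_le simp: mem_cball_0\<close>)
  then show ?thesis using lipschitz_on_nonneg[OF L] by (intro exI[of _ L]) simp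
qed

lemma solution_unique:
  assumes "ode_solution fld y1" "ode_solution fld y2" "y1 0 = y2 0" "t \<ge> 0"
  shows "y1 t = y2 t"
proof -
  obtain L where L: "\<forall>z1 z2 t. ode_solution fld z1 \<longrightarrow> ode_solution fld z2 \<longrightarrow> norm (z1 0) \<le> norm (y2 0) \<longrightarrow> norm (z2 0) \<le> norm (y2 0) \<longrightarrow> t \<ge> 0 \<longrightarrow>
     norm (z1 t - z2 t) \<le> exp (L * t) * norm (z1 0 - z2 0)"
    using solution_lipschitz[of "norm (y2 0)"] by blast
  show ?thesis using L[rule_format, of y1 y2 t] assms by simp
qed

lemma flow_bounded: "\<exists>R>0. \<forall>z t. norm z \<le> k \<longrightarrow> t \<ge> 0 \<longrightarrow> norm (flow z t) < R"
proof -
  obtain R where "R > 0" and R: "\<forall>y. ode_solution fld y \<longrightarrow> norm (y 0) \<le> k \<longrightarrow> (\<forall>t\<ge>0. norm (y t) < R)"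
    using solution_bounded by blast
  moreover have "norm (flow z t) < R" if "norm z \<le> k" "t \<ge> 0" for z t
    using R[rule_format, OF flow_solution, of z t] that by simp
  ultimately show ?thesis by (intro exI[of _ R]) simp
qed

lemma solution_shift: "ode_solution fld y \<Longrightarrow> 0 \<le> s \<Longrightarrow> ode_solution fld (\<lambda>t. y (s + t))"
  unfolding ode_solution_def
proof (intro allI impI)
  fix t :: real assume y: "\<forall>t\<ge>0. (y has_vector_derivative fld (y t)) (at t within {0..})" and s: "0 \<le> s" "0 \<le> t"
  have "((\<lambda>t. s + t) has_vector_derivative 1) (at t within {0..})"
    by (auto intro!: derivative_eq_intros)
  moreover have "(y has_vector_derivative fld (y (s + t))) (at (s + t) within (\<lambda>t. s + t) ` {0..})"
    by (rule has_vector_derivative_within_subset[where S = "{0..}"])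
       (use y[rule_format, of "s + t"] s in \<open>auto simp: image_subset_iff\<close>)
  ultimately have "((y \<circ> (\<lambda>t. s + t)) has_vector_derivative 1 *\<^sub>R fld (y (s + t))) (at t within {0..})"
    by (rule vector_diff_chain_within)
  then show "((\<lambda>t. y (s + t)) has_vector_derivative fld (y (s + t))) (at t within {0..})"
    by (simp add: o_def)
qed

lemma flow_add: "0 \<le> s \<Longrightarrow> 0 \<le> t \<Longrightarrow> flow z (s + t) = flow (flow z s) t"
  using solution_unique[OF solution_shift[OF flow_solution] flow_solution, of s z "flow z s" t] by simp

lemma continuous_flow_time: "continuous_on {0..} (flow z)"
  by (rule ode_solution_continuous[OF flow_solution])

lemma continuous_flow_data: "0 \<le> t \<Longrightarrow> continuous_on S (\<lambda>z. flow z t)"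
proof -
  assume t: "0 \<le> t"
  have "isCont (\<lambda>z. flow z t) z" for z
  proof -
    obtain L where L0: "\<forall>y1 y2 t. ode_solution fld y1 \<longrightarrow> ode_solution fld y2 \<longrightarrow>
        norm (y1 0) \<le> norm z + 1 \<longrightarrow> norm (y2 0) \<le> norm z + 1 \<longrightarrow> t \<ge> 0 \<longrightarrow>
        norm (y1 t - y2 t) \<le> exp (L * t) * norm (y1 0 - y2 0)"
      using solution_lipschitz[of "norm z + 1"] by blast
    have L: "norm w \<le> norm z + 1 \<Longrightarrow> norm (flow w t - flow z t) \<le> exp (L * t) * norm (w - z)" for w
      using L0[rule_format, OF flow_solution flow_solution, of w z t] t by simp
    have "((\<lambda>w. flow w t - flow z t) \<longlongrightarrow> 0) (at z)"
    proof (rule Lim_null_comparison)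
      show "\<forall>\<^sub>F w in at z. norm (flow w t - flow z t) \<le> exp (L * t) * norm (w - z)"
        unfolding eventually_at
      proof (rule exI[of _ 1], safe)
        fix w assume "dist w z < 1"
        then have "norm w \<le> norm z + 1" using norm_triangle_ineq2[of w z] by (simp add: dist_norm)
        then show "norm (flow w t - flow z t) \<le> exp (L * t) * norm (w - z)" by (rule L)
      qed simp
      show "((\<lambda>w. exp (L * t) * norm (w - z)) \<longlongrightarrow> 0) (at z)"
        by (auto intro!: tendsto_eq_intros)
    qed
    then show ?thesis by (simp add: isCont_def LIM_zero_iff)
  qed
  then show ?thesis by (simp add: continuous_at_imp_continuous_on)
qed

end

section \<open>Limit points and the alternative for positive energy\<close>

lemma last_crossing:
  fixes f :: "real \<Rightarrow> real"
  assumes f: "continuous_on {a..b} f" and ab: "a \<le> b" and fa: "f a \<le> c" and fb: "c < f b"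
  obtains t where "a \<le> t" "t < b" "f t = c" "\<And>x. t < x \<Longrightarrow> x \<le> b \<Longrightarrow> c < f x"
proof -
  define S where "S = {t\<in>{a..b}. f t \<le> c}"
  have "closed S"
    unfolding S_def using continuous_on_closed_Collect_le[OF f continuous_on_const closed_atLeastAtMost] .
  moreover have aS: "a \<in> S" using fa ab by (simp add: S_def)
  moreover have bdd: "bdd_above S" by (auto simp: S_def intro!: bdd_aboveI[of _ b])
  ultimately have T: "Sup S \<in> S" using closed_contains_Sup by blast
  define t where "t = Sup S"
  have t: "a \<le> t" "t \<le> b" "f t \<le> c" using T by (auto simp: t_def S_def)
  then have "t \<noteq> b" using fb by auto
  have gt: "c < f x" if "t < x" "x \<le> b" for x
  proof (rule ccontr)
    assume "\<not> c < f x"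
    then have "x \<in> S" using that t by (simp add: S_def)
    then have "x \<le> t" unfolding t_def using bdd by (rule cSup_upper)
    then show False using that by simp
  qed
  have "f t = c"
  proof -
    have "\<exists>x. t \<le> x \<and> x \<le> b \<and> f x = c"
      by (rule IVT') (use t fb in \<open>auto intro: continuous_on_subset[OF f]\<close>)
    then show ?thesis using gt by (metis less_irrefl order_le_less)
  qed
  then show ?thesis using that t \<open>t \<noteq> b\<close> gt by (metis order_le_less)
qed

text \<open>Time reversal of \<open>last_crossing\<close>, applied to
  \<open>- f (- x)\<close>.\<close>

lemma first_zero:
  fixes f :: "real \<Rightarrow> real"
  assumes f: "continuous_on {a..b} f" and ab: "a \<le> b" and fa: "f a < 0" and fb: "0 \<le> f b"
  obtains t where "a < t" "t \<le> b" "f t = 0" "\<And>x. a \<le> x \<Longrightarrow> x < t \<Longrightarrow> f x < 0"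
proof -
  have "continuous_on {-b..-a} (\<lambda>x. - f (- x))"
    by (intro continuous_intros continuous_on_compose2[OF f]) auto
  then obtain t where t: "-b \<le> t" "t < -a" "- f (- t) = 0" "\<And>x. t < x \<Longrightarrow> x \<le> -a \<Longrightarrow> 0 < - f (- x)"
    using last_crossing[of "-b" "-a" "\<lambda>x. - f (- x)" 0] ab fa fb by auto
  show ?thesis
  proof (rule that[of "- t"])
    fix x assume "a \<le> x" "x < - t"
    then show "f x < 0" using t(4)[of "- x"] by simp
  qed (use t in auto)
qed

lemma antimono_bounded_tendsto:
  fixes f :: "real \<Rightarrow> real"
  assumes mono: "\<And>s t. T \<le> s \<Longrightarrow> s \<le> t \<Longrightarrow> f t \<le> f s" and low: "\<And>t. T \<le> t \<Longrightarrow> m \<le> f t"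
  obtains l where "(f \<longlongrightarrow> l) at_top" "\<And>t. T \<le> t \<Longrightarrow> l \<le> f t"
proof -
  define l where "l = Inf (f ` {T..})"
  have bdd: "bdd_below (f ` {T..})" using low by (auto intro!: bdd_belowI[of _ m])
  have l: "l \<le> f t" if "T \<le> t" for t
    unfolding l_def by (rule cInf_lower[OF _ bdd]) (use that in auto)
  have "(f \<longlongrightarrow> l) at_top"
  proof (rule decreasing_tendsto)
    show "\<forall>\<^sub>F t in at_top. l \<le> f t"
      using eventually_ge_at_top[of T] by eventually_elim (rule l)
    fix x assume "l < x"
    then obtain s where s: "T \<le> s" "f s < x"
      unfolding l_def using cInf_lessD[of "f ` {T..}" x] by auto
    show "\<forall>\<^sub>F t in at_top. f t < x"
      using eventually_ge_at_top[of s] by eventually_elim (use mono[OF s(1)] s(2) in force)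
  qed
  then show ?thesis using l by (rule that)
qed

lemma const_derivative_0:
  fixes f :: "real \<Rightarrow> 'a::euclidean_space"
  assumes "a < b" "t \<in> {a..b}" "(f has_vector_derivative d) (at t within {a..b})"
    "\<And>x. x \<in> {a..b} \<Longrightarrow> f x = c"
  shows "d = 0"
proof -
  have "((\<lambda>x. c) has_vector_derivative 0) (at t within {a..b})" by simp
  then have "(f has_vector_derivative 0) (at t within {a..b})"
    by (rule has_vector_derivative_transform[rotated -1]) (use assms in auto)
  then show ?thesis
    using vector_derivative_unique_within_closed_interval[of a b t f d 0] assms by simp
qed

context central_system
begin

section \<open>Limit sets and LaSalle's principle\<close>

definition omega :: "'a \<times> 'a \<Rightarrow> ('a \<times> 'a) set" where
  "omega z = {w. \<exists>\<tau>. filterlim \<tau> at_top sequentially \<and> (\<lambda>k. flow z (\<tau> k)) \<longlonglongrightarrow> w}"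

text \<open>Visits to \<open>C\<close> at arbitrarily late times would accumulate in
  \<open>C\<close>, since the forward orbit is bounded. This is how facts about limit points return
  to the trajectory.\<close>

lemma eventually_avoids:
  assumes C: "closed C" and "\<And>w. w \<in> omega z \<Longrightarrow> w \<notin> C"
  shows "\<forall>\<^sub>F t in at_top. flow z t \<notin> C"
proof (rule ccontr)
  assume "\<not> ?thesis"
  then have "\<forall>n::nat. \<exists>t\<ge>real n. flow z t \<in> C"
    unfolding eventually_at_top_linorder by blast
  then obtain \<tau> where \<tau>: "\<And>n. \<tau> n \<ge> real n" "\<And>n. flow z (\<tau> n) \<in> C" by metis
  obtain R where R: "\<forall>z' t. norm z' \<le> norm z \<longrightarrow> t \<ge> 0 \<longrightarrow> norm (flow z' t) < R" using flow_bounded by blast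
  have "norm (flow z (\<tau> n)) < R" for n
    by (rule R[rule_format]) (use \<tau>(1)[of n] in linarith)+
  then have "flow z (\<tau> n) \<in> cball 0 R \<inter> C" for n using \<tau>(2)[of n] by (simp add: less_imp_le)
  moreover have "compact (cball 0 R \<inter> C)" using C by (intro compact_Int_closed) auto
  ultimately obtain w r where w: "w \<in> cball 0 R \<inter> C" and r: "strict_mono r" "((\<lambda>n. flow z (\<tau> n)) \<circ> r) \<longlonglongrightarrow> w"
    unfolding compact_def by metis
  have "filterlim (\<lambda>k. \<tau> (r k)) at_top sequentially"
  proof (rule filterlim_at_top_mono[OF filterlim_real_sequentially])
    show "\<forall>\<^sub>F k in sequentially. real k \<le> \<tau> (r k)"
      using \<tau>(1) seq_suble[OF r(1)] by (intro always_eventually) (metis of_nat_mono order_trans)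
  qed
  then have "w \<in> omega z" using r(2) unfolding omega_def o_def by blast
  then show False using assms(2) w by blast
qed

lemma omega_nonempty: "\<exists>w. w \<in> omega z"
  using eventually_avoids[of UNIV z] by (auto simp: eventually_at_top_linorder)

lemma omega_flow:
  assumes "w \<in> omega z" "0 \<le> s"
  shows "flow w s \<in> omega z"
proof -
  obtain \<tau> where \<tau>: "filterlim \<tau> at_top sequentially" "(\<lambda>k. flow z (\<tau> k)) \<longlonglongrightarrow> w"
    using assms(1) by (auto simp: omega_def)
  have "(\<lambda>k. flow (flow z (\<tau> k)) s) \<longlonglongrightarrow> flow w s"
    by (rule continuous_on_tendsto_compose[OF continuous_flow_data[OF assms(2), of UNIV] \<tau>(2)]) auto
  moreover have "\<forall>\<^sub>F k in sequentially. flow (flow z (\<tau> k)) s = flow z (\<tau> k + s)"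
    using \<tau>(1)[unfolded filterlim_at_top, rule_format, of 0]
    by eventually_elim (use flow_add assms(2) in auto)
  ultimately have "(\<lambda>k. flow z (\<tau> k + s)) \<longlonglongrightarrow> flow w s" by (rule Lim_transform_eventually)
  moreover have "filterlim (\<lambda>k. \<tau> k + s) at_top sequentially"
    using filterlim_tendsto_add_at_top[OF tendsto_const \<tau>(1), of s] by (simp add: add.commute)
  ultimately show ?thesis unfolding omega_def by blast
qed

lemma omega_limit:
  assumes "continuous_on UNIV f" "((\<lambda>t. f (flow z t)) \<longlongrightarrow> l) at_top" "w \<in> omega z"
  shows "f w = (l :: real)"
proof -
  obtain \<tau> where \<tau>: "filterlim \<tau> at_top sequentially" "(\<lambda>k. flow z (\<tau> k)) \<longlonglongrightarrow> w"
    using assms(3) by (auto simp: omega_def)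
  have "(\<lambda>k. f (flow z (\<tau> k))) \<longlonglongrightarrow> f w"
    by (rule continuous_on_tendsto_compose[OF assms(1) \<tau>(2)]) auto
  moreover have "(\<lambda>k. f (flow z (\<tau> k))) \<longlonglongrightarrow> l" by (rule filterlim_compose[OF assms(2) \<tau>(1)])
  ultimately show ?thesis by (rule LIMSEQ_unique)
qed

lemma flow_deriv_Icc: "0 \<le> a \<Longrightarrow> t \<in> {a..b} \<Longrightarrow> (flow z has_vector_derivative fld (flow z t)) (at t within {a..b})"
  by (rule has_vector_derivative_within_subset[OF flow_deriv]) auto

text \<open>Rest on an interval forces zero acceleration, hence zero gradient, and then
  \<open>U\<close> vanishes by \<open>g_eq_0D\<close>.\<close>

lemma rest_imp_energy_0:
  assumes "0 \<le> a" "a < b" and rest: "\<And>t. t \<in> {a..b} \<Longrightarrow> snd (flow z t) = 0"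
  shows "en (flow z a) = 0"
proof -
  have "- (\<phi> (fst (flow z a)) *\<^sub>R snd (flow z a)) - g (fst (flow z a)) = 0"
    by (rule const_derivative_0[OF assms(2) _ snd_deriv[OF flow_deriv_Icc[OF assms(1)]]])
       (use rest assms in auto)
  then have "g (fst (flow z a)) = 0" using rest[of a] assms by simp
  then show ?thesis using g_eq_0D rest[of a] assms by (simp add: en_def)
qed

text \<open>Inside the radius \<open>r\<^sub>0\<close> constant energy means that \<phi> |v|^2 = 0
  with \<phi> > 0, and by continuity this lasts for a short time; the particle rests during that
  time and so has energy 0.\<close>

lemma constant_energy_exterior:
  assumes en: "\<And>t. 0 \<le> t \<Longrightarrow> en (flow w t) = E" and "E > 0" "0 \<le> s"
  shows "r\<^sub>0 \<le> norm (fst (flow w s))"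
proof (rule ccontr)
  assume "\<not> ?thesis"
  then have lt: "r\<^sub>0 - norm (fst (flow w s)) > 0" by simp
  have "continuous_on {0..} (\<lambda>t. norm (fst (flow w t)))"
    by (intro continuous_intros continuous_flow_time)
  from this[unfolded continuous_on_iff, rule_format, OF _ lt, of s] obtain d where d: "d > 0"
    and d': "\<And>t. 0 \<le> t \<Longrightarrow> dist t s < d \<Longrightarrow> dist (norm (fst (flow w t))) (norm (fst (flow w s))) < r\<^sub>0 - norm (fst (flow w s))"
    using \<open>0 \<le> s\<close> by auto
  have near: "norm (fst (flow w t)) < r\<^sub>0" if "0 \<le> t" "\<bar>t - s\<bar> < d" for t
    using d'[of t] that by (simp add: dist_real_def abs_less_iff)
  have "snd (flow w t) = 0" if "t \<in> {s..s + d / 2}" for t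
  proof -
    have t: "0 \<le> t" "\<bar>t - s\<bar> < d" using that d \<open>0 \<le> s\<close> by auto
    have "((\<lambda>x. en (flow w x)) has_vector_derivative - \<phi> (fst (flow w t)) * (snd (flow w t) \<bullet> snd (flow w t))) (at t within {0..t+1})"
      using en_deriv[OF flow_deriv_Icc, of 0 t "t + 1"] t
      by (simp add: has_real_derivative_iff_has_vector_derivative)
    from const_derivative_0[OF _ _ this, of E] have "\<phi> (fst (flow w t)) * (snd (flow w t) \<bullet> snd (flow w t)) = 0"
      using en t by simp
    then show ?thesis using phi_pos[OF near[OF t]] by auto
  qed
  then have "en (flow w s) = 0" using rest_imp_energy_0[of s "s + d / 2" w] d \<open>0 \<le> s\<close> by simp
  then show False using en[of s] \<open>E > 0\<close> \<open>0 \<le> s\<close> by simp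
qed

text \<open>LaSalle's step: the limit set is forward invariant, and a convergent quantity takes only
  its limit value there.\<close>

lemma omega_const:
  assumes "continuous_on UNIV f" "((\<lambda>t. f (flow z t)) \<longlongrightarrow> l) at_top" "w \<in> omega z" "0 \<le> s"
  shows "f (flow w s) = (l :: real)"
  by (rule omega_limit[OF assms(1,2) omega_flow[OF assms(3,4)]])

lemma omega_exterior:
  assumes "((\<lambda>t. en (flow z t)) \<longlongrightarrow> E) at_top" "E > 0" "w \<in> omega z" "0 \<le> s"
  shows "r\<^sub>0 \<le> norm (fst (flow w s))"
  by (rule constant_energy_exterior[of w E, OF omega_const[OF continuous_en assms(1,3)] assms(2,4)])

lemma continuous_sqnorm: "continuous_on S (\<lambda>z. fst z \<bullet> fst z)"
  by (intro continuous_intros)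

text \<open>A monotone bounded |x|^2 converges, so it is constant along limit trajectories, where
  its derivative \<open>2 * vr\<close> must vanish.\<close>

lemma monotone_radius_imp_vr_0:
  assumes mono: "(\<forall>t\<ge>T. 0 \<le> vr (flow z t)) \<or> (\<forall>t\<ge>T. vr (flow z t) \<le> 0)"
    and "w \<in> omega z" "0 \<le> s"
  shows "vr (flow w s) = 0"
proof -
  let ?R = "\<lambda>t. fst (flow z t) \<bullet> fst (flow z t)"
  define T' where "T' = max T 0"
  obtain B where B: "\<forall>z' t. norm z' \<le> norm z \<longrightarrow> t \<ge> 0 \<longrightarrow> norm (flow z' t) < B" using flow_bounded by blast
  have RB: "?R t \<le> B\<^sup>2" if "t \<ge> 0" for t
  proof -
    have "norm (fst (flow z t)) \<le> norm (flow z t)"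
      using norm_fst_le[of "fst (flow z t)" "snd (flow z t)"] by simp
    also have "\<dots> \<le> B" using B[rule_format, of z t] that by simp
    finally show ?thesis unfolding dot_square_norm by (intro power_mono) auto
  qed
  have "\<exists>l. (?R \<longlongrightarrow> l) at_top"
    using mono
  proof
    assume m: "\<forall>t\<ge>T. 0 \<le> vr (flow z t)"
    have "\<exists>l. ((\<lambda>t. - ?R t) \<longlongrightarrow> l) at_top"
    proof (rule antimono_bounded_tendsto[of T' "\<lambda>t. - ?R t" "- B\<^sup>2"])
      fix a b :: real assume ab: "T' \<le> a" "a \<le> b"
      have "?R a \<le> ?R b"
        by (rule deriv_nonneg_imp_mono_within[OF ab(2), where S = "{0..}", OF _ sqnorm_deriv[OF flow_deriv]])
           (use ab m in \<open>auto simp: T'_def\<close>)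
      then show "- ?R b \<le> - ?R a" by simp
    qed (use RB in \<open>auto simp: T'_def\<close>)
    then show ?thesis using tendsto_minus by fastforce
  next
    assume m: "\<forall>t\<ge>T. vr (flow z t) \<le> 0"
    show ?thesis
    proof (rule antimono_bounded_tendsto[of T' ?R 0])
      fix a b :: real assume ab: "T' \<le> a" "a \<le> b"
      show "?R b \<le> ?R a"
        by (rule deriv_nonpos_imp_antimono_within[OF ab(2), where S = "{0..}", OF _ sqnorm_deriv[OF flow_deriv]])
           (use ab m in \<open>auto simp: T'_def\<close>)
    qed auto
  qed
  then obtain l where l: "(?R \<longlongrightarrow> l) at_top" by blast
  have const: "fst (flow w t) \<bullet> fst (flow w t) = l" if "0 \<le> t" for t
    by (rule omega_const[OF continuous_sqnorm l assms(2) that])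
  have "((\<lambda>t. fst (flow w t) \<bullet> fst (flow w t)) has_vector_derivative 2 * vr (flow w s)) (at s within {0..s+1})"
    using sqnorm_deriv[OF flow_deriv_Icc, of 0 s "s + 1"] assms(3)
    by (simp add: has_real_derivative_iff_has_vector_derivative)
  from const_derivative_0[OF _ _ this, of l] show ?thesis using const assms(3) by simp
qed

lemma en_tendsto: "\<exists>E. ((\<lambda>t. en (flow z t)) \<longlongrightarrow> E) at_top"
  by (rule antimono_bounded_tendsto[of 0 "\<lambda>t. en (flow z t)" 0])
     (use solution_en_antimono[OF flow_solution] en_nonneg in auto)

text \<open>Without angular momentum the motion outside the support of \<open>\<phi>\<close> is radial with
  \<open>r'' = - U'(r) \<le> 0\<close>, so it cannot stay bounded and away from \<open>0\<close> at positive energy.\<close>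
lemma am_limit_pos:
  assumes E: "((\<lambda>t. en (flow z t)) \<longlongrightarrow> E) at_top" "E > 0"
    and M: "((\<lambda>t. am (flow z t)) \<longlongrightarrow> M) at_top"
  shows "M > 0"
proof -
  have "M \<ge> 0" by (rule tendsto_lowerbound[OF M]) (auto simp: am_nonneg)
  moreover have "M \<noteq> 0"
  proof
    assume "M = 0"
    obtain w where w: "w \<in> omega z" using omega_nonempty by blast
    let ?y = "flow w"
    have ext: "r\<^sub>0 \<le> norm (fst (?y t))" if "0 \<le> t" for t by (rule omega_exterior[OF E w that])
    have en0: "en (?y t) = E" if "0 \<le> t" for t by (rule omega_const[OF continuous_en E(1) w that])
    have am0: "am (?y t) = 0" if "0 \<le> t" for t
      using omega_const[OF continuous_am M w that] \<open>M = 0\<close> by simp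
    \<comment> \<open>This is the radial velocity r'. Without drag and angular momentum its
      derivative is - U'(r) \<le> 0, so once negative it stays negative.\<close>
    define \<sigma> where "\<sigma> = (\<lambda>t. vr (?y t) / sqrt (fst (?y t) \<bullet> fst (?y t)))"
    have Rpos: "fst (?y t) \<bullet> fst (?y t) > 0" if "0 \<le> t" for t
      unfolding inner_gt_zero_iff using ext[OF that] r0_pos by auto
    have \<sigma>_anti: "\<sigma> b \<le> \<sigma> a" if "0 \<le> a" "a \<le> b" for a b
    proof (rule deriv_nonpos_imp_antimono_within[OF that(2), where S = "{0..}"])
      fix t assume "t \<in> {a..b}"
      then have t: "0 \<le> t" using that by simp
      let ?x = "fst (?y t)" and ?v = "snd (?y t)"
      have vd: "((\<lambda>t. vr (?y t)) has_real_derivative ?v \<bullet> ?v - g ?x \<bullet> ?x) (at t within {0..})"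
        using vr_deriv[OF flow_deriv[OF t], of w] phi_zero[OF ext[OF t]] by simp
      have sd: "((\<lambda>t. sqrt (fst (?y t) \<bullet> fst (?y t))) has_real_derivative (vr (?y t) / sqrt (?x \<bullet> ?x))) (at t within {0..})"
        by (rule DERIV_cong[OF DERIV_chain2[OF DERIV_real_sqrt[OF Rpos[OF t]] sqnorm_deriv[OF flow_deriv[OF t]]]])
           (simp add: field_simps)
      show "(\<sigma> has_real_derivative (((?v \<bullet> ?v - g ?x \<bullet> ?x) * sqrt (?x \<bullet> ?x) - vr (?y t) * (vr (?y t) / sqrt (?x \<bullet> ?x)))
          / (sqrt (?x \<bullet> ?x) * sqrt (?x \<bullet> ?x)))) (at t within {0..})"
        unfolding \<sigma>_def by (rule DERIV_divide[OF vd sd]) (use Rpos[OF t] in auto)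
    next
      fix t assume "t \<in> {a<..<b}"
      then have t: "0 \<le> t" using that by simp
      let ?x = "fst (?y t)" and ?v = "snd (?y t)"
      have "(?v \<bullet> ?v - g ?x \<bullet> ?x) * (?x \<bullet> ?x) - (vr (?y t))\<^sup>2 = - ((g ?x \<bullet> ?x) * (?x \<bullet> ?x))"
        using am0[OF t] unfolding am_def by (simp add: algebra_simps)
      also have "\<dots> \<le> 0" using du_nonneg by (simp add: g_inner_self mult_nonneg_nonneg)
      finally have "(?v \<bullet> ?v - g ?x \<bullet> ?x) * sqrt (?x \<bullet> ?x) - vr (?y t) * (vr (?y t) / sqrt (?x \<bullet> ?x)) \<le> 0"
        using Rpos[OF t] by (simp add: field_simps power2_eq_square)
      then show "((?v \<bullet> ?v - g ?x \<bullet> ?x) * sqrt (?x \<bullet> ?x) - vr (?y t) * (vr (?y t) / sqrt (?x \<bullet> ?x)))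
          / (sqrt (?x \<bullet> ?x) * sqrt (?x \<bullet> ?x)) \<le> 0"
        by (intro divide_nonpos_nonneg) auto
    qed (use that in auto)
    have "\<exists>T. (\<forall>t\<ge>T. 0 \<le> vr (?y t)) \<or> (\<forall>t\<ge>T. vr (?y t) \<le> 0)"
    proof (cases "\<forall>t\<ge>0. 0 \<le> vr (?y t)")
      case False
      then obtain T where T: "0 \<le> T" "vr (?y T) < 0" by force
      have "vr (?y t) \<le> 0" if "t \<ge> T" for t
      proof -
        have "\<sigma> t \<le> \<sigma> T" by (rule \<sigma>_anti[OF T(1) that])
        also have "\<sigma> T < 0" unfolding \<sigma>_def using T Rpos[OF T(1)] by (auto intro: divide_neg_pos)
        finally have "vr (?y t) / sqrt (fst (?y t) \<bullet> fst (?y t)) < 0" by (simp only: \<sigma>_def)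
        moreover have "sqrt (fst (?y t) \<bullet> fst (?y t)) > 0" using Rpos[of t] T that by simp
        ultimately show ?thesis by (auto simp only: divide_less_0_iff)
      qed
      then show ?thesis by blast
    qed blast
    then obtain T where T: "(\<forall>t\<ge>T. 0 \<le> vr (?y t)) \<or> (\<forall>t\<ge>T. vr (?y t) \<le> 0)" by blast
    \<comment> \<open>A second passage to the limit, now from \<open>w\<close>: there
      \<open>vr\<close> vanishes as well, and \<open>am = vr = 0\<close> away from the centre leaves
      only zero velocity.\<close>
    obtain w2 where w2: "w2 \<in> omega w" using omega_nonempty by blast
    have enw: "((\<lambda>t. en (?y t)) \<longlongrightarrow> E) at_top"
      by (rule tendsto_eventually) (use en0 in \<open>auto simp: eventually_at_top_linorder\<close>)
    have amw: "((\<lambda>t. am (?y t)) \<longlongrightarrow> 0) at_top"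
      by (rule tendsto_eventually) (use am0 in \<open>auto simp: eventually_at_top_linorder\<close>)
    have "snd (flow w2 t) = 0" if "0 \<le> t" for t
    proof -
      have "fst (flow w2 t) \<noteq> 0" using omega_exterior[OF enw E(2) w2 that] r0_pos by auto
      moreover have "am (flow w2 t) = 0" by (rule omega_const[OF continuous_am amw w2 that])
      moreover have "vr (flow w2 t) = 0" by (rule monotone_radius_imp_vr_0[OF T w2 that])
      ultimately show ?thesis by (simp add: am_def)
    qed
    then have "en (flow w2 0) = 0" by (intro rest_imp_energy_0[of 0 1]) auto
    moreover have "en (flow w2 0) = E" by (rule omega_const[OF continuous_en enw w2]) simp
    ultimately show False using E(2) by simp
  qed
  ultimately show ?thesis by simp
qed

text \<open>The energy minus the effective potential at radius \<open>\<rho>\<close>: a particle at radius \<open>\<rho>\<close> has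
  \<open>barrier \<rho> = r'\<^sup>2 / 2\<close>. Relative to the squared angular momentum it can only grow while the
  particle stays outside radius \<open>\<rho>\<close>.\<close>
definition barrier :: "real \<Rightarrow> 'a \<times> 'a \<Rightarrow> real" where
  "barrier \<rho> z = en z - am z / (2 * \<rho>\<^sup>2) - u \<rho>"

lemma barrier_at_radius:
  assumes "\<rho> > 0" "norm (fst z) = \<rho>"
  shows "barrier \<rho> z = (vr z)\<^sup>2 / (2 * \<rho>\<^sup>2)"
proof -
  have "fst z \<bullet> fst z = \<rho>\<^sup>2" using assms by (simp add: dot_square_norm)
  then show ?thesis using assms by (simp add: barrier_def en_def am_def U_radial field_simps)
qed

text \<open>The barrier and the squared angular momentum both decay at the rate 2 \<phi>, except for
  a source term 2 \<phi> (U - u \<rho>) in the barrier. In the quotient only the source survives,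
  and outside the radius \<rho> its sign is known.\<close>

lemma barrier_quotient_deriv:
  assumes "0 \<le> t" "am (flow z t) > 0" "\<rho> > 0"
  shows "((\<lambda>t. barrier \<rho> (flow z t) / am (flow z t)) has_real_derivative
     2 * \<phi> (fst (flow z t)) * (U (fst (flow z t)) - u \<rho>) / am (flow z t)) (at t within {0..})"
proof -
  let ?A = "am (flow z t)" and ?p = "\<phi> (fst (flow z t))" and ?v2 = "snd (flow z t) \<bullet> snd (flow z t)"
  have b: "((\<lambda>t. barrier \<rho> (flow z t)) has_real_derivative (- ?p * ?v2 - (- 2 * ?p * ?A) / (2 * \<rho>\<^sup>2) - 0)) (at t within {0..})"
    unfolding barrier_def
    by (intro DERIV_diff DERIV_const DERIV_cdivide en_deriv am_deriv flow_deriv assms)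
  have n: "- ?p * ?v2 - (- 2 * ?p * ?A) / (2 * \<rho>\<^sup>2) - 0 = - 2 * ?p * (barrier \<rho> (flow z t) - (U (fst (flow z t)) - u \<rho>))"
    using assms by (simp add: barrier_def en_def field_simps)
  show ?thesis
    by (rule DERIV_cong[OF DERIV_divide[OF b am_deriv[OF flow_deriv[OF assms(1)]]]], use assms in simp)
       (unfold n, use assms in \<open>simp add: field_simps\<close>)
qed

lemma barrier_quotient_mono:
  assumes "0 \<le> a" "a \<le> b" "\<rho> > 0"
    and am: "\<And>t. 0 \<le> t \<Longrightarrow> am (flow z t) > 0"
    and out: "\<And>t. t \<in> {a..b} \<Longrightarrow> \<rho> \<le> norm (fst (flow z t))"
  shows "barrier \<rho> (flow z a) / am (flow z a) \<le> barrier \<rho> (flow z b) / am (flow z b)"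
proof (rule deriv_nonneg_imp_mono_within[OF assms(2), where S = "{0..}"])
  fix t assume "t \<in> {a..b}"
  then show "((\<lambda>t. barrier \<rho> (flow z t) / am (flow z t)) has_real_derivative
     2 * \<phi> (fst (flow z t)) * (U (fst (flow z t)) - u \<rho>) / am (flow z t)) (at t within {0..})"
    using assms by (intro barrier_quotient_deriv) auto
next
  fix t assume t: "t \<in> {a<..<b}"
  then have "u \<rho> \<le> U (fst (flow z t))" using out[of t] assms(3) unfolding U_radial by (intro u_mono) auto
  then show "0 \<le> 2 * \<phi> (fst (flow z t)) * (U (fst (flow z t)) - u \<rho>) / am (flow z t)"
    using phi_nonneg am[of t] t assms(1) by (intro divide_nonneg_nonneg mult_nonneg_nonneg) auto
qed (use assms in auto)

lemma barrier_nonneg_after: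
  assumes "0 \<le> a" "a \<le> b" "\<rho> > 0"
    and am: "\<And>t. 0 \<le> t \<Longrightarrow> am (flow z t) > 0"
    and out: "\<And>t. t \<in> {a..b} \<Longrightarrow> \<rho> \<le> norm (fst (flow z t))"
    and start: "norm (fst (flow z a)) = \<rho>"
  shows "0 \<le> barrier \<rho> (flow z b)"
proof -
  have "0 \<le> barrier \<rho> (flow z a) / am (flow z a)"
    using barrier_at_radius[OF assms(3) start] am[OF assms(1)] by simp
  also have "\<dots> \<le> barrier \<rho> (flow z b) / am (flow z b)" by (rule barrier_quotient_mono[OF assms(1-5)])
  finally show ?thesis using am[of b] assms(1,2) by (auto simp: zero_le_divide_iff)
qed

lemma continuous_radius: "S \<subseteq> {0..} \<Longrightarrow> continuous_on S (\<lambda>t. norm (fst (flow z t)))"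
  by (intro continuous_intros continuous_on_subset[OF continuous_flow_time])

lemma continuous_vr_flow: "S \<subseteq> {0..} \<Longrightarrow> continuous_on S (\<lambda>t. vr (flow z t))"
  by (intro continuous_on_compose2[OF continuous_vr[of UNIV] continuous_on_subset[OF continuous_flow_time]]) auto

text \<open>Once a particle has come out from a smaller radius, its distance to the centre cannot have a
  local minimum: the barrier estimate would force this minimum and the last earlier passage through
  the same radius to be circular motions, and then the radius is constant in between.\<close>
lemma no_return:
  assumes am: "\<And>t. 0 \<le> t \<Longrightarrow> am (flow z t) > 0"
    and t1: "0 \<le> t1" "t1 < s" "s < t'"
    and smaller: "norm (fst (flow z t1)) < norm (fst (flow z t'))"
    and inward: "\<And>t. s \<le> t \<Longrightarrow> t < t' \<Longrightarrow> vr (flow z t) < 0" and turn: "vr (flow z t') = 0"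
  shows False
proof -
  let ?y = "flow z"
  define r where "r = (\<lambda>t. norm (fst (?y t)))"
  define \<rho> where "\<rho> = r t'"
  have \<rho>: "\<rho> > 0" using smaller norm_ge_zero le_less_trans unfolding \<rho>_def r_def by blast
  have rsq: "fst (?y t) \<bullet> fst (?y t) = (r t)\<^sup>2" for t by (simp add: r_def dot_square_norm)
  have r0: "r t \<ge> 0" for t by (simp add: r_def)
  have rc: "continuous_on S r" if "S \<subseteq> {0..}" for S
    unfolding r_def by (rule continuous_radius[OF that])
  have y': "(?y has_vector_derivative fld (?y t)) (at t within {0..})" if "0 \<le> t" for t
    by (rule flow_deriv[OF that])
  have r_late: "\<rho> < r a" if "s \<le> a" "a < t'" for a
  proof -
    have "(r t')\<^sup>2 < (r a)\<^sup>2"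
    proof (rule DERIV_neg_imp_decreasing_open[OF that(2)])
      fix x assume x: "a < x" "x < t'"
      have "((\<lambda>t. (r t)\<^sup>2) has_real_derivative 2 * vr (?y x)) (at x within {a..t'})"
        using sqnorm_deriv[OF flow_deriv_Icc, of a x t' z] x that t1 by (simp add: rsq)
      then have "((\<lambda>t. (r t)\<^sup>2) has_real_derivative 2 * vr (?y x)) (at x)"
        using at_within_Icc_at[OF x] by simp
      moreover have "2 * vr (?y x) < 0" using inward x that by simp
      ultimately show "\<exists>y. ((\<lambda>t. (r t)\<^sup>2) has_real_derivative y) (at x) \<and> y < 0" by blast
    next
      show "continuous_on {a..t'} (\<lambda>t. (r t)\<^sup>2)" by (intro continuous_intros rc) (use that t1 in auto)
    qed
    then show ?thesis unfolding \<rho>_def using r0 by (rule power2_less_imp_less)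
  qed
  \<comment> \<open>The last passage through the radius \<rho> of the turning point before
    \<open>s\<close>: the particle is below \<rho> at \<open>t1\<close> and above it at
    \<open>s\<close>.\<close>
  obtain t3 where t3: "t1 \<le> t3" "t3 < s" "r t3 = \<rho>" "\<And>t. t3 < t \<Longrightarrow> t \<le> s \<Longrightarrow> \<rho> < r t"
    by (rule last_crossing[of t1 s r \<rho>]) (use rc t1 smaller r_late[of s] in \<open>auto simp: \<rho>_def r_def\<close>)
  have t3': "0 \<le> t3" "t3 \<le> t'" "t3 < t'" using t3 t1 by auto
  have out: "\<rho> \<le> r t" if tt: "t \<in> {t3..t'}" for t
  proof -
    consider "t = t3" | "t3 < t" "t \<le> s" | "s \<le> t" "t < t'" | "t = t'" using tt by fastforce
    then show ?thesis using t3(3,4) r_late \<rho>_def by cases (auto intro: less_imp_le)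
  qed
  define Q where "Q = (\<lambda>t. barrier \<rho> (?y t) / am (?y t))"
  have Qmono: "Q a \<le> Q b" if "t3 \<le> a" "a \<le> b" "b \<le> t'" for a b
    unfolding Q_def by (rule barrier_quotient_mono[OF _ that(2) \<rho> am]) (use that t3' out in \<open>auto simp: r_def\<close>)
  have "Q t3 \<ge> 0" unfolding Q_def
    using barrier_at_radius[OF \<rho>, of "?y t3"] t3(3) am[OF t3'(1)] by (simp add: r_def)
  moreover have "Q t' = 0" unfolding Q_def
    using barrier_at_radius[OF \<rho>, of "?y t'"] turn by (simp add: \<rho>_def r_def)
  \<comment> \<open>\<open>Q\<close> is nondecreasing, nonnegative at \<open>t3\<close> and zero at
    \<open>t'\<close>, which leaves only the equality case.\<close>
  ultimately have Q0: "Q t = 0" if "t \<in> {t3..t'}" for t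
    using Qmono[of t3 t] Qmono[of t t'] that by auto
  have b0: "barrier \<rho> (?y t) = 0" if "t \<in> {t3..t'}" for t
    using Q0[OF that] am[of t] that t3' by (simp add: Q_def)
  have "(vr (?y t3))\<^sup>2 / (2 * \<rho>\<^sup>2) = 0"
    using barrier_at_radius[OF \<rho>, of "?y t3"] b0[of t3] t3 t3' by (simp add: r_def)
  then have vr3: "vr (?y t3) = 0" using \<rho> by simp
  define m where "m = am (?y t3)"
  have m: "m > 0" unfolding m_def by (rule am[OF t3'(1)])
  \<comment> \<open>Every radius between \<open>r t1\<close> and \<rho> has been passed before
    \<open>t3\<close>, so the energy at \<open>t3\<close> is at least the effective potential there.
    Zero barrier says that this energy equals the effective potential at \<rho>.\<close>
  have inner_barrier: "m / (2 * \<rho>'\<^sup>2) + u \<rho>' \<le> m / (2 * \<rho>\<^sup>2) + u \<rho>" if \<rho>': "r t1 < \<rho>'" "\<rho>' < \<rho>" for \<rho>'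
  proof -
    obtain t4 where t4: "t1 \<le> t4" "t4 < t3" "r t4 = \<rho>'" "\<And>t. t4 < t \<Longrightarrow> t \<le> t3 \<Longrightarrow> \<rho>' < r t"
      by (rule last_crossing[of t1 t3 r \<rho>']) (use rc t1 t3 \<rho>' in auto)
    have "0 \<le> barrier \<rho>' (?y t3)"
    proof (rule barrier_nonneg_after[of t4])
      show "0 < \<rho>'" using \<rho>' r0[of t1] by linarith
      show "\<rho>' \<le> norm (fst (?y t))" if "t \<in> {t4..t3}" for t
        using t4(3) t4(4)[of t] that by (cases "t = t4") (auto simp: r_def)
    qed (use t4 t1 am in \<open>auto simp: r_def\<close>)
    then show ?thesis using b0[of t3] t3' by (simp add: barrier_def m_def)
  qed
  \<comment> \<open>Just below \<rho> the effective potential is at most its value at \<rho>, so its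
    derivative at \<rho> is nonnegative: the central force balances at least the centrifugal
    one.\<close>
  have du\<rho>: "m / \<rho>\<^sup>2 \<le> \<rho> * du \<rho>"
  proof -
    have D: "((\<lambda>x. m / (2 * x\<^sup>2) + u x) has_real_derivative (du \<rho> - m / \<rho> ^ 3)) (at \<rho>)"
    proof -
      have "((\<lambda>x. m / (2 * x\<^sup>2)) has_real_derivative - m / \<rho> ^ 3) (at \<rho>)"
        using \<rho> by (auto intro!: derivative_eq_intros simp: field_simps power2_eq_square power3_eq_cube)
      from DERIV_add[OF this u_deriv[OF \<rho>]] show ?thesis by (rule DERIV_cong) simp
    qed
    have "du \<rho> - m / \<rho> ^ 3 \<ge> 0"
    proof (rule ccontr)
      assume "\<not> ?thesis"
      then obtain d where d: "d > 0" "\<forall>h>0. h < d \<longrightarrow> m / (2 * \<rho>\<^sup>2) + u \<rho> < m / (2 * (\<rho> - h)\<^sup>2) + u (\<rho> - h)"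
        using DERIV_neg_dec_left[OF D] by auto
      define h where "h = min (d / 2) ((\<rho> - r t1) / 2)"
      have "r t1 < \<rho>" using smaller by (simp add: \<rho>_def r_def)
      then have "0 < h" "h < d" "r t1 < \<rho> - h" using d(1) by (auto simp: h_def min_def field_simps)
      then show False using d(2) inner_barrier[of "\<rho> - h"] by force
    qed
    then show ?thesis using \<rho> by (simp add: field_simps power2_eq_square power3_eq_cube)
  qed
  then have du_pos: "du \<rho> > 0"
    using m \<rho> by (metis divide_pos_pos less_le_trans zero_less_mult_pos zero_less_power)
  have u_strict: "u \<rho> < u x" if "\<rho> < x" for x
  proof -
    obtain d where d: "d > 0" "\<forall>h>0. h < d \<longrightarrow> u \<rho> < u (\<rho> + h)"
      using DERIV_pos_inc_right[OF u_deriv[OF \<rho>] du_pos] by blast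
    have "u \<rho> < u (\<rho> + min (d / 2) (x - \<rho>))" using d that by auto
    also have "\<dots> \<le> u x" by (rule u_mono) (use \<rho> d that in auto)
    finally show ?thesis .
  qed
  \<comment> \<open>The derivative of the constant \<open>Q\<close> vanishes, so \<phi> is 0
    wherever the radius exceeds \<rho>, as \<open>U\<close> exceeds \<open>u \<rho>\<close> there.
    At radius \<rho> zero barrier gives \<open>vr = 0\<close> instead.\<close>
  have no_drag: "\<phi> (fst (?y t)) * vr (?y t) = 0" if t: "t3 < t" "t < t'" for t
  proof (cases "r t = \<rho>")
    case True
    then have "(vr (?y t))\<^sup>2 / (2 * \<rho>\<^sup>2) = 0"
      using barrier_at_radius[OF \<rho>, of "?y t"] b0[of t] t by (simp add: r_def)
    then show ?thesis using \<rho> by simp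
  next
    case False
    then have gt: "\<rho> < r t" using out[of t] t by auto
    have at: "am (?y t) > 0" using am t t3' by simp
    have "(Q has_vector_derivative 2 * \<phi> (fst (?y t)) * (U (fst (?y t)) - u \<rho>) / am (?y t)) (at t within {t3..t'})"
      using barrier_quotient_deriv[OF _ at \<rho>] t t3' unfolding Q_def
      by (auto intro: has_field_derivative_subset simp flip: has_real_derivative_iff_has_vector_derivative)
    from const_derivative_0[OF _ _ this, of 0] have "\<phi> (fst (?y t)) * (U (fst (?y t)) - u \<rho>) = 0"
      using Q0 t at by auto
    moreover have "U (fst (?y t)) - u \<rho> > 0" using u_strict[OF gt] by (simp add: U_radial r_def)
    ultimately show ?thesis by simp
  qed
  have rB: "\<exists>B\<ge>\<rho>. \<forall>t\<in>{t3..t'}. r t \<le> B"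
  proof -
    have "\<exists>x\<in>{t3..t'}. \<forall>t\<in>{t3..t'}. r t \<le> r x"
      by (rule continuous_attains_sup) (use t3' rc in auto)
    then show ?thesis using out by blast
  qed
  then obtain B where B: "B \<ge> \<rho>" "\<And>t. t \<in> {t3..t'} \<Longrightarrow> r t \<le> B" by blast
  obtain L where L: "L-lipschitz_on {0..B} du" using du_lip by blast
  have L0: "L \<ge> 0" by (rule lipschitz_on_nonneg[OF L])
  define q where "q = (\<lambda>t. (r t)\<^sup>2 - \<rho>\<^sup>2)"
  define a where "a = (\<lambda>t. snd (?y t) \<bullet> snd (?y t) - \<phi> (fst (?y t)) * vr (?y t) - g (fst (?y t)) \<bullet> fst (?y t))"
  have q': "(q has_real_derivative 2 * vr (?y t)) (at t within {0..})" if "0 \<le> t" for t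
    using DERIV_diff[OF sqnorm_deriv[OF y'[OF that]] DERIV_const[of "\<rho>\<^sup>2"]] by (simp add: q_def rsq)
  have v': "((\<lambda>t. vr (?y t)) has_real_derivative a t) (at t within {0..})" if "0 \<le> t" for t
    unfolding a_def by (rule vr_deriv[OF y'[OF that]])
  \<comment> \<open>Zero barrier bounds |v|^2 by \<open>m / \<rho>\<^sup>2\<close>, hence by
    \<open>\<rho> * du \<rho>\<close>; the Lipschitz bound of \<open>du\<close> compares this with
    the central force at \<open>r t\<close>.\<close>
  have a_le: "a t \<le> L * q t" if t: "t3 < t" "t < t'" for t
  proof -
    have tt: "t \<in> {t3..t'}" "0 \<le> t" using t t3' by auto
    have le: "\<rho> \<le> r t" "r t \<le> B" using out B tt by auto
    have "snd (?y t) \<bullet> snd (?y t) = am (?y t) / \<rho>\<^sup>2 + 2 * (u \<rho> - u (r t))"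
      using b0[OF tt(1)] by (simp add: barrier_def en_def U_radial r_def field_simps)
    also have "\<dots> \<le> m / \<rho>\<^sup>2 + 0"
      using solution_am_antimono[OF flow_solution t3'(1), of t z] t u_mono[of \<rho> "r t"] le \<rho>
      by (intro add_mono divide_right_mono) (auto simp: m_def)
    finally have "a t \<le> \<rho> * du \<rho> - r t * du (r t)"
      using du\<rho> unfolding a_def no_drag[OF t] g_inner_self by (simp add: r_def)
    also have "\<dots> = \<rho> * (du \<rho> - du (r t)) - (r t - \<rho>) * du (r t)" by (simp add: algebra_simps)
    also have "\<dots> \<le> \<rho> * (L * (r t - \<rho>)) - 0"
    proof (intro diff_mono mult_left_mono)
      show "du \<rho> - du (r t) \<le> L * (r t - \<rho>)"
        using lipschitz_onD[OF L, of \<rho> "r t"] le \<rho> B(1) by (simp add: dist_real_def)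
      show "0 \<le> (r t - \<rho>) * du (r t)" using le du_nonneg[OF r0] by simp
    qed (use \<rho> in simp)
    also have "\<dots> \<le> L * q t"
    proof -
      have "\<rho> * (r t - \<rho>) \<le> (r t + \<rho>) * (r t - \<rho>)"
        using le r0[of t] by (intro mult_right_mono) auto
      also have "\<dots> = q t" by (simp add: q_def algebra_simps power2_eq_square)
      finally show ?thesis using mult_left_mono[OF _ L0] by (simp add: mult.left_commute)
    qed
    finally show ?thesis .
  qed
  \<comment> \<open>With \<open>k\<^sup>2 = 2 * L\<close> the inequality q'' \<le> 2 L q factors
    into two of first order, one for q' + k q and one for q. Both quantities vanish at
    \<open>t3\<close>, so \<open>q \<le> 0\<close> up to \<open>s\<close>, where the radius is
    larger than \<rho>.\<close>
  define k where "k = sqrt (2 * L)"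
  have k: "k \<ge> 0" "k * k = 2 * L" using L0 by (auto simp: k_def)
  have h: "2 * vr (?y t) + k * q t \<le> 0" if t: "t \<in> {t3..t'}" for t
  proof -
    let ?h = "\<lambda>t. (2 * vr (?y t) + k * q t) * exp (- k * t)"
    have "?h t \<le> ?h t3"
    proof (rule deriv_nonpos_imp_antimono_within[where S = "{0..}" and f = ?h and a = t3 and b = t])
      fix x assume "x \<in> {t3..t}"
      then have x: "0 \<le> x" using t3' by simp
      show "(?h has_real_derivative (2 * a x + k * (2 * vr (?y x)) - k * (2 * vr (?y x) + k * q x)) * exp (- k * x)) (at x within {0..})"
        by (rule derivative_eq_intros v'[OF x] q'[OF x] refl)+ (simp add: algebra_simps)
    next
      fix x assume "x \<in> {t3<..<t}"
      then have "2 * a x \<le> k * k * q x" using a_le[of x] t k by simp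
      then show "(2 * a x + k * (2 * vr (?y x)) - k * (2 * vr (?y x) + k * q x)) * exp (- k * x) \<le> 0"
        by (intro mult_nonpos_nonneg) (auto simp: algebra_simps)
    qed (use t t3' in auto)
    also have "?h t3 = 0" by (simp add: vr3 q_def t3)
    finally show ?thesis by (simp add: mult_le_0_iff)
  qed
  have "q s * exp (k * s) \<le> q t3 * exp (k * t3)"
  proof (rule deriv_nonpos_imp_antimono_within[where S = "{0..}" and f = "\<lambda>x. q x * exp (k * x)" and a = t3 and b = s])
    fix x assume "x \<in> {t3..s}"
    then have x: "0 \<le> x" using t3' by simp
    show "((\<lambda>x. q x * exp (k * x)) has_real_derivative (2 * vr (?y x) + k * q x) * exp (k * x)) (at x within {0..})"
      by (rule derivative_eq_intros q'[OF x] refl)+ (simp add: algebra_simps)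
  next
    fix x assume "x \<in> {t3<..<s}"
    then show "(2 * vr (?y x) + k * q x) * exp (k * x) \<le> 0"
      using h[of x] t1 by (intro mult_nonpos_nonneg) auto
  qed (use t3 t3' in auto)
  also have "\<dots> = 0" by (simp add: q_def t3)
  finally have "q s \<le> 0" by (simp add: mult_le_0_iff)
  moreover have "q s > 0"
    unfolding q_def using power_strict_mono[OF r_late[of s], of 2] t1 \<rho> by simp
  ultimately show False by simp
qed

lemma am_tendsto_pos:
  assumes E: "((\<lambda>t. en (flow z t)) \<longlongrightarrow> E) at_top" "E > 0"
  shows "\<exists>m>0. \<forall>t\<ge>0. m \<le> am (flow z t)"
proof -
  obtain M where M: "((\<lambda>t. am (flow z t)) \<longlongrightarrow> M) at_top" "\<And>t. 0 \<le> t \<Longrightarrow> M \<le> am (flow z t)"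
    by (rule antimono_bounded_tendsto[of 0 "\<lambda>t. am (flow z t)" 0])
       (use solution_am_antimono[OF flow_solution] am_nonneg in auto)
  then show ?thesis using am_limit_pos[OF E M(1)] by blast
qed

text \<open>Limit points lie outside the radius \<open>r\<^sub>0\<close>, so the particle leaves a
  slightly smaller ball for good. From then on an inward phase never ends: its end would be a local
  minimum of the radius above an earlier radius, which \<open>no_return\<close> excludes. So
  \<open>vr\<close> eventually has one sign.\<close>

theorem positive_energy_imp_asymptotically_circular:
  assumes E: "((\<lambda>t. en (flow z t)) \<longlongrightarrow> E) at_top" "E > 0"
    and t1: "0 \<le> t1" "norm (fst (flow z t1)) < r\<^sub>0"
  shows "((\<lambda>t. vr (flow z t)) \<longlongrightarrow> 0) at_top"
proof -
  obtain m where "m > 0" "\<And>t. 0 \<le> t \<Longrightarrow> m \<le> am (flow z t)" using am_tendsto_pos[OF E] by blast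
  then have am: "am (flow z t) > 0" if "0 \<le> t" for t using that by (meson less_le_trans)
  \<comment> \<open>Strictly between the radius at \<open>t1\<close> and \<open>r\<^sub>0\<close>:
    no limit point has radius at most \<rho>, and all late radii exceed the one at
    \<open>t1\<close>.\<close>
  define \<rho> where "\<rho> = (norm (fst (flow z t1)) + r\<^sub>0) / 2"
  have \<rho>: "norm (fst (flow z t1)) < \<rho>" "\<rho> < r\<^sub>0" using t1 by (auto simp: \<rho>_def)
  have "closed {w :: 'a \<times> 'a. norm (fst w) \<le> \<rho>}"
    by (intro closed_Collect_le continuous_intros)
  then have "\<forall>\<^sub>F t in at_top. flow z t \<notin> {w. norm (fst w) \<le> \<rho>}"
    by (rule eventually_avoids) (use omega_exterior[OF E, of _ 0] \<rho> in force)
  then obtain T0 where T0: "\<And>t. t \<ge> T0 \<Longrightarrow> norm (fst (flow z t)) > \<rho>"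
    unfolding eventually_at_top_linorder by force
  define T where "T = max T0 t1"
  have T: "T \<ge> t1" "\<And>t. t \<ge> T \<Longrightarrow> norm (fst (flow z t)) > \<rho>" using T0 by (auto simp: T_def)
  have "\<exists>T. (\<forall>t\<ge>T. 0 \<le> vr (flow z t)) \<or> (\<forall>t\<ge>T. vr (flow z t) \<le> 0)"
  proof (cases "\<forall>t\<ge>T. 0 \<le> vr (flow z t)")
    case False
    then obtain s where s: "T \<le> s" "vr (flow z s) < 0" by force
    have "s \<noteq> t1" using T(2)[OF s(1)] \<rho> by auto
    then have ts: "t1 < s" using s T by simp
    have "vr (flow z t) < 0" if st: "s \<le> t" for t
    proof (rule ccontr)
      assume nt: "\<not> vr (flow z t) < 0"
      obtain t' where t': "s < t'" "t' \<le> t" "vr (flow z t') = 0" "\<And>x. s \<le> x \<Longrightarrow> x < t' \<Longrightarrow> vr (flow z x) < 0"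
        by (rule first_zero[of s t "\<lambda>t. vr (flow z t)"])
           (use continuous_vr_flow st s nt ts t1 in auto)
      have "norm (fst (flow z t1)) < norm (fst (flow z t'))" using T(2)[of t'] t' s \<rho> by auto
      from no_return[OF am t1(1) ts t'(1) this t'(4,3)] show False .
    qed
    then show ?thesis by (auto intro!: exI[of _ s] less_imp_le)
  qed blast
  then obtain T' where mono: "(\<forall>t\<ge>T'. 0 \<le> vr (flow z t)) \<or> (\<forall>t\<ge>T'. vr (flow z t) \<le> 0)" by blast
  have vr0: "vr w = 0" if "w \<in> omega z" for w
    using monotone_radius_imp_vr_0[OF mono that, of 0] by simp
  show ?thesis
  proof (rule tendstoI)
    fix \<epsilon> :: real assume \<epsilon>: "\<epsilon> > 0"
    have "closed {w :: 'a \<times> 'a. \<epsilon> \<le> \<bar>vr w\<bar>}"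
      by (intro closed_Collect_le continuous_intros continuous_vr)
    then have "\<forall>\<^sub>F t in at_top. flow z t \<notin> {w. \<epsilon> \<le> \<bar>vr w\<bar>}"
      by (rule eventually_avoids) (use vr0 \<epsilon> in auto)
    then show "\<forall>\<^sub>F t in at_top. dist (vr (flow z t)) 0 < \<epsilon>"
      by eventually_elim (simp add: dist_real_def)
  qed
qed

end

section \<open>A volume-controlled splitting scheme\<close>

lemma nn_integral_lborel_affine:
  fixes t :: "'a::euclidean_space" and f :: "'a \<Rightarrow> ennreal"
  assumes [measurable]: "f \<in> borel_measurable borel" and c: "c \<noteq> 0"
  shows "(\<integral>\<^sup>+x. f (t + c *\<^sub>R x) * ennreal (\<bar>c\<bar> ^ DIM('a)) \<partial>lborel) = (\<integral>\<^sup>+x. f x \<partial>lborel)"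
proof -
  have "(\<integral>\<^sup>+x. f x \<partial>lborel) = (\<integral>\<^sup>+x. f x \<partial>density (distr lborel borel (\<lambda>x. t + c *\<^sub>R x)) (\<lambda>_. ennreal (\<bar>c\<bar> ^ DIM('a))))"
    using lborel_affine[OF c, of t] by simp
  also have "\<dots> = (\<integral>\<^sup>+x. ennreal (\<bar>c\<bar> ^ DIM('a)) * f x \<partial>distr lborel borel (\<lambda>x. t + c *\<^sub>R x))"
    by (rule nn_integral_density) measurable
  also have "\<dots> = (\<integral>\<^sup>+x. ennreal (\<bar>c\<bar> ^ DIM('a)) * f (t + c *\<^sub>R x) \<partial>lborel)"
    by (rule nn_integral_distr) measurable
  finally show ?thesis by (simp add: mult.commute)
qed

lemma nn_integral_lborel_translate:
  fixes t :: "'a::euclidean_space" and f :: "'a \<Rightarrow> ennreal"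
  assumes "f \<in> borel_measurable borel"
  shows "(\<integral>\<^sup>+x. f (x + t) \<partial>lborel) = (\<integral>\<^sup>+x. f x \<partial>lborel)"
  using nn_integral_lborel_affine[OF assms, of 1 t] by (simp add: add.commute)

lemma nn_integral_lborel_pair:
  fixes f :: "'a::euclidean_space \<times> 'b::euclidean_space \<Rightarrow> ennreal"
  assumes "f \<in> borel_measurable borel"
  shows "(\<integral>\<^sup>+z. f z \<partial>lborel) = (\<integral>\<^sup>+x. \<integral>\<^sup>+v. f (x, v) \<partial>lborel \<partial>lborel)"
    and "(\<integral>\<^sup>+z. f z \<partial>lborel) = (\<integral>\<^sup>+v. \<integral>\<^sup>+x. f (x, v) \<partial>lborel \<partial>lborel)"
proof -
  have f: "f \<in> borel_measurable (lborel \<Otimes>\<^sub>M lborel)"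
    using assms by (simp add: lborel_prod)
  show "(\<integral>\<^sup>+z. f z \<partial>lborel) = (\<integral>\<^sup>+x. \<integral>\<^sup>+v. f (x, v) \<partial>lborel \<partial>lborel)"
    using lborel.nn_integral_fst[OF f] by (simp add: lborel_prod)
  show "(\<integral>\<^sup>+z. f z \<partial>lborel) = (\<integral>\<^sup>+v. \<integral>\<^sup>+x. f (x, v) \<partial>lborel \<partial>lborel)"
    using lborel_pair.nn_integral_snd[OF f] by (simp add: lborel_prod)
qed

context central_system
begin

text \<open>One step of a splitting scheme. Position and velocity are updated one after the other, so that
  each half step is a shear or a dilation of the fibres and its effect on Lebesgue measure is explicit
  even though \<open>p\<close> need not be differentiable.\<close>
definition step :: "('a \<Rightarrow> 'a) \<Rightarrow> real \<Rightarrow> 'a \<times> 'a \<Rightarrow> 'a \<times> 'a" where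
  "step p h z = (fst z + h *\<^sub>R snd z,
     (1 - h * \<phi> (fst z + h *\<^sub>R snd z)) *\<^sub>R snd z - h *\<^sub>R p (fst z + h *\<^sub>R snd z))"

text \<open>The identity is that of \<open>g_parallel\<close>. It is inherited by multiples of
  \<open>g\<close> with a scalar function, in particular by the truncation with which the scheme is
  run.\<close>

definition central_field :: "('a \<Rightarrow> 'a) \<Rightarrow> bool" where
  "central_field p \<longleftrightarrow> continuous_on UNIV p \<and> (\<forall>x w. (x \<bullet> x) * (p x \<bullet> w) = (x \<bullet> w) * (p x \<bullet> x))"

text \<open>The wedge of position and velocity is unchanged by the shear of the position and by a
  force parallel to the new position; only the damping factor scales it.\<close>

lemma am_step:
  assumes "central_field p"
  shows "am (step p h z) = (1 - h * \<phi> (fst (step p h z)))\<^sup>2 * am z"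
proof -
  define x v b where "x = fst z" and "v = snd z" and "b = fst z + h *\<^sub>R snd z"
  define a where "a = 1 - h * \<phi> b"
  have B: "(b \<bullet> b) * (p b \<bullet> w) = (b \<bullet> w) * (p b \<bullet> b)" for w
    using assms by (auto simp: central_field_def)
  have "am (step p h z) = (b \<bullet> b) * ((a *\<^sub>R v - h *\<^sub>R p b) \<bullet> (a *\<^sub>R v - h *\<^sub>R p b)) - (b \<bullet> (a *\<^sub>R v - h *\<^sub>R p b))\<^sup>2"
    by (simp add: am_def vr_def step_def a_def b_def v_def)
  also have "\<dots> = a\<^sup>2 * ((b \<bullet> b) * (v \<bullet> v) - (b \<bullet> v)\<^sup>2)
      - 2 * a * h * ((b \<bullet> b) * (p b \<bullet> v) - (b \<bullet> v) * (p b \<bullet> b))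
      + h\<^sup>2 * ((b \<bullet> b) * (p b \<bullet> p b) - (b \<bullet> p b) * (p b \<bullet> b))"
    by (simp add: inner_simps inner_commute power2_eq_square algebra_simps)
  also have "\<dots> = a\<^sup>2 * ((b \<bullet> b) * (v \<bullet> v) - (b \<bullet> v)\<^sup>2)" using B by simp
  also have "(b \<bullet> b) * (v \<bullet> v) - (b \<bullet> v)\<^sup>2 = am z"
    by (simp add: b_def am_def vr_def v_def inner_simps inner_commute power2_eq_square algebra_simps)
  finally show ?thesis by (simp add: a_def b_def step_def)
qed

lemma phi_measurable [measurable]: "\<phi> \<in> borel_measurable borel"
  by (rule borel_measurable_continuous_onI[OF continuous_on_phi])

lemma am_measurable [measurable]: "am \<in> borel_measurable borel"
  by (rule borel_measurable_continuous_onI[OF continuous_am])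

lemma step_measurable:
  assumes "continuous_on UNIV p"
  shows "step p h \<in> borel_measurable borel"
  unfolding step_def
  by (intro borel_measurable_continuous_onI continuous_intros
      continuous_on_compose2[OF assms] continuous_on_compose2[OF continuous_on_phi[of UNIV]]) auto

text \<open>At fixed velocity the first half step translates the position; at fixed position the
  second is an affine map of the velocity with factor \<open>1 - h * \<phi> x\<close>. Fubini is
  applied in the order that suits each half step.\<close>

lemma nn_integral_step:
  fixes f :: "'a \<times> 'a \<Rightarrow> ennreal"
  assumes [measurable]: "f \<in> borel_measurable borel" and p: "continuous_on UNIV p"
    and h: "\<And>x. h * \<phi> x < 1"
  shows "(\<integral>\<^sup>+z. f (step p h z) * ennreal ((1 - h * \<phi> (fst (step p h z))) ^ DIM('a)) \<partial>lborel) = (\<integral>\<^sup>+z. f z \<partial>lborel)"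
proof -
  have [measurable]: "p \<in> borel_measurable borel" by (rule borel_measurable_continuous_onI[OF p])
  have [measurable]: "step p h \<in> borel_measurable borel" by (rule step_measurable[OF p])
  define F where "F = (\<lambda>z :: 'a \<times> 'a. f (fst z, (1 - h * \<phi> (fst z)) *\<^sub>R snd z - h *\<^sub>R p (fst z))
      * ennreal ((1 - h * \<phi> (fst z)) ^ DIM('a)))"
  have [measurable]: "F \<in> borel_measurable borel"
  proof -
    have "(\<lambda>z :: 'a \<times> 'a. (fst z, (1 - h * \<phi> (fst z)) *\<^sub>R snd z - h *\<^sub>R p (fst z))) \<in> borel_measurable borel"
      by (intro borel_measurable_continuous_onI continuous_intros
          continuous_on_compose2[OF p] continuous_on_compose2[OF continuous_on_phi[of UNIV]]) auto
    note [measurable] = measurable_compose[OF this assms(1)]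
    have "(\<lambda>z :: 'a \<times> 'a. (1 - h * \<phi> (fst z)) ^ DIM('a)) \<in> borel_measurable borel"
      by (intro borel_measurable_continuous_onI continuous_intros continuous_on_compose2[OF continuous_on_phi[of UNIV]]) auto
    then show ?thesis unfolding F_def by measurable
  qed
  have "(\<integral>\<^sup>+z. f (step p h z) * ennreal ((1 - h * \<phi> (fst (step p h z))) ^ DIM('a)) \<partial>lborel)
      = (\<integral>\<^sup>+z. F (fst z + h *\<^sub>R snd z, snd z) \<partial>lborel)"
    by (simp add: F_def step_def)
  also have "\<dots> = (\<integral>\<^sup>+v. \<integral>\<^sup>+x. F (x + h *\<^sub>R v, v) \<partial>lborel \<partial>lborel)"
  proof (subst nn_integral_lborel_pair(2))
    have "(\<lambda>z :: 'a \<times> 'a. (fst z + h *\<^sub>R snd z, snd z)) \<in> borel_measurable borel"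
      by (intro borel_measurable_continuous_onI continuous_intros)
    then show "(\<lambda>z. F (fst z + h *\<^sub>R snd z, snd z)) \<in> borel_measurable borel"
      by (rule measurable_compose) measurable
  qed simp
  also have "\<dots> = (\<integral>\<^sup>+v. \<integral>\<^sup>+x. F (x, v) \<partial>lborel \<partial>lborel)"
  proof (rule nn_integral_cong)
    fix v :: 'a
    have "(\<lambda>x :: 'a. (x, v)) \<in> borel_measurable borel"
      by (intro borel_measurable_continuous_onI continuous_intros)
    then have "(\<lambda>x. F (x, v)) \<in> borel_measurable borel"
      by (rule measurable_compose) measurable
    then show "(\<integral>\<^sup>+x. F (x + h *\<^sub>R v, v) \<partial>lborel) = (\<integral>\<^sup>+x. F (x, v) \<partial>lborel)"
      by (rule nn_integral_lborel_translate)
  qed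
  also have "\<dots> = (\<integral>\<^sup>+x. \<integral>\<^sup>+v. F (x, v) \<partial>lborel \<partial>lborel)"
    using nn_integral_lborel_pair[of F] by simp
  also have "\<dots> = (\<integral>\<^sup>+x. \<integral>\<^sup>+v. f (x, v) \<partial>lborel \<partial>lborel)"
  proof (rule nn_integral_cong)
    fix x :: 'a
    have "(\<lambda>v :: 'a. (x, v)) \<in> borel_measurable borel"
      by (intro borel_measurable_continuous_onI continuous_intros)
    then have "(\<lambda>v. f (x, v)) \<in> borel_measurable borel"
      by (rule measurable_compose) measurable
    from nn_integral_lborel_affine[OF this, of "1 - h * \<phi> x" "- (h *\<^sub>R p x)"] h[of x]
    show "(\<integral>\<^sup>+v. F (x, v) \<partial>lborel) = (\<integral>\<^sup>+v. f (x, v) \<partial>lborel)"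
      by (simp add: F_def)
  qed
  also have "\<dots> = (\<integral>\<^sup>+z. f z \<partial>lborel)"
    by (rule nn_integral_lborel_pair(1)[symmetric]) measurable
  finally show ?thesis .
qed

text \<open>The density \<open>|x \<and> v|\<^sup>-\<^sup>n\<close>, set to \<open>0\<close> where the angular momentum vanishes. Both phase space
  volume and \<open>|x \<and> v|\<^sup>n\<close> shrink by the factor \<open>(1 - h \<phi>)\<^sup>n\<close> in a step, so this density is invariant.\<close>
definition wt :: "'a \<times> 'a \<Rightarrow> ennreal" where
  "wt z = ennreal (1 / sqrt (am z) ^ DIM('a))"

lemma wt_measurable [measurable]: "wt \<in> borel_measurable borel"
  unfolding wt_def by measurable

lemma wt_step:
  assumes "central_field p" and h: "\<And>x. h * \<phi> x < 1"
  shows "ennreal ((1 - h * \<phi> (fst (step p h z))) ^ DIM('a)) * wt (step p h z) = wt z"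
proof -
  let ?c = "1 - h * \<phi> (fst (step p h z))"
  have c: "?c > 0" using h by simp
  have "sqrt (am (step p h z)) = ?c * sqrt (am z)"
    using c unfolding am_step[OF assms(1)] real_sqrt_mult by simp
  then have "?c ^ DIM('a) * (1 / sqrt (am (step p h z)) ^ DIM('a)) = 1 / sqrt (am z) ^ DIM('a)"
    using c by (simp add: power_mult_distrib)
  then show ?thesis unfolding wt_def using c by (subst ennreal_mult[symmetric]) (auto simp: am_nonneg)
qed

lemma nn_integral_step_iterate:
  assumes p: "central_field p" and h: "\<And>x. h * \<phi> x < 1" and f: "f \<in> borel_measurable borel"
  shows "(\<integral>\<^sup>+z. f ((step p h ^^ k) z) * wt z \<partial>lborel) = (\<integral>\<^sup>+z. f z * wt z \<partial>lborel)"
  using f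
proof (induction k arbitrary: f)
  case (Suc k)
  note [measurable] = Suc.prems
  have pc: "continuous_on UNIV p" using p by (simp add: central_field_def)
  have [measurable]: "step p h \<in> borel_measurable borel" by (rule step_measurable[OF pc])
  have "(\<integral>\<^sup>+z. f ((step p h ^^ Suc k) z) * wt z \<partial>lborel) = (\<integral>\<^sup>+z. f (step p h ((step p h ^^ k) z)) * wt z \<partial>lborel)"
    by simp
  also have "\<dots> = (\<integral>\<^sup>+z. f (step p h z) * wt z \<partial>lborel)" by (rule Suc.IH) measurable
  also have "\<dots> = (\<integral>\<^sup>+z. (f (step p h z) * wt (step p h z)) * ennreal ((1 - h * \<phi> (fst (step p h z))) ^ DIM('a)) \<partial>lborel)"
    using wt_step[OF p h] by (simp add: mult.assoc mult.commute[of "wt _"])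
  also have "\<dots> = (\<integral>\<^sup>+z. f z * wt z \<partial>lborel)"
    by (rule nn_integral_step[OF _ pc h, of "\<lambda>z. f z * wt z"]) measurable
  finally show ?case .
qed simp

text \<open>\<open>A\<close> lies in the preimage of \<open>N\<close> under a map that preserves the
  measure with density \<open>wt\<close>. This density is bounded below on \<open>A\<close> in terms
  of \<open>m1\<close> and above on \<open>N\<close> in terms of \<open>m0\<close>, so the factor is
  independent of the number \<open>k\<close> of steps.\<close>

lemma emeasure_step_le:
  assumes p: "central_field p" and h: "\<And>x. h * \<phi> x < 1"
    and [measurable]: "A \<in> sets borel" "N \<in> sets borel"
    and AN: "\<And>z. z \<in> A \<Longrightarrow> (step p h ^^ k) z \<in> N"
    and mA: "\<And>z. z \<in> A \<Longrightarrow> 0 < am z \<and> am z \<le> m1" and mN: "\<And>z. z \<in> N \<Longrightarrow> m0 \<le> am z"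
    and m: "0 < m0" "0 < m1"
  shows "emeasure lborel A \<le> ennreal (sqrt m1 ^ DIM('a) / sqrt m0 ^ DIM('a)) * emeasure lborel N"
proof -
  let ?n = "DIM('a)"
  have "emeasure lborel A * ennreal (1 / sqrt m1 ^ ?n) = (\<integral>\<^sup>+z. indicator A z * ennreal (1 / sqrt m1 ^ ?n) \<partial>lborel)"
    by (simp add: nn_integral_multc)
  also have "\<dots> \<le> (\<integral>\<^sup>+z. indicator N ((step p h ^^ k) z) * wt z \<partial>lborel)"
  proof (rule nn_integral_mono)
    fix z
    show "indicator A z * ennreal (1 / sqrt m1 ^ ?n) \<le> indicator N ((step p h ^^ k) z) * wt z"
    proof (cases "z \<in> A")
      case True
      have "1 / sqrt m1 ^ ?n \<le> 1 / sqrt (am z) ^ ?n"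
        using mA[OF True] by (intro divide_left_mono power_mono mult_pos_pos) auto
      then show ?thesis using AN[OF True] True by (simp add: wt_def ennreal_leI)
    qed simp
  qed
  also have "\<dots> = (\<integral>\<^sup>+z. indicator N z * wt z \<partial>lborel)"
    by (rule nn_integral_step_iterate[OF p h]) measurable
  also have "\<dots> \<le> (\<integral>\<^sup>+z. indicator N z * ennreal (1 / sqrt m0 ^ ?n) \<partial>lborel)"
  proof (rule nn_integral_mono)
    fix z
    show "indicator N z * wt z \<le> indicator N z * ennreal (1 / sqrt m0 ^ ?n)"
    proof (cases "z \<in> N")
      case True
      have "1 / sqrt (am z) ^ ?n \<le> 1 / sqrt m0 ^ ?n"
        using mN[OF True] m by (intro divide_left_mono power_mono mult_pos_pos) auto
      then show ?thesis using True by (simp add: wt_def ennreal_leI)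
    qed simp
  qed
  also have "\<dots> = emeasure lborel N * ennreal (1 / sqrt m0 ^ ?n)"
    by (simp add: nn_integral_multc)
  finally have "ennreal (sqrt m1 ^ ?n) * (emeasure lborel A * ennreal (1 / sqrt m1 ^ ?n))
      \<le> ennreal (sqrt m1 ^ ?n) * (emeasure lborel N * ennreal (1 / sqrt m0 ^ ?n))"
    by (rule mult_left_mono) simp
  moreover have "ennreal (sqrt m1 ^ ?n) * ennreal (1 / sqrt m1 ^ ?n) = 1"
    using m by (subst ennreal_mult[symmetric]) auto
  moreover have "ennreal (sqrt m1 ^ ?n) * ennreal (1 / sqrt m0 ^ ?n) = ennreal (sqrt m1 ^ ?n / sqrt m0 ^ ?n)"
    using m by (subst ennreal_mult[symmetric]) auto
  ultimately show ?thesis by (simp add: mult_ac flip: mult.assoc)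
qed

end

section \<open>Convergence of the scheme\<close>

lemma vector_mean_value_bound:
  fixes f :: "real \<Rightarrow> 'a::real_normed_vector"
  assumes "a \<le> b" and f: "\<And>t. t \<in> {a..b} \<Longrightarrow> (f has_vector_derivative f' t) (at t within {a..b})"
    and B: "\<And>t. t \<in> {a..b} \<Longrightarrow> norm (f' t - c) \<le> B"
  shows "norm (f b - f a - (b - a) *\<^sub>R c) \<le> B * (b - a)"
proof -
  let ?g = "\<lambda>t. f t - t *\<^sub>R c"
  have "(?g has_derivative (\<lambda>h. h *\<^sub>R (f' t - c))) (at t within {a..b})" if "t \<in> {a..b}" for t
    using f[OF that] unfolding has_vector_derivative_def
    by (auto intro!: derivative_eq_intros simp: scaleR_diff_right)
  moreover have "onorm (\<lambda>h. h *\<^sub>R (f' t - c)) \<le> B" if "t \<in> {a..b}" for t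
    by (rule onorm_le) (use B[OF that] in \<open>auto intro: mult_left_mono simp: mult.commute[of B]\<close>)
  ultimately have "norm (?g b - ?g a) \<le> B * norm (b - a)"
    using assms(1) by (intro differentiable_bound[of "{a..b}"]) auto
  then show ?thesis using assms(1) by (simp add: algebra_simps)
qed

lemma discrete_gronwall:
  fixes e :: "nat \<Rightarrow> real"
  assumes "e 0 = 0" "\<And>j. e (Suc j) \<le> (1 + a) * e j + b" "0 \<le> a" "0 \<le> b"
  shows "e k \<le> real k * b * exp (a * real k)"
proof -
  have "e k \<le> real k * b * (1 + a) ^ k"
  proof (induction k)
    case (Suc k)
    have "e (Suc k) \<le> (1 + a) * (real k * b * (1 + a) ^ k) + b * (1 + a) ^ Suc k"
    proof (rule order_trans[OF assms(2)], intro add_mono mult_left_mono)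
      have "1 \<le> (1 + a) ^ Suc k" using assms(3) by (intro one_le_power) auto
      then show "b \<le> b * (1 + a) ^ Suc k" using assms(4) by (simp add: mult_le_cancel_left1)
    qed (use Suc assms in auto)
    also have "\<dots> = real (Suc k) * b * (1 + a) ^ Suc k" by (simp add: algebra_simps)
    finally show ?case .
  qed (simp add: assms)
  also have "(1 + a) ^ k \<le> exp (a * real k)"
    using power_mono[OF exp_ge_add_one_self[of a], of k] assms(3)
    by (simp add: exp_of_nat_mult mult.commute[of a])
  then have "real k * b * (1 + a) ^ k \<le> real k * b * exp (a * real k)"
    using assms(4) by (intro mult_left_mono) auto
  finally show ?thesis .
qed

context central_system
begin

lemma drag_lipschitz:
  assumes Lp: "Lp-lipschitz_on UNIV \<phi>" and Lq: "Lq-lipschitz_on UNIV p" and B: "\<And>x. \<phi> x \<le> B"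
    and v: "norm v \<le> R"
  shows "norm ((\<phi> x *\<^sub>R v + p x) - (\<phi> x' *\<^sub>R v' + p x')) \<le> (Lp * R + Lq) * norm (x - x') + B * norm (v - v')"
proof -
  have "(\<phi> x *\<^sub>R v + p x) - (\<phi> x' *\<^sub>R v' + p x') = (\<phi> x - \<phi> x') *\<^sub>R v + \<phi> x' *\<^sub>R (v - v') + (p x - p x')"
    by (simp add: algebra_simps)
  also have "norm \<dots> \<le> norm ((\<phi> x - \<phi> x') *\<^sub>R v) + norm (\<phi> x' *\<^sub>R (v - v')) + norm (p x - p x')"
    by (intro norm_triangle_mono order_refl)
  also have "\<dots> \<le> (Lp * norm (x - x')) * R + B * norm (v - v') + Lq * norm (x - x')"
    using lipschitz_onD[OF Lp, of x x'] lipschitz_onD[OF Lq, of x x'] v B[of x'] phi_nonneg[of x']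
      lipschitz_on_nonneg[OF Lp]
    by (intro add_mono) (auto simp: dist_norm intro!: mult_mono mult_right_mono)
  finally show ?thesis by (simp add: algebra_simps)
qed

text \<open>\<open>D\<close> bounds the derivatives of position and velocity along the trajectory,
  so neither moves by more than \<open>D * h\<close>; freezing the right-hand side over a step of
  length \<open>h\<close> therefore costs order h^2. The trajectory stays where \<open>p\<close> and
  \<open>g\<close> agree.\<close>

lemma step_local_error:
  assumes Lp: "Lp-lipschitz_on UNIV \<phi>" and Lq: "Lq-lipschitz_on UNIV p" and B: "\<And>x. \<phi> x \<le> B"
    and R: "\<And>t. 0 \<le> t \<Longrightarrow> norm (flow z t) \<le> R" and p: "\<And>x. norm x \<le> R \<Longrightarrow> p x = g x"
    and Q: "\<And>x. norm (p x) \<le> Q" and t: "0 \<le> t" and h: "0 \<le> h"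
  defines "D \<equiv> R + (B * R + Q)"
  shows "norm (fst (flow z (t + h)) - fst (step p h (flow z t))) \<le> D * h\<^sup>2"
    and "norm (snd (flow z (t + h)) - snd (step p h (flow z t))) \<le> (2 * (Lp * R + Lq) + B) * D * h\<^sup>2"
proof -
  define x v where "x = (\<lambda>t. fst (flow z t))" and "v = (\<lambda>t. snd (flow z t))"
  have nR: "norm (x s) \<le> R" "norm (v s) \<le> R" if "0 \<le> s" for s
    using R[OF that] norm_fst_le[of "x s" "v s"] norm_snd_le[of "v s" "x s"] by (auto simp: x_def v_def)
  have R0: "R \<ge> 0" using R[OF t] norm_ge_zero order_trans by blast
  have B0: "B \<ge> 0" using B[of 0] phi_nonneg[of 0] by linarith
  have Q0: "Q \<ge> 0" using Q[of 0] norm_ge_zero order_trans by blast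
  have L0: "Lp \<ge> 0" "Lq \<ge> 0" using Lp Lq lipschitz_on_nonneg by auto
  have D: "R \<le> D" "B * R + Q \<le> D" "D \<ge> 0" using R0 B0 Q0 by (auto simp: D_def)
  define f where "f = (\<lambda>x v. \<phi> x *\<^sub>R v + p x)"
  have fD: "norm (f (x s) (v s)) \<le> D" if "0 \<le> s" for s
  proof -
    have "norm (f (x s) (v s)) \<le> \<phi> (x s) * norm (v s) + norm (p (x s))"
      unfolding f_def using norm_triangle_ineq[of "\<phi> (x s) *\<^sub>R v s" "p (x s)"] phi_nonneg by simp
    also have "\<dots> \<le> B * R + Q"
      using B Q nR[OF that] B0 phi_nonneg by (intro add_mono mult_mono) auto
    finally show ?thesis using D by simp
  qed
  have x': "(x has_vector_derivative v s) (at s within {a..b})"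
    and v': "(v has_vector_derivative - f (x s) (v s)) (at s within {a..b})" if "0 \<le> a" "s \<in> {a..b}" for s a b
    using fst_deriv[OF flow_deriv_Icc[OF that], of z] snd_deriv[OF flow_deriv_Icc[OF that], of z] nR(1)[of s] that p[of "x s"]
    by (simp_all add: x_def v_def f_def)
  have xD: "norm (x s - x t) \<le> D * h" if "s \<in> {t..t+h}" for s
  proof -
    have "norm (x s - x t - (s - t) *\<^sub>R 0) \<le> D * (s - t)"
      by (rule vector_mean_value_bound[where f' = v]) (use that x' t order_trans[OF nR(2) D(1)] in auto)
    also have "\<dots> \<le> D * h" using that D by (intro mult_left_mono) auto
    finally show ?thesis by simp
  qed
  have vD: "norm (v s - v t) \<le> D * h" if "s \<in> {t..t+h}" for s
  proof -
    have "norm (v s - v t - (s - t) *\<^sub>R 0) \<le> D * (s - t)"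
      by (rule vector_mean_value_bound[where f' = "\<lambda>s. - f (x s) (v s)"]) (use that v' t fD in auto)
    also have "\<dots> \<le> D * h" using that D by (intro mult_left_mono) auto
    finally show ?thesis by simp
  qed
  have "norm (x (t + h) - x t - (t + h - t) *\<^sub>R v t) \<le> D * h * (t + h - t)"
    by (rule vector_mean_value_bound[where f' = v]) (use x' t vD h in auto)
  then show "norm (fst (flow z (t + h)) - fst (step p h (flow z t))) \<le> D * h\<^sup>2"
    by (simp add: x_def v_def step_def power2_eq_square algebra_simps)
  \<comment> \<open>The step evaluates the force at the new position \<open>b\<close>, which is
    within \<open>2 * (D * h)\<close> of every \<open>x s\<close>; this is the factor 2 in the
    constant.\<close>
  define b where "b = x t + h *\<^sub>R v t"
  have "norm (v (t + h) - v t - (t + h - t) *\<^sub>R (- f b (v t))) \<le> ((2 * (Lp * R + Lq) + B) * D * h) * (t + h - t)"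
  proof (rule vector_mean_value_bound[where f' = "\<lambda>s. - f (x s) (v s)"])
    fix s assume s: "s \<in> {t..t+h}"
    then show "(v has_vector_derivative - f (x s) (v s)) (at s within {t..t+h})" using v' t by auto
    have "norm (x s - b) \<le> norm (x s - x t) + norm (h *\<^sub>R v t)"
      using norm_triangle_ineq4[of "x s - x t" "h *\<^sub>R v t"] by (simp add: b_def algebra_simps)
    also have "\<dots> \<le> D * h + h * D"
      using xD[OF s] nR(2)[OF t] D h by (intro add_mono) (auto intro!: mult_left_mono)
    finally have xb: "norm (x s - b) \<le> 2 * (D * h)" by simp
    have s0: "0 \<le> s" using s t by simp
    have "norm (- f (x s) (v s) - - f b (v t)) = norm (f (x s) (v s) - f b (v t))"
      by (simp add: norm_minus_commute)
    also have "\<dots> \<le> (Lp * R + Lq) * norm (x s - b) + B * norm (v s - v t)"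
      unfolding f_def by (rule drag_lipschitz[OF Lp Lq B nR(2)[OF s0]])
    also have "\<dots> \<le> (Lp * R + Lq) * (2 * (D * h)) + B * (D * h)"
      using xb vD[OF s] L0 R0 B0 by (intro add_mono mult_left_mono) auto
    finally show "norm (- f (x s) (v s) - - f b (v t)) \<le> (2 * (Lp * R + Lq) + B) * D * h"
      by (simp add: algebra_simps)
  qed (use h in simp)
  then show "norm (snd (flow z (t + h)) - snd (step p h (flow z t))) \<le> (2 * (Lp * R + Lq) + B) * D * h\<^sup>2"
    by (simp add: x_def v_def b_def f_def step_def power2_eq_square algebra_simps)
qed

text \<open>The difference is split so that differences of drag coefficients multiply the velocity
  of \<open>z\<close>, which will lie on the exact trajectory and is bounded. The iterates of the
  scheme enter as \<open>z'\<close>.\<close>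

lemma step_stable:
  assumes Lp: "Lp-lipschitz_on UNIV \<phi>" and Lq: "Lq-lipschitz_on UNIV p"
    and v: "norm (snd z) \<le> R" and h: "0 \<le> h" "h \<le> 1" "\<And>x. h * \<phi> x < 1"
  defines "K \<equiv> Lp * R + Lq"
  shows "norm (fst (step p h z) - fst (step p h z')) + norm (snd (step p h z) - snd (step p h z'))
     \<le> (1 + h * (1 + K)) * (norm (fst z - fst z') + norm (snd z - snd z'))"
proof -
  define x v x' v' where "x = fst z" and "v = snd z" and "x' = fst z'" and "v' = snd z'"
  define b b' where "b = x + h *\<^sub>R v" and "b' = x' + h *\<^sub>R v'"
  have L0: "Lp \<ge> 0" "Lq \<ge> 0" using Lp Lq lipschitz_on_nonneg by auto
  have R0: "R \<ge> 0" using assms(3) norm_ge_zero order_trans by blast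
  have K0: "K \<ge> 0" using L0 R0 by (simp add: K_def)
  have "norm (b - b') = norm ((x - x') + h *\<^sub>R (v - v'))" by (simp add: b_def b'_def algebra_simps)
  also have "\<dots> \<le> norm (x - x') + h * norm (v - v')"
    using norm_triangle_ineq[of "x - x'" "h *\<^sub>R (v - v')"] h by simp
  finally have bb: "norm (b - b') \<le> norm (x - x') + h * norm (v - v')" .
  have "h * norm (v - v') \<le> 1 * norm (v - v')" using h by (intro mult_right_mono) auto
  then have bb1: "norm (b - b') \<le> norm (x - x') + norm (v - v')" using bb by simp
  have "((1 - h * \<phi> b) *\<^sub>R v - h *\<^sub>R p b) - ((1 - h * \<phi> b') *\<^sub>R v' - h *\<^sub>R p b')
      = (1 - h * \<phi> b') *\<^sub>R (v - v') - h *\<^sub>R ((\<phi> b - \<phi> b') *\<^sub>R v + (p b - p b'))"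
    by (simp add: algebra_simps)
  also have "norm \<dots> \<le> \<bar>1 - h * \<phi> b'\<bar> * norm (v - v') + h * norm ((\<phi> b - \<phi> b') *\<^sub>R v + (p b - p b'))"
    using norm_triangle_ineq4[of "(1 - h * \<phi> b') *\<^sub>R (v - v')" "h *\<^sub>R ((\<phi> b - \<phi> b') *\<^sub>R v + (p b - p b'))"] h by simp
  also have "\<dots> \<le> 1 * norm (v - v') + h * (K * norm (b - b'))"
  proof (intro add_mono mult_right_mono mult_left_mono)
    show "\<bar>1 - h * \<phi> b'\<bar> \<le> 1" using h(1) h(3)[of b'] phi_nonneg[of b'] by (simp add: abs_le_iff)
    have "norm ((\<phi> b - \<phi> b') *\<^sub>R v + (p b - p b')) \<le> \<bar>\<phi> b - \<phi> b'\<bar> * norm v + norm (p b - p b')"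
      using norm_triangle_ineq[of "(\<phi> b - \<phi> b') *\<^sub>R v" "p b - p b'"] by simp
    also have "\<dots> \<le> (Lp * norm (b - b')) * R + Lq * norm (b - b')"
      using lipschitz_onD[OF Lp, of b b'] lipschitz_onD[OF Lq, of b b'] assms(3) L0
      by (intro add_mono mult_mono) (auto simp: dist_norm v_def)
    finally show "norm ((\<phi> b - \<phi> b') *\<^sub>R v + (p b - p b')) \<le> K * norm (b - b')"
      by (simp add: K_def algebra_simps)
  qed (use h in auto)
  also have "\<dots> \<le> norm (v - v') + h * (K * (norm (x - x') + norm (v - v')))"
    using bb1 h K0 by (intro add_mono mult_left_mono) auto
  finally have vv: "norm (snd (step p h z) - snd (step p h z')) \<le> norm (v - v') + h * (K * (norm (x - x') + norm (v - v')))"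
    by (simp add: step_def b_def b'_def x_def x'_def v_def v'_def)
  have xx: "norm (fst (step p h z) - fst (step p h z')) \<le> norm (x - x') + h * norm (v - v')"
    using bb by (simp add: step_def b_def b'_def x_def x'_def v_def v'_def)
  have "0 \<le> h * norm (x - x')" using h by simp
  then have "norm (fst (step p h z) - fst (step p h z')) + norm (snd (step p h z) - snd (step p h z'))
      \<le> (1 + h * (1 + K)) * (norm (x - x') + norm (v - v'))"
    using xx vv by (simp add: algebra_simps)
  then show ?thesis by (simp add: x_def x'_def v_def v'_def)
qed

text \<open>Consistency and stability, with the error uniform over a ball of initial data, because a
  whole set of data is to be transported.\<close>

lemma scheme_converges:
  assumes T: "T > 0" and \<epsilon>: "\<epsilon> > 0"
  shows "\<exists>p h N. central_field p \<and> (\<forall>x. h * \<phi> x < 1) \<and>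
    (\<forall>z. norm z \<le> k \<longrightarrow> dist ((step p h ^^ N) z) (flow z T) < \<epsilon>)"
proof -
  obtain R where R0: "R > 0" and R: "\<forall>z t. norm z \<le> k \<longrightarrow> t \<ge> 0 \<longrightarrow> norm (flow z t) < R"
    using flow_bounded by blast
  obtain Lg where Lg: "Lg-lipschitz_on (cball 0 (R + 1)) g" using g_lip by blast
  obtain Lp where Lp: "Lp-lipschitz_on UNIV \<phi>" using phi_lip by blast
  obtain B where B: "B > 0" "\<And>x. \<phi> x \<le> B" using phi_bounded by blast
  obtain c Lq Q where c: "Lq-lipschitz_on UNIV (\<lambda>x. c x *\<^sub>R g x)" "\<And>x. norm (c x *\<^sub>R g x) \<le> Q"
    "\<And>x. norm x \<le> R \<Longrightarrow> c x = 1"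
    by (rule lipschitz_cutoff[OF R0 Lg]) (rule that)
  define p where "p = (\<lambda>x. c x *\<^sub>R g x)"
  have Lq: "Lq-lipschitz_on UNIV p" and Q: "\<And>x. norm (p x) \<le> Q" and pg: "\<And>x. norm x \<le> R \<Longrightarrow> p x = g x"
    using c by (auto simp: p_def)
  have cf: "central_field p"
    unfolding central_field_def
  proof (intro conjI allI)
    show "continuous_on UNIV p" by (rule lipschitz_on_continuous_on[OF Lq])
    fix x w
    have "c x * ((x \<bullet> x) * (g x \<bullet> w)) = c x * ((x \<bullet> w) * (g x \<bullet> x))" by (simp only: g_parallel)
    then show "(x \<bullet> x) * (p x \<bullet> w) = (x \<bullet> w) * (p x \<bullet> x)" by (simp add: p_def mult_ac)
  qed
  have L0: "Lp \<ge> 0" "Lq \<ge> 0" using Lp Lq lipschitz_on_nonneg by auto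
  have Q0: "Q \<ge> 0" using Q[of 0] norm_ge_zero order_trans by blast
  define K where "K = Lp * R + Lq"
  define D where "D = R + (B * R + Q)"
  define C where "C = D + (2 * K + B) * D"
  have K0: "K \<ge> 0" using L0 R0 by (simp add: K_def)
  have D0: "D \<ge> 0" using R0 B Q0 by (simp add: D_def)
  have C0: "C \<ge> 0" using D0 K0 B by (simp add: C_def)
  define W where "W = C * T\<^sup>2 * exp ((1 + K) * T)"
  \<comment> \<open>The first bound gives \<open>h \<le> 1\<close> and \<open>h * B < 1\<close>; the
    second makes the global error \<open>W / N\<close> smaller than \<epsilon>.\<close>
  obtain N :: nat where N: "max (T + T * B) (W / \<epsilon>) < real N" using reals_Archimedean2 by blast
  have "T > 0" "T * B > 0" using T B by auto
  then have N0: "real N > 0" "T < real N" "T * B < real N" using N by auto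
  define h where "h = T / real N"
  have h: "0 < h" "h \<le> 1" "h * B < 1" using N0 T by (auto simp: h_def)
  have hphi: "h * \<phi> x < 1" for x
    using mult_left_mono[OF B(2)[of x], of h] h by linarith
  have "dist ((step p h ^^ N) z) (flow z T) < \<epsilon>" if z: "norm z \<le> k" for z
  proof -
    have Rz: "norm (flow z t) \<le> R" if "0 \<le> t" for t using R[rule_format, OF z that] by simp
    define er where "er = (\<lambda>j. norm (fst (flow z (real j * h)) - fst ((step p h ^^ j) z))
        + norm (snd (flow z (real j * h)) - snd ((step p h ^^ j) z)))"
    have "er (Suc j) \<le> (1 + h * (1 + K)) * er j + C * h\<^sup>2" for j
    proof -
      let ?t = "real j * h" and ?s = "(step p h ^^ j) z"
      have t: "0 \<le> ?t" using h by simp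
      have tS: "real (Suc j) * h = ?t + h" by (simp add: algebra_simps)
      have l1: "norm (fst (flow z (?t + h)) - fst (step p h (flow z ?t))) \<le> D * h\<^sup>2"
        unfolding D_def by (rule step_local_error(1)[OF Lp Lq B(2) Rz pg Q t]) (use h in simp_all)
      have l2: "norm (snd (flow z (?t + h)) - snd (step p h (flow z ?t))) \<le> (2 * K + B) * D * h\<^sup>2"
        unfolding D_def K_def by (rule step_local_error(2)[OF Lp Lq B(2) Rz pg Q t]) (use h in simp_all)
      have "norm (snd (flow z ?t)) \<le> R"
        using Rz[OF t] norm_snd_le[of "snd (flow z ?t)" "fst (flow z ?t)"] by simp
      from step_stable[OF Lp Lq this _ h(2) hphi, of ?s] h
      have st: "norm (fst (step p h (flow z ?t)) - fst (step p h ?s)) + norm (snd (step p h (flow z ?t)) - snd (step p h ?s))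
          \<le> (1 + h * (1 + K)) * er j"
        by (simp add: er_def K_def)
      have tri: "norm (a - c) \<le> norm (a - b) + norm (b - c)" for a b c :: 'a
        using norm_triangle_ineq[of "a - b" "b - c"] by simp
      have "er (Suc j) \<le> (norm (fst (flow z (?t + h)) - fst (step p h (flow z ?t))) + norm (fst (step p h (flow z ?t)) - fst (step p h ?s)))
          + (norm (snd (flow z (?t + h)) - snd (step p h (flow z ?t))) + norm (snd (step p h (flow z ?t)) - snd (step p h ?s)))"
        unfolding er_def tS funpow.simps o_def by (intro add_mono tri)
      also have "\<dots> \<le> (1 + h * (1 + K)) * er j + (D * h\<^sup>2 + (2 * K + B) * D * h\<^sup>2)"
        using l1 l2 st by linarith
      finally show ?thesis by (simp add: C_def algebra_simps)
    qed
    then have "er N \<le> real N * (C * h\<^sup>2) * exp (h * (1 + K) * real N)"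
      by (intro discrete_gronwall) (use h K0 C0 in \<open>auto simp: er_def\<close>)
    also have "\<dots> = W / real N"
      using N0 by (simp add: h_def W_def power2_eq_square field_simps)
    also have "\<dots> < \<epsilon>"
      using N N0 \<epsilon> by (simp add: field_simps)
    finally have "er N < \<epsilon>" .
    moreover have "real N * h = T" using N0 by (simp add: h_def)
    moreover have "dist ((step p h ^^ N) z) (flow z (real N * h)) \<le> er N"
      using dist_Pair_le[of "flow z (real N * h)" "(step p h ^^ N) z"] by (simp add: er_def dist_norm norm_minus_commute)
    ultimately show ?thesis by simp
  qed
  then show ?thesis using cf hphi by blast
qed

end

section \<open>Data with positive limit energy form a null set\<close>

lemma lebesgue_null_imp_borel_null:
  "S \<in> sets borel \<Longrightarrow> negligible S \<Longrightarrow> S \<in> null_sets (lborel :: 'a::euclidean_space measure)"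
  using null_sets_completion_iff[of S lborel] by (simp add: negligible_iff_null_sets)

context central_system
begin

text \<open>For \<open>x \<noteq> 0\<close> the velocities orthogonal to \<open>x\<close> form a
  hyperplane, and Fubini applies.\<close>

lemma vr_zero_null: "{z. vr z = 0} \<in> null_sets lborel"
proof
  have b: "{z. vr z = 0} \<in> sets borel"
    using continuous_vr[of UNIV] by (intro borel_closed closed_Collect_eq) auto
  then show "{z. vr z = 0} \<in> sets lborel" by simp
  have "emeasure lborel {z. vr z = 0} = (\<integral>\<^sup>+z. indicator {z. vr z = 0} z \<partial>lborel)"
    using b by simp
  also have "\<dots> = (\<integral>\<^sup>+x. \<integral>\<^sup>+v. indicator {z. vr z = 0} (x, v) \<partial>lborel \<partial>lborel)"
    using b by (intro nn_integral_lborel_pair) auto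
  also have "\<dots> = (\<integral>\<^sup>+x. 0 \<partial>(lborel :: 'a measure))"
  proof (rule nn_integral_cong_AE)
    show "AE x in lborel. (\<integral>\<^sup>+v. indicator {z. vr z = 0} (x, v) \<partial>lborel) = (0 :: ennreal)"
      using AE_lborel_singleton[of "0 :: 'a"]
    proof eventually_elim
      case (elim x)
      have "{v. x \<bullet> v = 0} \<in> null_sets lborel"
        using elim by (intro lebesgue_null_imp_borel_null negligible_hyperplane borel_closed closed_hyperplane) auto
      then have "(\<integral>\<^sup>+v. indicator {v. x \<bullet> v = 0} v \<partial>lborel) = (0 :: ennreal)" by auto
      then show ?case by (simp add: vr_def indicator_def)
    qed
  qed
  also have "\<dots> = 0" by simp
  finally show "emeasure lborel {z. vr z = 0} = 0" .
qed

text \<open>Non-strict inequalities make this an intersection of closed sets. One index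
  \<open>k\<close> bounds both the size of the datum and, through its reciprocal, the angular
  momentum, so that countably many sets exhaust all data.\<close>

definition trapped :: "nat \<Rightarrow> real \<Rightarrow> nat \<Rightarrow> ('a \<times> 'a) set" where
  "trapped k \<epsilon> j = {z. norm z \<le> real k \<and> (\<forall>t\<ge>0. 1 / (real k + 1) \<le> am (flow z t)) \<and>
     (\<forall>t\<ge>real j. \<bar>vr (flow z t)\<bar> \<le> \<epsilon>)}"

lemma closed_trapped: "closed (trapped k \<epsilon> j)"
proof -
  have "trapped k \<epsilon> j = {z. norm z \<le> real k} \<inter> (\<Inter>t\<in>{0..}. {z. 1 / (real k + 1) \<le> am (flow z t)})
      \<inter> (\<Inter>t\<in>{real j..}. {z. \<bar>vr (flow z t)\<bar> \<le> \<epsilon>})"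
    by (auto simp: trapped_def)
  also have "closed \<dots>"
  proof (intro closed_Int closed_INT ballI closed_Collect_le)
    fix t :: real
    show "continuous_on UNIV (\<lambda>z. am (flow z t))" if "t \<in> {0..}"
      using that by (intro continuous_on_compose2[OF continuous_am[of UNIV] continuous_flow_data]) auto
    show "continuous_on UNIV (\<lambda>z. \<bar>vr (flow z t)\<bar>)" if "t \<in> {real j..}"
      using that by (intro continuous_on_rabs continuous_on_compose2[OF continuous_vr[of UNIV] continuous_flow_data]) auto
  qed (auto intro!: continuous_intros)
  finally show ?thesis .
qed

text \<open>At time \<open>j + 1\<close> the flow has brought these data to |vr| \<le> \<epsilon>,
  and a sufficiently accurate scheme brings them into the strip of twice that width.
  \<open>R\<close> and \<open>C\<close> are chosen before \<epsilon> and \<open>j\<close>: however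
  late the time, the loss of volume is limited by the ratio of angular momenta.\<close>

lemma trapped_measure:
  "\<exists>R C. \<forall>\<epsilon>>0. \<forall>j. emeasure lborel (trapped k \<epsilon> j)
     \<le> ennreal C * emeasure lborel {z. norm z \<le> R \<and> \<bar>vr z\<bar> \<le> 2 * \<epsilon>}"
proof -
  obtain R where R0: "R > 0" and R: "\<forall>z t. norm z \<le> real k \<longrightarrow> t \<ge> 0 \<longrightarrow> norm (flow z t) < R"
    using flow_bounded by blast
  have "compact (am ` cball 0 (real k))" by (intro compact_continuous_image continuous_am compact_cball)
  then obtain m1 where m1: "m1 > 0" "\<forall>a\<in>am ` cball 0 (real k). norm a \<le> m1"
    using compact_imp_bounded bounded_pos by metis
  \<comment> \<open>Half the lower bound for \<open>am\<close> along the flow leaves room for the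
    error of the scheme.\<close>
  define m0 where "m0 = 1 / (real k + 1) / 2"
  have m0: "m0 > 0" "2 * m0 = 1 / (real k + 1)" by (auto simp: m0_def field_simps)
  define C where "C = sqrt m1 ^ DIM('a) / sqrt m0 ^ DIM('a)"
  have "emeasure lborel (trapped k \<epsilon> j) \<le> ennreal C * emeasure lborel {z. norm z \<le> R + 1 \<and> \<bar>vr z\<bar> \<le> 2 * \<epsilon>}"
    if \<epsilon>: "\<epsilon> > 0" for \<epsilon> j
  proof -
    let ?Q = "cball 0 (R + 1) :: ('a \<times> 'a) set"
    obtain d1 where d1: "d1 > 0" "\<And>z w. z \<in> ?Q \<Longrightarrow> w \<in> ?Q \<Longrightarrow> dist z w < d1 \<Longrightarrow> dist (vr z) (vr w) < \<epsilon>"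
      using compact_uniformly_continuous[OF continuous_vr compact_cball, of 0 "R + 1"] \<epsilon>
      unfolding uniformly_continuous_on_def by metis
    obtain d2 where d2: "d2 > 0" "\<And>z w. z \<in> ?Q \<Longrightarrow> w \<in> ?Q \<Longrightarrow> dist z w < d2 \<Longrightarrow> dist (am z) (am w) < m0"
      using compact_uniformly_continuous[OF continuous_am compact_cball, of 0 "R + 1"] m0
      unfolding uniformly_continuous_on_def by metis
    \<comment> \<open>The 1 keeps the iterate in the ball of radius \<open>R + 1\<close>;
      \<open>Suc j\<close> makes the time positive, as \<open>scheme_converges\<close>
      requires.\<close>
    let ?d = "min 1 (min d1 d2)" and ?T = "real (Suc j)"
    obtain p h N where p: "central_field p" "\<And>x. h * \<phi> x < 1"
      and conv: "\<And>z. norm z \<le> real k \<Longrightarrow> dist ((step p h ^^ N) z) (flow z ?T) < ?d"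
      using scheme_converges[of ?T ?d "real k"] d1 d2 by auto
    define S where "S = {z. norm z \<le> R + 1 \<and> \<bar>vr z\<bar> \<le> 2 * \<epsilon> \<and> m0 \<le> am z}"
    have Sc: "closed S" unfolding S_def
      by (intro closed_Collect_conj closed_Collect_le continuous_intros continuous_vr continuous_am)
    have Dc: "closed {z. norm z \<le> R + 1 \<and> \<bar>vr z\<bar> \<le> 2 * \<epsilon>}"
      by (intro closed_Collect_conj closed_Collect_le continuous_intros continuous_vr)
    have "emeasure lborel (trapped k \<epsilon> j) \<le> ennreal C * emeasure lborel S"
      unfolding C_def
    proof (rule emeasure_step_le[OF p, where k = N])
      show "trapped k \<epsilon> j \<in> sets borel" by (intro borel_closed closed_trapped)
      show "S \<in> sets borel" using Sc by (rule borel_closed)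
      fix z assume z: "z \<in> trapped k \<epsilon> j"
      then have nz: "norm z \<le> real k" by (simp add: trapped_def)
      let ?w = "(step p h ^^ N) z" and ?y = "flow z ?T"
      have c: "dist ?w ?y < 1" "dist ?w ?y < d1" "dist ?w ?y < d2" using conv[OF nz] by auto
      have y: "norm ?y < R" by (rule R[rule_format, OF nz]) simp
      have w: "norm ?w \<le> R + 1" using c(1) y norm_triangle_ineq2[of ?w ?y] by (simp add: dist_norm)
      have Q: "?w \<in> ?Q" "?y \<in> ?Q" using y w by auto
      have "\<bar>vr ?y\<bar> \<le> \<epsilon>" "2 * m0 \<le> am ?y" using z m0(2) by (auto simp: trapped_def)
      then show "?w \<in> S"
        using d1(2)[OF Q c(2)] d2(2)[OF Q c(3)] w unfolding S_def dist_real_def abs_less_iff by auto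
      have "2 * m0 \<le> am z" using z m0(2) unfolding trapped_def by (metis (mono_tags, lifting) flow_0 mem_Collect_eq order_refl)
      moreover have "norm (am z) \<le> m1" using m1(2) nz by simp
      ultimately show "0 < am z \<and> am z \<le> m1" using m0 by auto
    qed (use m0 m1 in \<open>auto simp: S_def\<close>)
    also have "\<dots> \<le> ennreal C * emeasure lborel {z. norm z \<le> R + 1 \<and> \<bar>vr z\<bar> \<le> 2 * \<epsilon>}"
      by (intro mult_left_mono emeasure_mono) (use Dc in \<open>auto simp: S_def\<close>)
    finally show ?thesis .
  qed
  then show ?thesis by blast
qed

lemma emeasure_vr_strip_tendsto:
  "(\<lambda>i. emeasure lborel {z. norm z \<le> R \<and> \<bar>vr z\<bar> \<le> 2 * (1 / (real i + 1))}) \<longlonglongrightarrow> 0"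
proof -
  let ?S = "\<lambda>i::nat. {z. norm z \<le> R \<and> \<bar>vr z\<bar> \<le> 2 * (1 / (real i + 1))}"
  have cl: "closed (?S i)" for i
    by (intro closed_Collect_conj closed_Collect_le continuous_intros continuous_vr)
  have dec: "decseq ?S"
  proof (rule decseq_SucI, rule subsetI)
    fix i z assume z: "z \<in> ?S (Suc i)"
    have "1 / (real (Suc i) + 1) \<le> 1 / (real i + 1)" by (intro divide_left_mono) auto
    then show "z \<in> ?S i" using z by auto
  qed
  have fin: "emeasure lborel (?S i) \<noteq> \<infinity>" for i
  proof -
    have "emeasure lborel (?S i) \<le> emeasure lborel (cball 0 R :: ('a \<times> 'a) set)" by (intro emeasure_mono) auto
    also have "\<dots> < \<infinity>" by (rule emeasure_bounded_finite) simp
    finally show ?thesis by simp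
  qed
  have "(\<lambda>i. emeasure lborel (?S i)) \<longlonglongrightarrow> emeasure lborel (\<Inter>i. ?S i)"
  proof (rule Lim_emeasure_decseq[OF _ dec fin], rule image_subsetI)
    show "?S i \<in> sets lborel" for i unfolding sets_lborel by (rule borel_closed[OF cl])
  qed
  also have "emeasure lborel (\<Inter>i. ?S i) = 0"
  proof -
    have "(\<Inter>i. ?S i) \<subseteq> {z. vr z = 0}"
    proof
      fix z assume "z \<in> (\<Inter>i. ?S i)"
      then have "\<bar>vr z\<bar> \<le> 2 * (1 / (real i + 1))" for i :: nat by blast
      moreover have "(\<lambda>i::nat. 2 * (1 / (real i + 1))) \<longlonglongrightarrow> 0"
        using tendsto_mult_right_zero[OF LIMSEQ_inverse_real_of_nat, of 2] by (simp add: inverse_eq_divide add.commute)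
      ultimately have "\<bar>vr z\<bar> \<le> 0" by (intro LIMSEQ_le_const) auto
      then show "z \<in> {z. vr z = 0}" by simp
    qed
    then have "emeasure lborel (\<Inter>i. ?S i) \<le> emeasure lborel {z. vr z = 0}"
      using vr_zero_null by (intro emeasure_mono) auto
    then show ?thesis using vr_zero_null by auto
  qed
  finally show ?thesis .
qed

text \<open>For fixed \<epsilon> the trapped sets increase with \<open>j\<close>, so their union
  obeys the same bound; as \<epsilon> tends to 0 the strips shrink to the null set
  \<open>vr = 0\<close>. Working with a Borel null superset avoids measurability of the limit
  condition.\<close>

lemma asymptotically_circular_null_bounded:
  "\<exists>P\<in>null_sets lborel. {z. norm z \<le> real k \<and> (\<forall>t\<ge>0. 1 / (real k + 1) \<le> am (flow z t)) \<and>
     ((\<lambda>t. vr (flow z t)) \<longlongrightarrow> 0) at_top} \<subseteq> P"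
proof -
  obtain R C where le: "\<And>\<epsilon> j. \<epsilon> > 0 \<Longrightarrow> emeasure lborel (trapped k \<epsilon> j)
     \<le> ennreal C * emeasure lborel {z. norm z \<le> R \<and> \<bar>vr z\<bar> \<le> 2 * \<epsilon>}"
    using trapped_measure by blast
  define P where "P = (\<lambda>i::nat. \<Union>j. trapped k (1 / (real i + 1)) j)"
  have tb: "trapped k \<epsilon> j \<in> sets borel" for \<epsilon> j by (intro borel_closed closed_trapped)
  have Pb: "P i \<in> sets lborel" for i unfolding P_def using tb by auto
  have P_le: "emeasure lborel (P i) \<le> ennreal C * emeasure lborel {z. norm z \<le> R \<and> \<bar>vr z\<bar> \<le> 2 * (1 / (real i + 1))}" for i
  proof -
    have "incseq (trapped k \<epsilon>)" for \<epsilon> by (rule incseq_SucI) (auto simp: trapped_def)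
    then have "emeasure lborel (P i) = (SUP j. emeasure lborel (trapped k (1 / (real i + 1)) j))"
      unfolding P_def by (intro SUP_emeasure_incseq[symmetric]) (use tb in auto)
    also have "\<dots> \<le> ennreal C * emeasure lborel {z. norm z \<le> R \<and> \<bar>vr z\<bar> \<le> 2 * (1 / (real i + 1))}"
      by (intro SUP_least le) simp
    finally show ?thesis .
  qed
  have "emeasure lborel (\<Inter>i. P i) \<le> 0"
  proof (rule LIMSEQ_le_const)
    show "(\<lambda>i. ennreal C * emeasure lborel {z. norm z \<le> R \<and> \<bar>vr z\<bar> \<le> 2 * (1 / (real i + 1))}) \<longlonglongrightarrow> 0"
      using ennreal_tendsto_cmult[OF _ emeasure_vr_strip_tendsto, of "ennreal C"] by simp
    have "emeasure lborel (\<Inter>i. P i) \<le> emeasure lborel (P i)" for i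
      using Pb by (intro emeasure_mono) auto
    then show "\<exists>N. \<forall>i\<ge>N. emeasure lborel (\<Inter>i. P i) \<le> ennreal C * emeasure lborel {z. norm z \<le> R \<and> \<bar>vr z\<bar> \<le> 2 * (1 / (real i + 1))}"
      using P_le order_trans by blast
  qed
  then have "(\<Inter>i. P i) \<in> null_sets lborel" using Pb by (intro null_setsI sets.countable_INT) auto
  moreover have "z \<in> (\<Inter>i. P i)" if z: "norm z \<le> real k" "\<forall>t\<ge>0. 1 / (real k + 1) \<le> am (flow z t)"
    "((\<lambda>t. vr (flow z t)) \<longlongrightarrow> 0) at_top" for z
  proof
    fix i :: nat
    have "1 / (real i + 1) > 0" by simp
    from tendstoD[OF z(3) this] obtain T where T: "\<And>t. t \<ge> T \<Longrightarrow> \<bar>vr (flow z t)\<bar> < 1 / (real i + 1)"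
      unfolding eventually_at_top_linorder by (auto simp: dist_real_def)
    obtain j :: nat where "T \<le> real j" using real_arch_simple by blast
    then have "z \<in> trapped k (1 / (real i + 1)) j"
      using z T by (auto simp: trapped_def intro!: less_imp_le)
    then show "z \<in> P i" unfolding P_def by blast
  qed
  ultimately show ?thesis by blast
qed

theorem asymptotically_circular_null:
  "\<exists>P\<in>null_sets lborel. {z. (\<exists>m>0. \<forall>t\<ge>0. m \<le> am (flow z t)) \<and>
     ((\<lambda>t. vr (flow z t)) \<longlongrightarrow> 0) at_top} \<subseteq> P"
proof -
  let ?S = "\<lambda>k::nat. {z. norm z \<le> real k \<and> (\<forall>t\<ge>0. 1 / (real k + 1) \<le> am (flow z t)) \<and>
     ((\<lambda>t. vr (flow z t)) \<longlongrightarrow> 0) at_top}"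
  have "\<forall>k. \<exists>P. P \<in> null_sets lborel \<and> ?S k \<subseteq> P"
    using asymptotically_circular_null_bounded by blast
  from choice[OF this] obtain P where P: "\<And>k. P k \<in> null_sets lborel" "\<And>k. ?S k \<subseteq> P k" by blast
  have "z \<in> (\<Union>k. P k)" if m: "m > 0" "\<forall>t\<ge>0. m \<le> am (flow z t)" and v: "((\<lambda>t. vr (flow z t)) \<longlongrightarrow> 0) at_top" for z m
  proof -
    obtain k :: nat where k: "max (norm z) (1 / m) \<le> real k" using real_arch_simple by blast
    then have "1 / m \<le> real k + 1" by simp
    then have "1 / (real k + 1) \<le> m" using m(1) by (simp add: field_simps)
    then have "\<forall>t\<ge>0. 1 / (real k + 1) \<le> am (flow z t)" using m(2) order_trans by blast
    then have "z \<in> ?S k" using k v by simp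
    then show ?thesis using P(2)[of k] by blast
  qed
  then show ?thesis using P(1) by (intro bexI[of _ "\<Union>k. P k"]) auto
qed

end

section \<open>The two-agent system\<close>

text \<open>A shift by \<open>\<iota> y\<close> preserves the measure of the preimage, so its
  integral over all \<open>y\<close> is this measure times infinity. Exchanging the integrals gives
  measures of translates of \<open>P\<close>, all 0.\<close>

lemma null_sets_vimage_linear_surj:
  fixes T :: "'v::euclidean_space \<Rightarrow> 'w::euclidean_space" and \<iota> :: "'w \<Rightarrow> 'v"
  assumes T: "linear T" and \<iota>: "linear \<iota>" and T\<iota>: "\<And>y. T (\<iota> y) = y" and P: "P \<in> null_sets lborel"
  shows "T -` P \<in> null_sets lborel"
proof
  have Pb [measurable]: "P \<in> sets borel" using P by auto
  have [measurable]: "T \<in> borel_measurable borel" "\<iota> \<in> borel_measurable borel"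
    using T \<iota> by (auto intro!: borel_measurable_continuous_onI linear_continuous_on simp: linear_conv_bounded_linear)
  have TP [measurable]: "T -` P \<in> sets borel"
    by (rule measurable_sets_borel[OF _ Pb]) measurable
  then show "T -` P \<in> sets lborel" by simp
  let ?f = "\<lambda>z. indicator (T -` P) z :: ennreal"
  have m: "(\<lambda>p. ?f (fst p + \<iota> (snd p))) \<in> borel_measurable borel"
  proof -
    have \<iota>c: "continuous_on UNIV \<iota>"
      using \<iota> by (simp add: linear_conv_bounded_linear linear_continuous_on)
    have "(\<lambda>p. fst p + \<iota> (snd p)) \<in> borel_measurable borel"
      by (intro borel_measurable_continuous_onI continuous_on_add continuous_on_fst continuous_on_id
          continuous_on_compose2[OF \<iota>c] continuous_on_snd) auto
    then show ?thesis by (rule measurable_compose) measurable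
  qed
  have "emeasure lborel (T -` P) * \<infinity> = (\<integral>\<^sup>+y. emeasure lborel (T -` P) \<partial>(lborel :: 'w measure))"
    by simp
  also have "\<dots> = (\<integral>\<^sup>+y. \<integral>\<^sup>+z. ?f (z + \<iota> y) \<partial>lborel \<partial>lborel)"
    by (subst nn_integral_lborel_translate) auto
  also have "\<dots> = (\<integral>\<^sup>+z. \<integral>\<^sup>+y. ?f (z + \<iota> y) \<partial>lborel \<partial>lborel)"
    using nn_integral_lborel_pair[OF m] by simp
  also have "\<dots> = (\<integral>\<^sup>+z. 0 \<partial>(lborel :: 'v measure))"
  proof (rule nn_integral_cong)
    fix z
    have "(\<integral>\<^sup>+y. ?f (z + \<iota> y) \<partial>lborel) = (\<integral>\<^sup>+y. indicator P (y + T z) \<partial>lborel)"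
      using T by (simp add: indicator_def linear_add T\<iota> add.commute)
    also have "\<dots> = (\<integral>\<^sup>+y. indicator P y \<partial>lborel)" by (rule nn_integral_lborel_translate) measurable
    also have "\<dots> = 0" using P by (subst nn_integral_indicator) auto
    finally show "(\<integral>\<^sup>+y. ?f (z + \<iota> y) \<partial>lborel) = 0" .
  qed
  finally show "emeasure lborel (T -` P) = 0" by (simp add: ennreal_mult_eq_top_iff)
qed

text \<open>Along the ray in direction \<open>e\<close> the potential is its own profile, up to and
  including the one-sided derivative at \<open>r = 0\<close>.\<close>

lemma profile_deriv_radial:
  fixes U :: "'a::euclidean_space \<Rightarrow> real"
  assumes "\<And>x. U x = U\<^sub>r (norm x)" "\<And>x. GDERIV U x :> G x" "norm e = 1" "0 \<le> r"
  shows "profile_deriv U\<^sub>r r = G (r *\<^sub>R e) \<bullet> e"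
proof -
  have "((\<lambda>t. t *\<^sub>R e) has_derivative (\<lambda>h. h *\<^sub>R e)) (at r within {0..})"
    by (auto intro!: derivative_eq_intros)
  from has_derivative_compose[OF this assms(2)[unfolded gderiv_def]]
  have "((\<lambda>t. U (t *\<^sub>R e)) has_vector_derivative G (r *\<^sub>R e) \<bullet> e) (at r within {0..})"
    by (simp add: has_vector_derivative_def inner_commute)
  then have "(U\<^sub>r has_vector_derivative G (r *\<^sub>R e) \<bullet> e) (at r within {0..})"
    by (rule has_vector_derivative_transform[rotated 2]) (use assms in auto)
  moreover have "at r within {0..} \<noteq> bot"
    using assms(4) at_within_Ici_eq_Icc[of r "r + 1"] by (simp add: trivial_limit_within islimpt_Icc)
  ultimately show ?thesis unfolding profile_deriv_def by (intro vector_derivative_within)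
qed

section \<open>Reduction to relative coordinates\<close>

definition rel_state :: "'n::finite state \<Rightarrow> (real^'n) \<times> (real^'n)" where
  "rel_state z = (rel_pos z, rel_vel z)"

lemma linear_rel_state: "linear rel_state"
  by (rule linearI) (auto simp: rel_state_def rel_pos_def rel_vel_def scaleR_diff_right)

lemma rel_state_preimage_null:
  assumes "P \<in> null_sets lborel"
  shows "(rel_state :: 'n::finite state \<Rightarrow> _) -` P \<in> null_sets lborel"
proof (rule null_sets_vimage_linear_surj[OF linear_rel_state _ _ assms])
  \<comment> \<open>A right inverse of \<open>rel_state\<close>: the second agent is placed at the
    origin, at rest.\<close>
  let ?\<iota> = "\<lambda>y::(real^'n) \<times> (real^'n). ((\<chi> i. if i = 1 then fst y else 0, \<chi> i. if i = 1 then snd y else 0) :: 'n state)"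
  show "linear ?\<iota>" by (rule linearI) (auto simp: vec_eq_iff)
  show "rel_state (?\<iota> y) = y" for y by (simp add: rel_state_def rel_pos_def rel_vel_def)
qed

locale two_agent_system = central_system \<phi> U g u r\<^sub>0
  for \<phi> U :: "real^'n::finite \<Rightarrow> real" and g u r\<^sub>0 +
  assumes phi_even: "\<And>x. \<phi> (- x) = \<phi> x"
begin

lemma gradient_U: "gradient U x = g x"
  by (rule gradient_eq[OF U_gderiv])

lemma phi_diff_commute: "\<phi> (x - y) = \<phi> (y - x)"
  using phi_even[of "x - y"] by simp

lemma g_diff_commute: "g (x - y) = - g (y - x)"
  using g_odd[of "y - x"] by simp

text \<open>The self-interaction drops out because v_i - v_i = 0 and \<open>g 0 = 0\<close>;
  evenness of \<phi> and oddness of \<open>g\<close> make the two accelerations opposite.\<close>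

lemma is_solution_iff:
  "is_solution \<phi> U z \<longleftrightarrow> (\<forall>t\<ge>0.
     ((\<lambda>s. fst (z s) $ 1) has_vector_derivative snd (z t) $ 1) (at t within {0..}) \<and>
     ((\<lambda>s. fst (z s) $ 2) has_vector_derivative snd (z t) $ 2) (at t within {0..}) \<and>
     ((\<lambda>s. snd (z s) $ 1) has_vector_derivative
        (1/2) *\<^sub>R (- (\<phi> (rel_pos (z t)) *\<^sub>R rel_vel (z t)) - g (rel_pos (z t)))) (at t within {0..}) \<and>
     ((\<lambda>s. snd (z s) $ 2) has_vector_derivative
        - (1/2) *\<^sub>R (- (\<phi> (rel_pos (z t)) *\<^sub>R rel_vel (z t)) - g (rel_pos (z t)))) (at t within {0..}))"
proof -
  have 1: "(1/2) *\<^sub>R (\<Sum>j\<in>UNIV. \<phi> (fst w $ 1 - fst w $ j) *\<^sub>R (snd w $ j - snd w $ 1))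
         - (1/2) *\<^sub>R (\<Sum>j\<in>UNIV. gradient U (fst w $ 1 - fst w $ j))
      = (1/2) *\<^sub>R (- (\<phi> (rel_pos w) *\<^sub>R rel_vel w) - g (rel_pos w))" for w :: "'n state"
    by (simp add: sum_2 gradient_U g_0 rel_pos_def rel_vel_def algebra_simps)
  have 2: "(1/2) *\<^sub>R (\<Sum>j\<in>UNIV. \<phi> (fst w $ 2 - fst w $ j) *\<^sub>R (snd w $ j - snd w $ 2))
         - (1/2) *\<^sub>R (\<Sum>j\<in>UNIV. gradient U (fst w $ 2 - fst w $ j))
      = - (1/2) *\<^sub>R (- (\<phi> (rel_pos w) *\<^sub>R rel_vel w) - g (rel_pos w))" for w :: "'n state"
    unfolding sum_2 gradient_U rel_pos_def rel_vel_def phi_diff_commute[of "fst w $ 2" "fst w $ 1"]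
      g_diff_commute[of "fst w $ 2" "fst w $ 1"]
    by (simp add: g_0 algebra_simps)
  show ?thesis unfolding is_solution_def forall_2 1 2 by blast
qed

lemma is_solution_imp_relative:
  assumes "is_solution \<phi> U z"
  shows "ode_solution fld (\<lambda>t. rel_state (z t))"
  unfolding ode_solution_def
proof (intro allI impI)
  fix t :: real assume t: "0 \<le> t"
  let ?a = "- (\<phi> (rel_pos (z t)) *\<^sub>R rel_vel (z t)) - g (rel_pos (z t))"
  note d = assms[unfolded is_solution_iff, rule_format, OF t]
  have "((\<lambda>s. fst (z s) $ 1 - fst (z s) $ 2) has_vector_derivative snd (z t) $ 1 - snd (z t) $ 2) (at t within {0..})"
    using d by (intro has_vector_derivative_diff) auto
  moreover have "((\<lambda>s. snd (z s) $ 1 - snd (z s) $ 2) has_vector_derivative (1/2) *\<^sub>R ?a - (- (1/2) *\<^sub>R ?a)) (at t within {0..})"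
    using d by (intro has_vector_derivative_diff) auto
  moreover have "(1/2) *\<^sub>R ?a - (- (1/2) *\<^sub>R ?a) = ?a" by (simp flip: scaleR_left_diff_distrib scaleR_left_distrib)
  ultimately show "((\<lambda>t. rel_state (z t)) has_vector_derivative fld (rel_state (z t))) (at t within {0..})"
    unfolding rel_state_def fld_def rel_pos_def rel_vel_def fst_conv snd_conv
    by (intro has_vector_derivative_Pair) simp_all
qed

text \<open>The accelerations cancel in the sum, so the centre of mass moves uniformly; adding plus
  and minus half the relative flow gives both agents.\<close>

lemma is_solution_exists: "\<exists>z. is_solution \<phi> U z \<and> z 0 = z\<^sub>0"
proof -
  define y where "y = flow (rel_state z\<^sub>0)"
  define V where "V = (1/2) *\<^sub>R (snd z\<^sub>0 $ 1 + snd z\<^sub>0 $ 2)"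
  define X where "X = (\<lambda>t. (1/2) *\<^sub>R (fst z\<^sub>0 $ 1 + fst z\<^sub>0 $ 2) + t *\<^sub>R V)"
  define z :: "real \<Rightarrow> 'n state" where
    "z = (\<lambda>t. (\<chi> i. if i = 1 then X t + (1/2) *\<^sub>R fst (y t) else X t - (1/2) *\<^sub>R fst (y t),
               \<chi> i. if i = 1 then V + (1/2) *\<^sub>R snd (y t) else V - (1/2) *\<^sub>R snd (y t)))"
  have half: "(1/2) *\<^sub>R a + (1/2) *\<^sub>R a = a" for a :: "real^'n"
    by (simp flip: scaleR_left_distrib)
  have rel: "rel_pos (z t) = fst (y t)" "rel_vel (z t) = snd (y t)" for t
    using half[of "fst (y t)"] half[of "snd (y t)"] by (simp_all add: z_def rel_pos_def rel_vel_def)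
  have sol: "is_solution \<phi> U z"
    unfolding is_solution_iff rel
  proof (intro allI impI)
    fix t :: real assume t: "0 \<le> t"
    have y: "(y has_vector_derivative fld (y t)) (at t within {0..})"
      unfolding y_def by (rule flow_deriv[OF t])
    note [derivative_intros] = fst_deriv[OF y] snd_deriv[OF y]
    have X: "(X has_vector_derivative V) (at t within {0..})"
      unfolding X_def by (auto intro!: derivative_eq_intros)
    have V: "((\<lambda>_. V) has_vector_derivative 0) (at t within {0..})" by simp
    have h: "((\<lambda>s. (1/2) *\<^sub>R f s) has_vector_derivative (1/2) *\<^sub>R f') (at t within {0..})"
      if "(f has_vector_derivative f') (at t within {0..})" for f :: "real \<Rightarrow> real^'n" and f'
      using that by (rule bounded_linear.has_vector_derivative[OF bounded_linear_scaleR_right])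
    show "((\<lambda>s. fst (z s) $ 1) has_vector_derivative snd (z t) $ 1) (at t within {0..}) \<and>
     ((\<lambda>s. fst (z s) $ 2) has_vector_derivative snd (z t) $ 2) (at t within {0..}) \<and>
     ((\<lambda>s. snd (z s) $ 1) has_vector_derivative
        (1/2) *\<^sub>R (- (\<phi> (fst (y t)) *\<^sub>R snd (y t)) - g (fst (y t)))) (at t within {0..}) \<and>
     ((\<lambda>s. snd (z s) $ 2) has_vector_derivative
        - (1/2) *\<^sub>R (- (\<phi> (fst (y t)) *\<^sub>R snd (y t)) - g (fst (y t)))) (at t within {0..})"
      using has_vector_derivative_add[OF X h[OF fst_deriv[OF y]]] has_vector_derivative_diff[OF X h[OF fst_deriv[OF y]]]
        has_vector_derivative_add[OF V h[OF snd_deriv[OF y]]] has_vector_derivative_diff[OF V h[OF snd_deriv[OF y]]]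
      by (simp add: z_def)
  qed
  have y0: "fst (y 0) = fst z\<^sub>0 $ 1 - fst z\<^sub>0 $ 2" "snd (y 0) = snd z\<^sub>0 $ 1 - snd z\<^sub>0 $ 2"
    by (simp_all add: y_def rel_state_def rel_pos_def rel_vel_def)
  have "(1/2) *\<^sub>R (a + b) + (1/2) *\<^sub>R (a - b) = a" "(1/2) *\<^sub>R (a + b) - (1/2) *\<^sub>R (a - b) = b" for a b :: "real^'n"
    using half[of a] half[of b] by (simp_all add: scaleR_right_distrib scaleR_diff_right)
  then have "z 0 = z\<^sub>0"
    unfolding z_def y0 X_def V_def by (intro prod_eqI) (simp_all add: vec_eq_iff[where 'b = 2] forall_2)
  with sol show ?thesis by blast
qed

text \<open>Whichever solution \<open>SOME\<close> selects, its relative coordinates solve the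
  relative system, where uniqueness holds.\<close>

lemma rel_state_solution:
  assumes "0 \<le> t"
  shows "rel_state (solution \<phi> U z\<^sub>0 t) = flow (rel_state z\<^sub>0) t"
proof -
  have "is_solution \<phi> U (solution \<phi> U z\<^sub>0) \<and> solution \<phi> U z\<^sub>0 0 = z\<^sub>0"
    unfolding solution_def by (rule someI_ex[OF is_solution_exists])
  then show ?thesis
    using solution_unique[OF is_solution_imp_relative flow_solution _ assms, of "solution \<phi> U z\<^sub>0" "rel_state z\<^sub>0"] by simp
qed

lemma energy_0_imp_flocking:
  assumes "((\<lambda>t. en (flow z t)) \<longlongrightarrow> 0) at_top"
  shows "((\<lambda>t. U (fst (flow z t)) + norm (snd (flow z t))) \<longlongrightarrow> 0) at_top"
proof (rule Lim_null_comparison)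
  have "U (fst w) + norm (snd w) \<le> en w + sqrt (2 * en w)" for w
  proof -
    have "U (fst w) \<le> en w" "snd w \<bullet> snd w \<le> 2 * en w"
      using U_nonneg[of "fst w"] by (auto simp: en_def)
    then show ?thesis by (intro add_mono) (auto simp: norm_eq_sqrt_inner)
  qed
  then show "\<forall>\<^sub>F t in at_top. norm (U (fst (flow z t)) + norm (snd (flow z t))) \<le> en (flow z t) + sqrt (2 * en (flow z t))"
    by (simp add: U_nonneg)
  have "((\<lambda>t. en (flow z t) + sqrt (2 * en (flow z t))) \<longlongrightarrow> 0 + sqrt (2 * 0)) at_top"
    by (intro tendsto_intros assms)
  then show "((\<lambda>t. en (flow z t) + sqrt (2 * en (flow z t))) \<longlongrightarrow> 0) at_top" by simp
qed

text \<open>An interacting datum enters the ball of radius \<open>r\<^sub>0\<close> at some time.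
  With positive limit energy it would then be asymptotically circular with angular momentum bounded
  below, which places its relative state in the null set \<open>P\<close>.\<close>

theorem almost_every_flocking:
  "AE z\<^sub>0 in lebesgue. z\<^sub>0 \<notin> noninteracting_data \<phi> U r\<^sub>0 \<longrightarrow>
     ((\<lambda>t. U (rel_pos (solution \<phi> U z\<^sub>0 t)) + norm (rel_vel (solution \<phi> U z\<^sub>0 t))) \<longlongrightarrow> 0) at_top"
proof -
  obtain P where P: "P \<in> null_sets lborel"
    "{z. (\<exists>m>0. \<forall>t\<ge>0. m \<le> am (flow z t)) \<and> ((\<lambda>t. vr (flow z t)) \<longlongrightarrow> 0) at_top} \<subseteq> P"
    using asymptotically_circular_null by blast
  have "AE z\<^sub>0 in lborel. z\<^sub>0 \<notin> (rel_state :: 'n state \<Rightarrow> _) -` P"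
    by (rule AE_not_in[OF rel_state_preimage_null[OF P(1)]])
  then have "AE z\<^sub>0 in lebesgue. z\<^sub>0 \<notin> (rel_state :: 'n state \<Rightarrow> _) -` P"
    by (rule AE_completion)
  then show ?thesis
  proof eventually_elim
    case (elim z\<^sub>0)
    let ?z = "rel_state z\<^sub>0"
    have rel: "rel_pos (solution \<phi> U z\<^sub>0 t) = fst (flow ?z t)" "rel_vel (solution \<phi> U z\<^sub>0 t) = snd (flow ?z t)"
      if "0 \<le> t" for t
      using rel_state_solution[OF that, of z\<^sub>0] unfolding rel_state_def by (auto simp: prod_eq_iff)
    show ?case
    proof
      assume "z\<^sub>0 \<notin> noninteracting_data \<phi> U r\<^sub>0"
      then obtain t1 where t1: "0 \<le> t1" "norm (fst (flow ?z t1)) < r\<^sub>0"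
        using rel(1) by (auto simp: noninteracting_data_def not_le)
      obtain E where E: "((\<lambda>t. en (flow ?z t)) \<longlongrightarrow> E) at_top" using en_tendsto by blast
      have "E \<ge> 0" by (rule tendsto_lowerbound[OF E]) (auto simp: en_nonneg)
      moreover have "\<not> E > 0"
      proof
        assume "E > 0"
        from am_tendsto_pos[OF E this] positive_energy_imp_asymptotically_circular[OF E this t1]
        have "?z \<in> P" using P(2) by blast
        then show False using elim by simp
      qed
      ultimately have "((\<lambda>t. U (fst (flow ?z t)) + norm (snd (flow ?z t))) \<longlongrightarrow> 0) at_top"
        using E by (intro energy_0_imp_flocking) simp
      moreover have "\<forall>\<^sub>F t in at_top. U (fst (flow ?z t)) + norm (snd (flow ?z t))
          = U (rel_pos (solution \<phi> U z\<^sub>0 t)) + norm (rel_vel (solution \<phi> U z\<^sub>0 t))"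
        using eventually_ge_at_top[of 0] by eventually_elim (simp add: rel)
      ultimately show "((\<lambda>t. U (rel_pos (solution \<phi> U z\<^sub>0 t)) + norm (rel_vel (solution \<phi> U z\<^sub>0 t))) \<longlongrightarrow> 0) at_top"
        by (rule Lim_transform_eventually)
    qed
  qed
qed

end

theorem theorem4p5:
  fixes \<phi> U :: "real^'n::finite \<Rightarrow> real"
    and \<phi>\<^sub>r U\<^sub>r :: "real \<Rightarrow> real"
    and r\<^sub>0 :: real
  assumes r0_pos: "r\<^sub>0 > 0"
    and phi_smooth: "smooth \<phi>"
    and phi_radial: "\<forall>x. \<phi> x = \<phi>\<^sub>r (norm x)"
    and phi_nonneg: "\<forall>x. \<phi> x \<ge> 0"
    and phi_pos: "\<forall>x. norm x < r\<^sub>0 \<longrightarrow> \<phi> x > 0"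
    and phi_zero: "\<forall>x. norm x \<ge> r\<^sub>0 \<longrightarrow> \<phi> x = 0"
    and U_Sobolev: "W_inf_loc 2 U"
    and U_continuous: "continuous_on UNIV U"
    and U_radial: "\<forall>x. U x = U\<^sub>r (norm x)"
    and U_nonneg: "\<forall>r\<ge>0. U\<^sub>r r \<ge> 0"
    and U_infinity: "filterlim U\<^sub>r at_top at_top"
    and U_phi: "\<forall>r\<ge>0. profile_deriv U\<^sub>r r * profile_deriv \<phi>\<^sub>r r \<le> 0"
    and U_deriv_lower: "\<forall>R>0. \<exists>c>0. \<forall>r. 0 \<le> r \<and> r < R \<longrightarrow>
           \<bar>profile_deriv U\<^sub>r r\<bar>\<^sup>2 \<ge> c * \<bar>U\<^sub>r r\<bar>"
  shows "AE z\<^sub>0 in lebesgue. z\<^sub>0 \<notin> noninteracting_data \<phi> U r\<^sub>0 \<longrightarrow>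
           ((\<lambda>t. U (rel_pos (solution \<phi> U z\<^sub>0 t)) + norm (rel_vel (solution \<phi> U z\<^sub>0 t))) \<longlongrightarrow> 0) at_top"
proof -
  obtain g where G: "\<And>x. GDERIV U x :> g x" and g_lip: "\<And>R. \<exists>L. L-lipschitz_on (cball 0 R) g"
    using W_2_inf_imp_C_1_1[OF U_Sobolev U_continuous] by blast
  \<comment> \<open>Compact support turns smoothness into a global Lipschitz bound.\<close>
  have "test_function \<phi>"
    unfolding test_function_def using phi_smooth phi_zero by (intro conjI exI[of _ "cball 0 r\<^sub>0"]) auto
  then have phi_lip: "\<exists>L. L-lipschitz_on UNIV \<phi>" by (rule test_function_lipschitz)
  have g0: "U x = 0" if gx: "g x = 0" for x
  proof -
    \<comment> \<open>The direction of \<open>x\<close>; at \<open>x = 0\<close> any unit vector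
      serves, since \<open>norm x *\<^sub>R e = x\<close> still holds.\<close>
    define e :: "real^'n" where "e = (if x = 0 then SOME b. b \<in> Basis else (1 / norm x) *\<^sub>R x)"
    have e: "norm e = 1" "norm x *\<^sub>R e = x" by (auto simp: e_def SOME_Basis)
    have "profile_deriv U\<^sub>r (norm x) = g (norm x *\<^sub>R e) \<bullet> e"
      by (rule profile_deriv_radial[OF _ G e(1)]) (use U_radial in auto)
    then have "profile_deriv U\<^sub>r (norm x) = 0" using gx by (simp add: e)
    moreover obtain c where "c > 0" and c: "\<forall>r. 0 \<le> r \<and> r < norm x + 1 \<longrightarrow> \<bar>profile_deriv U\<^sub>r r\<bar>\<^sup>2 \<ge> c * \<bar>U\<^sub>r r\<bar>"
      using U_deriv_lower[rule_format, of "norm x + 1"] by (auto simp: add_nonneg_pos)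
    ultimately have "c * \<bar>U\<^sub>r (norm x)\<bar> \<le> 0" using c[rule_format, of "norm x"] by simp
    then have "U\<^sub>r (norm x) = 0" using \<open>c > 0\<close> by (simp add: mult_le_0_iff)
    then show ?thesis using U_radial by simp
  qed
  interpret two_agent_system \<phi> U g U\<^sub>r r\<^sub>0
    by unfold_locales (use assms G g_lip phi_lip g0 in auto)
  show ?thesis by (rule almost_every_flocking)
qed

end
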